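(* $\mathrm{MFD}_{\mathbb Z}$ can be approximated within a factor $\lceil\log\Vert X\Vert\rceil+1$ in time $O(m(n+\mathrm{width}(G)\lceil\log\Vert X\Vert\rceil))$. That is, there is an algorithm which, given an $s$-$t$ DAG $G=(V,E)$ with $n$ nodes and $m$ edges and a non-zero flow $X\colon E\to\mathbb Z$, outputs within this running time a flow decomposition of $(G,X)$ with weights in $\mathbb Z$ of size at most $(\lceil\log\Vert X\Vert\rceil+1)\cdot\mathrm{mfd}_{\mathbb Z}(G,X)$.
   Context: An $s$-$t$ DAG is a directed acyclic graph $G=(V,E)$ with a unique source $s$ (no in-edges) and a unique sink $t$ (no out-edges). A flow is a function $X$ on $E$ such that at every node of $V\setminus\{s,t\}$ incoming flow equals outgoing flow. $\Vert X\Vert=\max_{e\in E}|X(e)|$. $\mathrm{width}(G)$ is the minimum number of $s$-$t$ paths needed to cover all edges of $G$. An $s$-$t$ path $P$ is identified with the flow that is $1$ on the edges of $P$ and $0$ elsewhere. A flow decomposition of $(G,X)$ of size $k$ with weights in $\mathbb Z$ is a family of $s$-$t$ paths $P_1,\dots,P_k$ with weights $w_1,\dots,w_k\in\mathbb Z$ such that $X=w_1P_1+\dots+w_kP_k$; $\mathrm{mfd}_{\mathbb Z}(G,X)$ is the smallest size of such a decomposition, and $\mathrm{MFD}_{\mathbb Z}$ is the problem of finding one of smallest size. Logarithms are base $2$. Running times count arithmetic operations on numbers as unit-cost. *)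

theory Defs
  imports Complex_Main "Graph_Theory.Digraph" "Graph_Theory.Arc_Walk"
begin

section \<open>Flows in s-t DAGs\<close>

text \<open>Parallel arcs are allowed; simple digraphs are the special case in which
  the pair of endpoints determines the arc. Acyclicity excludes loops.\<close>

locale st_dag = fin_digraph G for G :: "('a, 'b) pre_digraph" +
  fixes s t :: 'a
  assumes acyclic: "\<nexists>p. cycle p"
    and unique_source: "{v \<in> verts G. in_arcs G v = {}} = {s}"
    and unique_sink: "{v \<in> verts G. out_arcs G v = {}} = {t}"

definition is_flow :: "('a, 'b) pre_digraph \<Rightarrow> 'a \<Rightarrow> 'a \<Rightarrow> ('b \<Rightarrow> int) \<Rightarrow> bool" where
  "is_flow G s t X \<longleftrightarrow>
     (\<forall>v \<in> verts G - {s, t}. (\<Sum>e \<in> in_arcs G v. X e) = (\<Sum>e \<in> out_arcs G v. X e))"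

text \<open>Only meaningful if \<open>G\<close> has at least one arc and finitely many.\<close>

definition flow_norm :: "('a, 'b) pre_digraph \<Rightarrow> ('b \<Rightarrow> int) \<Rightarrow> int" where
  "flow_norm G X = Max ((\<lambda>e. \<bar>X e\<bar>) ` arcs G)"

definition st_path :: "('a, 'b) pre_digraph \<Rightarrow> 'a \<Rightarrow> 'a \<Rightarrow> 'b list \<Rightarrow> bool" where
  "st_path G s t P \<longleftrightarrow> pre_digraph.apath G s P t"

definition path_flow :: "'b list \<Rightarrow> 'b \<Rightarrow> int" where
  "path_flow P e = (if e \<in> set P then 1 else 0)"

definition path_cover :: "('a, 'b) pre_digraph \<Rightarrow> 'a \<Rightarrow> 'a \<Rightarrow> 'b list list \<Rightarrow> bool" where
  "path_cover G s t Ps \<longleftrightarrow>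
     (\<forall>P \<in> set Ps. st_path G s t P) \<and> (\<forall>e \<in> arcs G. \<exists>P \<in> set Ps. e \<in> set P)"

definition width :: "('a, 'b) pre_digraph \<Rightarrow> 'a \<Rightarrow> 'a \<Rightarrow> nat" where
  "width G s t = (LEAST k. \<exists>Ps. path_cover G s t Ps \<and> length Ps = k)"

definition flow_decomposition ::
  "('a, 'b) pre_digraph \<Rightarrow> 'a \<Rightarrow> 'a \<Rightarrow> ('b \<Rightarrow> int) \<Rightarrow> (int \<times> 'b list) list \<Rightarrow> bool" where
  "flow_decomposition G s t X D \<longleftrightarrow>
     (\<forall>(w, P) \<in> set D. st_path G s t P) \<and>
     (\<forall>e \<in> arcs G. X e = (\<Sum>(w, P) \<leftarrow> D. w * path_flow P e))"

definition mfd_int :: "('a, 'b) pre_digraph \<Rightarrow> 'a \<Rightarrow> 'a \<Rightarrow> ('b \<Rightarrow> int) \<Rightarrow> nat" where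
  "mfd_int G s t X = (LEAST k. \<exists>D. flow_decomposition G s t X D \<and> length D = k)"


section \<open>A unit-cost random access machine\<close>

text \<open>
  Algorithms are programs of a while language over integer variables and integer arrays.
  Every constant, variable or array access, arithmetic operation, comparison, Boolean
  connective, assignment and branch costs one time unit, whatever the size of the numbers
  involved. A program mentions only finitely many variables and arrays, so its arrays can be
  interleaved in the memory of a random access machine with constant overhead.

  The arithmetic operations are addition, subtraction and halving with rounding down.
  General multiplication is deliberately left out: this way a single step lengthens the
  binary representation of the numbers by at most one bit, and unit cost cannot be abused
  to pack large computations into few operations on huge numbers.
\<close>

datatype exp =
    Const int
  | Var string
  | Elem string exp
  | Add exp exp
  | Sub exp exp
  | Half exp

datatype cond =
    Less exp exp
  | Not cond
  | And cond cond

datatype prog =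
    Assign string exp
  | Store string exp exp  \<comment> \<open>array, index, value\<close>
  | Seq prog prog
  | If cond prog prog
  | While cond prog

record state =
  scalar :: "string \<Rightarrow> int"
  arr :: "string \<Rightarrow> int \<Rightarrow> int"

primrec eval_exp :: "exp \<Rightarrow> state \<Rightarrow> int" where
  "eval_exp (Const k) \<sigma> = k"
| "eval_exp (Var x) \<sigma> = scalar \<sigma> x"
| "eval_exp (Elem a i) \<sigma> = arr \<sigma> a (eval_exp i \<sigma>)"
| "eval_exp (Add e f) \<sigma> = eval_exp e \<sigma> + eval_exp f \<sigma>"
| "eval_exp (Sub e f) \<sigma> = eval_exp e \<sigma> - eval_exp f \<sigma>"
| "eval_exp (Half e) \<sigma> = eval_exp e \<sigma> div 2"

primrec eval_cond :: "cond \<Rightarrow> state \<Rightarrow> bool" where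
  "eval_cond (Less e f) \<sigma> \<longleftrightarrow> eval_exp e \<sigma> < eval_exp f \<sigma>"
| "eval_cond (Not b) \<sigma> \<longleftrightarrow> \<not> eval_cond b \<sigma>"
| "eval_cond (And b c) \<sigma> \<longleftrightarrow> eval_cond b \<sigma> \<and> eval_cond c \<sigma>"

primrec cost_exp :: "exp \<Rightarrow> nat" where
  "cost_exp (Const k) = 1"
| "cost_exp (Var x) = 1"
| "cost_exp (Elem a i) = 1 + cost_exp i"
| "cost_exp (Add e f) = 1 + cost_exp e + cost_exp f"
| "cost_exp (Sub e f) = 1 + cost_exp e + cost_exp f"
| "cost_exp (Half e) = 1 + cost_exp e"

primrec cost_cond :: "cond \<Rightarrow> nat" where
  "cost_cond (Less e f) = 1 + cost_exp e + cost_exp f"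
| "cost_cond (Not b) = 1 + cost_cond b"
| "cost_cond (And b c) = 1 + cost_cond b + cost_cond c"

text \<open>\<open>runs c \<sigma> \<tau> \<sigma>'\<close>: started in \<open>\<sigma>\<close>, program \<open>c\<close> terminates in \<open>\<sigma>'\<close> after \<open>\<tau>\<close> time units.\<close>

inductive runs :: "prog \<Rightarrow> state \<Rightarrow> nat \<Rightarrow> state \<Rightarrow> bool" where
  Assign: "runs (Assign x e) \<sigma> (1 + cost_exp e)
             (\<sigma>\<lparr>scalar := (scalar \<sigma>)(x := eval_exp e \<sigma>)\<rparr>)"
| Store: "runs (Store a i e) \<sigma> (1 + cost_exp i + cost_exp e)
             (\<sigma>\<lparr>arr := (arr \<sigma>)(a := (arr \<sigma> a)(eval_exp i \<sigma> := eval_exp e \<sigma>))\<rparr>)"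
| Seq: "runs c \<sigma> \<tau> \<sigma>' \<Longrightarrow> runs d \<sigma>' \<tau>' \<sigma>'' \<Longrightarrow> runs (Seq c d) \<sigma> (\<tau> + \<tau>') \<sigma>''"
| IfTrue: "eval_cond b \<sigma> \<Longrightarrow> runs c \<sigma> \<tau> \<sigma>' \<Longrightarrow> runs (If b c d) \<sigma> (1 + cost_cond b + \<tau>) \<sigma>'"
| IfFalse: "\<not> eval_cond b \<sigma> \<Longrightarrow> runs d \<sigma> \<tau> \<sigma>' \<Longrightarrow> runs (If b c d) \<sigma> (1 + cost_cond b + \<tau>) \<sigma>'"
| WhileFalse: "\<not> eval_cond b \<sigma> \<Longrightarrow> runs (While b c) \<sigma> (1 + cost_cond b) \<sigma>"
| WhileTrue: "eval_cond b \<sigma> \<Longrightarrow> runs c \<sigma> \<tau> \<sigma>' \<Longrightarrow> runs (While b c) \<sigma>' \<tau>' \<sigma>'' \<Longrightarrow>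
    runs (While b c) \<sigma> (1 + cost_cond b + \<tau> + \<tau>') \<sigma>''"

inductive_cases runs_AssignE: "runs (Assign x e) \<sigma> \<tau> \<sigma>'"
  and runs_StoreE: "runs (Store a i e) \<sigma> \<tau> \<sigma>'"
  and runs_SeqE: "runs (Seq c d) \<sigma> \<tau> \<sigma>'"
  and runs_IfE: "runs (If b c d) \<sigma> \<tau> \<sigma>'"
  and runs_WhileE: "runs (While b c) \<sigma> \<tau> \<sigma>'"

lemma runs_deterministic:
  "runs c \<sigma> \<tau> \<sigma>' \<Longrightarrow> runs c \<sigma> \<tau>' \<sigma>'' \<Longrightarrow> \<tau>' = \<tau> \<and> \<sigma>'' = \<sigma>'"
proof (induction arbitrary: \<tau>' \<sigma>'' rule: runs.induct)
  case (Assign x e \<sigma>)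
  then show ?case by (elim runs_AssignE) simp
next
  case (Store a i e \<sigma>)
  then show ?case by (elim runs_StoreE) simp
next
  case (Seq c \<sigma> \<tau>1 \<sigma>1 d \<tau>2 \<sigma>2)
  from Seq.prems show ?case by (rule runs_SeqE) (metis Seq.IH)
next
  case (IfTrue b \<sigma> c \<tau>1 \<sigma>1 d)
  from IfTrue.prems show ?case by (rule runs_IfE) (use IfTrue.hyps in \<open>auto dest: IfTrue.IH\<close>)
next
  case (IfFalse b \<sigma> d \<tau>1 \<sigma>1 c)
  from IfFalse.prems show ?case by (rule runs_IfE) (use IfFalse.hyps in \<open>auto dest: IfFalse.IH\<close>)
next
  case (WhileFalse b \<sigma> c)
  from WhileFalse.prems show ?case by (rule runs_WhileE) (use WhileFalse.hyps in simp_all)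
next
  case (WhileTrue b \<sigma> c \<tau>1 \<sigma>1 \<tau>2 \<sigma>2)
  from WhileTrue.prems show ?case by (rule runs_WhileE) (use WhileTrue.hyps in \<open>auto dest: WhileTrue.IH\<close>)
qed


section \<open>Encoding of instances and solutions\<close>

text \<open>As usual for graph algorithms, the nodes and the arcs of an input graph are numbered
  consecutively from 0, in an arbitrary order.\<close>

definition numbered :: "(nat, nat) pre_digraph \<Rightarrow> bool" where
  "numbered G \<longleftrightarrow> verts G = {..<card (verts G)} \<and> arcs G = {..<card (arcs G)}"

definition input_array :: "nat \<Rightarrow> (nat \<Rightarrow> int) \<Rightarrow> int \<Rightarrow> int" where
  "input_array m f i = (if 0 \<le> i \<and> i < int m then f (nat i) else 0)"

definition initial_state ::
  "(nat, nat) pre_digraph \<Rightarrow> nat \<Rightarrow> nat \<Rightarrow> (nat \<Rightarrow> int) \<Rightarrow> state" where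
  "initial_state G s t X = \<lparr>
     scalar = (\<lambda>_. 0)(''n'' := int (card (verts G)), ''m'' := int (card (arcs G)),
                      ''s'' := int s, ''t'' := int t),
     arr = (\<lambda>_ _. 0)(''tail'' := input_array (card (arcs G)) (\<lambda>e. int (tail G e)),
                     ''head'' := input_array (card (arcs G)) (\<lambda>e. int (head G e)),
                     ''flow'' := input_array (card (arcs G)) X)\<rparr>"

text \<open>The \<open>i\<close>-th path of the output is the list of arcs stored in the cells
  \<open>start[i], \<dots>, start[i+1] - 1\<close> of the array \<open>path\<close>.\<close>

definition outputs :: "state \<Rightarrow> (int \<times> nat list) list \<Rightarrow> bool" where
  "outputs \<sigma> D \<longleftrightarrow>
     scalar \<sigma> ''size'' = int (length D) \<and>
     (\<forall>i < length D.
        arr \<sigma> ''weight'' (int i) = fst (D ! i) \<and>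
        map (arr \<sigma> ''path'') [arr \<sigma> ''start'' (int i) .. arr \<sigma> ''start'' (int i + 1) - 1]
          = map int (snd (D ! i)))"

end

(*
  Any two paths of G cross a set R that no arc leaves at most once, so every cover of the
  support of X by s-t paths, in particular every decomposition of X, has at least as many paths
  as there are support arcs entering R. Let F be a minimum flow that is at least 1 on the support
  of X; its value equals such a cut, hence it is at most mfd(G, X) and at most width(G).

  Every circulation W (close G by an arc from t to s) has a parity fix: a circulation with values
  in {-1, 0, 1} that agrees with W modulo 2. It is found in linear time by walking along unused
  odd arcs, ignoring their directions: a walk can only get stuck where it started.
  Let Y be the parity fix of X and Z that of F + Y, with the sign of Z chosen such that its value
  is not positive. Then A = (F + Y + Z) / 2 and B = (F - Y + Z) / 2 are nonnegative integral flows
  with Y = A - B and A + B = F + Z, so Y is decomposed with weights 1 and -1 into at most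
  |F| paths. Replacing X by (X - Y) / 2 halves the norm and does not enlarge the support. After
  at most ceil(log ||X||) such steps the norm is at most 1, and then Y = X finishes.

  The flow F is found by push-relabel from F = 1 on the support, moving the units of excess one
  at a time to the nodes with a deficit; units stuck at a node of label n are sent to t in the
  end, and the remaining deficits are filled from s. As there are at most m units, all of them
  make O(nm) pushes altogether.
*)

theory Submission
  imports Defs
begin

section \<open>Total correctness with running times\<close>

text \<open>Emitting a level costs as much as the paths written are long, so the time bound needs
  their total length to be at most \<open>n\<close> times the value of F. Acyclicity provides this:
  every arc but the return arc raises a topological rank, and in a circulation all these gains are
  undone on the return arc. A level thus costs O(m + n |F|), and n is at most m + 1, so the part of
  the cost that grows with the number of levels is within O(m width) per level. When the norm is 1,
  the logarithm is 0 and nothing may be charged to the width; the level that remains is charged to n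
  m, through |F| at most m. F is computed only once, because halving never enlarges the support on
  which it is at least 1. This also makes F dominate the parity fix Y: 2 A = F + Y + Z is then at
  least -1 and even, hence nonnegative. The sign of Z matters on the return arc, where A + B = F + Z
  counts the paths. Minimality of F is never discussed among all flows: \<open>drain\<close> leaves
  a node set R as a certificate, \<open>settle\<close> preserves it, and at the end the value of F
  is read off as the cut of R.\<close>

primrec loop_free :: "prog \<Rightarrow> bool" where
  "loop_free (Assign x e) = True"
| "loop_free (Store a i e) = True"
| "loop_free (Seq c d) = (loop_free c \<and> loop_free d)"
| "loop_free (If b c d) = (loop_free c \<and> loop_free d)"
| "loop_free (While b c) = False"

text \<open>Symbolic execution of loop-free code: a loop body becomes a single state transformation.
  The clause for \<open>While\<close> is a dummy, like the one of \<open>max_cost\<close>; both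
  functions are applied to loop-free programs only.\<close>

primrec exec :: "prog \<Rightarrow> state \<Rightarrow> state" where
  "exec (Assign x e) \<sigma> = \<sigma>\<lparr>scalar := (scalar \<sigma>)(x := eval_exp e \<sigma>)\<rparr>"
| "exec (Store a i e) \<sigma> = \<sigma>\<lparr>arr := (arr \<sigma>)(a := (arr \<sigma> a)(eval_exp i \<sigma> := eval_exp e \<sigma>))\<rparr>"
| "exec (Seq c d) \<sigma> = exec d (exec c \<sigma>)"
| "exec (If b c d) \<sigma> = (if eval_cond b \<sigma> then exec c \<sigma> else exec d \<sigma>)"
| "exec (While b c) \<sigma> = \<sigma>"

primrec max_cost :: "prog \<Rightarrow> nat" where
  "max_cost (Assign x e) = 1 + cost_exp e"
| "max_cost (Store a i e) = 1 + cost_exp i + cost_exp e"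
| "max_cost (Seq c d) = max_cost c + max_cost d"
| "max_cost (If b c d) = 1 + cost_cond b + max (max_cost c) (max_cost d)"
| "max_cost (While b c) = 0"

lemma runs_exec: "loop_free c \<Longrightarrow> \<exists>\<tau> \<le> max_cost c. runs c \<sigma> \<tau> (exec c \<sigma>)"
proof (induction c arbitrary: \<sigma>)
  case (Assign x e)
  show ?case using runs.Assign[of x e \<sigma>] by auto
next
  case (Store a i e)
  show ?case using runs.Store[of a i e \<sigma>] by auto
next
  case (Seq c d)
  then obtain \<tau> \<tau>' where "\<tau> \<le> max_cost c" "runs c \<sigma> \<tau> (exec c \<sigma>)"
    "\<tau>' \<le> max_cost d" "runs d (exec c \<sigma>) \<tau>' (exec d (exec c \<sigma>))"
    using Seq.IH(1)[of \<sigma>] Seq.IH(2)[of "exec c \<sigma>"] Seq.prems loop_free.simps(3) by blast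
  then show ?case by (intro exI[of _ "\<tau> + \<tau>'"]) (auto intro: runs.Seq)
next
  case (If b c d)
  then obtain \<tau> \<tau>' where "\<tau> \<le> max_cost c" "runs c \<sigma> \<tau> (exec c \<sigma>)"
    "\<tau>' \<le> max_cost d" "runs d \<sigma> \<tau>' (exec d \<sigma>)"
    using If.IH(1)[of \<sigma>] If.IH(2)[of \<sigma>] If.prems loop_free.simps(4) by blast
  then show ?case
    using runs.IfTrue[of b \<sigma> c \<tau> "exec c \<sigma>" d] runs.IfFalse[of b \<sigma> d \<tau>' "exec d \<sigma>" c]
    by (cases "eval_cond b \<sigma>")
      (simp, rule exI[of _ "1 + cost_cond b + \<tau>"], simp,
       simp, rule exI[of _ "1 + cost_cond b + \<tau>'"], simp)
qed simp

primrec scalars_of :: "prog \<Rightarrow> string set" where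
  "scalars_of (Assign x e) = {x}"
| "scalars_of (Store a i e) = {}"
| "scalars_of (Seq c d) = scalars_of c \<union> scalars_of d"
| "scalars_of (If b c d) = scalars_of c \<union> scalars_of d"
| "scalars_of (While b c) = scalars_of c"

primrec arrays_of :: "prog \<Rightarrow> string set" where
  "arrays_of (Assign x e) = {}"
| "arrays_of (Store a i e) = {a}"
| "arrays_of (Seq c d) = arrays_of c \<union> arrays_of d"
| "arrays_of (If b c d) = arrays_of c \<union> arrays_of d"
| "arrays_of (While b c) = arrays_of c"

text \<open>A purely syntactic frame rule: loop invariants can stay silent on everything that the
  body never assigns.\<close>

definition frame :: "prog \<Rightarrow> state \<Rightarrow> state \<Rightarrow> bool" where
  "frame c \<sigma> \<sigma>' \<longleftrightarrow> (\<forall>x. x \<notin> scalars_of c \<longrightarrow> scalar \<sigma>' x = scalar \<sigma> x) \<and>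
     (\<forall>a. a \<notin> arrays_of c \<longrightarrow> arr \<sigma>' a = arr \<sigma> a)"

lemma frame_scalar: "frame c \<sigma> \<sigma>' \<Longrightarrow> x \<notin> scalars_of c \<Longrightarrow> scalar \<sigma>' x = scalar \<sigma> x"
  and frame_arr: "frame c \<sigma> \<sigma>' \<Longrightarrow> a \<notin> arrays_of c \<Longrightarrow> arr \<sigma>' a = arr \<sigma> a"
  by (auto simp: frame_def)

lemma frame_refl: "frame c \<sigma> \<sigma>"
  by (simp add: frame_def)

lemma frame_trans: "frame c \<sigma> \<sigma>' \<Longrightarrow> frame c \<sigma>' \<sigma>'' \<Longrightarrow> frame c \<sigma> \<sigma>''"
  by (simp add: frame_def)

lemma frame_While [simp]: "frame (While b c) = frame c"
  by (simp add: frame_def fun_eq_iff)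

lemma frame_exec: "loop_free c \<Longrightarrow> frame c \<sigma> (exec c \<sigma>)"
  by (induction c arbitrary: \<sigma>) (auto simp: frame_def)

lemma frame_runs: "runs c \<sigma> \<tau> \<sigma>' \<Longrightarrow> frame c \<sigma> \<sigma>'"
  by (induction rule: runs.induct) (auto simp: frame_def)

text \<open>Total correctness with a time bound. The bound is an integer, so costs can be subtracted
  from it without truncation.\<close>

definition terminates :: "prog \<Rightarrow> state \<Rightarrow> int \<Rightarrow> (state \<Rightarrow> bool) \<Rightarrow> bool" where
  "terminates c \<sigma> N Q \<longleftrightarrow> (\<exists>\<tau> \<sigma>'. runs c \<sigma> \<tau> \<sigma>' \<and> int \<tau> \<le> N \<and> Q \<sigma>')"

lemma terminates_mono:
  assumes "terminates c \<sigma> N P" "N \<le> N'" "\<And>\<sigma>'. frame c \<sigma> \<sigma>' \<Longrightarrow> P \<sigma>' \<Longrightarrow> Q \<sigma>'"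
  shows "terminates c \<sigma> N' Q"
proof -
  obtain \<tau> \<sigma>' where "runs c \<sigma> \<tau> \<sigma>'" "int \<tau> \<le> N" "P \<sigma>'"
    using assms(1) by (auto simp: terminates_def)
  then show ?thesis using assms(2,3) frame_runs[of c \<sigma> \<tau> \<sigma>'] unfolding terminates_def
    by (intro exI[of _ \<tau>] exI[of _ \<sigma>']) auto
qed

lemma terminates_exec:
  assumes "loop_free c" "int (max_cost c) \<le> N" "Q (exec c \<sigma>)"
  shows "terminates c \<sigma> N Q"
proof -
  obtain \<tau> where "\<tau> \<le> max_cost c" "runs c \<sigma> \<tau> (exec c \<sigma>)"
    using runs_exec[OF assms(1), of \<sigma>] by blast
  then show ?thesis using assms(2,3) unfolding terminates_def by (intro exI[of _ \<tau>] exI[of _ "exec c \<sigma>"]) auto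
qed

lemma terminates_Seq:
  assumes "terminates c \<sigma> N P" "\<And>\<sigma>'. frame c \<sigma> \<sigma>' \<Longrightarrow> P \<sigma>' \<Longrightarrow> terminates d \<sigma>' N' Q"
  shows "terminates (Seq c d) \<sigma> (N + N') Q"
proof -
  obtain \<tau> \<sigma>' where 1: "runs c \<sigma> \<tau> \<sigma>'" "int \<tau> \<le> N" "P \<sigma>'"
    using assms(1) by (auto simp: terminates_def)
  then obtain \<tau>' \<sigma>'' where 2: "runs d \<sigma>' \<tau>' \<sigma>''" "int \<tau>' \<le> N'" "Q \<sigma>''"
    using assms(2)[of \<sigma>'] frame_runs[of c \<sigma> \<tau> \<sigma>'] by (auto simp: terminates_def)
  from 1 2 show ?thesis unfolding terminates_def by (intro exI[of _ "\<tau> + \<tau>'"]) (auto intro: runs.Seq)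
qed

lemma terminates_Seq_exec:
  assumes "loop_free c" "terminates d (exec c \<sigma>) N Q"
  shows "terminates (Seq c d) \<sigma> (int (max_cost c) + N) Q"
  by (rule terminates_Seq[where P = "\<lambda>\<sigma>'. \<sigma>' = exec c \<sigma>"]) (use assms in \<open>auto intro: terminates_exec\<close>)

text \<open>The variant \<open>V\<close> bounds the iterations that are left and \<open>N\<close>
  the cost of one of them including its test; the summand 1 pays for the test that fails. Every
  iteration may refer to the initial state through \<open>frame c\<close>, which is therefore
  carried along in the induction.\<close>

lemma terminates_While:
  fixes V :: "state \<Rightarrow> int"
  assumes step: "\<And>\<sigma>'. frame c \<sigma> \<sigma>' \<Longrightarrow> I \<sigma>' \<Longrightarrow> eval_cond b \<sigma>' \<Longrightarrow>
      1 \<le> V \<sigma>' \<and> terminates c \<sigma>' (N - 1 - int (cost_cond b)) (\<lambda>\<sigma>''. I \<sigma>'' \<and> V \<sigma>'' \<le> V \<sigma>' - 1)"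
    and "I \<sigma>" "0 \<le> V \<sigma>" "1 + int (cost_cond b) \<le> N"
  shows "terminates (While b c) \<sigma> (N * (V \<sigma> + 1)) (\<lambda>\<sigma>'. I \<sigma>' \<and> \<not> eval_cond b \<sigma>')"
proof -
  \<comment> \<open>The induction runs over an upper bound \<open>k\<close> of the variant, because
    an iteration may lower \<open>V\<close> by more than 1.\<close>
  have "\<exists>\<tau> \<sigma>''. runs (While b c) \<sigma>' \<tau> \<sigma>'' \<and> int \<tau> \<le> N * (int k + 1) \<and> I \<sigma>'' \<and> \<not> eval_cond b \<sigma>''"
    if "frame c \<sigma> \<sigma>'" "I \<sigma>'" "V \<sigma>' \<le> int k" for k \<sigma>'
    using that
  proof (induction k arbitrary: \<sigma>')
    case 0
    then have "\<not> eval_cond b \<sigma>'" using step by fastforce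
    then show ?case using 0 assms(4) by (intro exI) (auto intro!: runs.WhileFalse)
  next
    case (Suc k)
    show ?case
    proof (cases "eval_cond b \<sigma>'")
      case False
      have "N * 1 \<le> N * (int (Suc k) + 1)" using assms(4) by (intro mult_left_mono) auto
      then have "int (1 + cost_cond b) \<le> N * (int (Suc k) + 1)" using assms(4) by linarith
      then show ?thesis using Suc.prems False runs.WhileFalse by blast
    next
      case True
      then obtain \<tau> \<sigma>1 where 1: "runs c \<sigma>' \<tau> \<sigma>1" "int \<tau> \<le> N - 1 - int (cost_cond b)" "I \<sigma>1"
        "V \<sigma>1 \<le> V \<sigma>' - 1"
        using step[OF Suc.prems(1,2)] by (auto simp: terminates_def)
      have "frame c \<sigma> \<sigma>1" using Suc.prems(1) frame_runs[OF 1(1)] frame_trans by blast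
      then obtain \<tau>' \<sigma>2 where 2: "runs (While b c) \<sigma>1 \<tau>' \<sigma>2" "int \<tau>' \<le> N * (int k + 1)" "I \<sigma>2"
        "\<not> eval_cond b \<sigma>2"
        using Suc.IH[of \<sigma>1] 1 Suc.prems by auto
      show ?thesis
        using runs.WhileTrue[OF True 1(1) 2(1)] 1(2) 2(2-) by (intro exI conjI) (auto simp: algebra_simps)
    qed
  qed
  from this[of \<sigma> "nat (V \<sigma>)"] assms(2,3) show ?thesis
    by (simp add: frame_refl terminates_def)
qed

text \<open>For a loop-free body it suffices that \<open>V\<close> drops and stays nonnegative: its
  value after the body forces it to be positive before.\<close>

lemma terminates_While_exec:
  fixes V :: "state \<Rightarrow> int"
  assumes "loop_free c" "1 + int (cost_cond b) + int (max_cost c) \<le> N"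
    and step: "\<And>\<sigma>'. frame c \<sigma> \<sigma>' \<Longrightarrow> I \<sigma>' \<Longrightarrow> eval_cond b \<sigma>' \<Longrightarrow>
      I (exec c \<sigma>') \<and> V (exec c \<sigma>') \<le> V \<sigma>' - 1"
    and nonneg: "\<And>\<sigma>'. I \<sigma>' \<Longrightarrow> 0 \<le> V \<sigma>'"
    and "I \<sigma>"
  shows "terminates (While b c) \<sigma> (N * (V \<sigma> + 1)) (\<lambda>\<sigma>'. I \<sigma>' \<and> \<not> eval_cond b \<sigma>')"
proof (rule terminates_While)
  fix \<sigma>' assume "frame c \<sigma> \<sigma>'" "I \<sigma>'" "eval_cond b \<sigma>'"
  note s = step[OF this]
  then have "1 \<le> V \<sigma>'" using nonneg[of "exec c \<sigma>'"] by linarith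
  then show "1 \<le> V \<sigma>' \<and> terminates c \<sigma>' (N - 1 - int (cost_cond b)) (\<lambda>\<sigma>''. I \<sigma>'' \<and> V \<sigma>'' \<le> V \<sigma>' - 1)"
    using s assms(1,2) by (auto intro!: terminates_exec)
qed (use assms in auto)

definition for_loop :: "string \<Rightarrow> string \<Rightarrow> prog \<Rightarrow> prog" where
  "for_loop i b c = Seq (Assign i (Const 0))
     (While (Less (Var i) (Var b)) (Seq c (Assign i (Add (Var i) (Const 1)))))"

text \<open>Origin of the constants: the body costs at most 140, test and increment of the counter
  cost 8, so 150 per iteration suffice, and 200 absorbs the initial assignment.\<close>

lemma terminates_for_loop:
  assumes "loop_free c" "max_cost c \<le> 140" "i \<notin> scalars_of c" "b \<notin> scalars_of c" "i \<noteq> b"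
    and N: "scalar \<sigma> b = N" "0 \<le> N"
    and init: "I 0 (\<sigma>\<lparr>scalar := (scalar \<sigma>)(i := 0)\<rparr>)"
    and step: "\<And>\<sigma>' k. frame (for_loop i b c) \<sigma> \<sigma>' \<Longrightarrow> I k \<sigma>' \<Longrightarrow> scalar \<sigma>' i = k \<Longrightarrow> 0 \<le> k \<Longrightarrow> k < N \<Longrightarrow>
      I (k + 1) ((exec c \<sigma>')\<lparr>scalar := (scalar (exec c \<sigma>'))(i := k + 1)\<rparr>)"
  shows "terminates (for_loop i b c) \<sigma> (200 * (N + 1)) (I N)"
proof -
  let ?c = "Seq c (Assign i (Add (Var i) (Const 1)))"
  let ?\<sigma> = "\<sigma>\<lparr>scalar := (scalar \<sigma>)(i := 0)\<rparr>"
  let ?I = "\<lambda>\<sigma>'. I (scalar \<sigma>' i) \<sigma>' \<and> 0 \<le> scalar \<sigma>' i \<and> scalar \<sigma>' i \<le> N"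
  have ex: "scalar (exec c \<sigma>') i = scalar \<sigma>' i" for \<sigma>'
    using frame_scalar[OF frame_exec[OF assms(1)] assms(3)] .
  have fr: "frame (for_loop i b c) \<sigma> \<sigma>'" if "frame ?c ?\<sigma> \<sigma>'" for \<sigma>'
    using that by (auto simp: frame_def for_loop_def)
  have b: "scalar \<sigma>' b = N" if "frame ?c ?\<sigma> \<sigma>'" for \<sigma>'
    using frame_scalar[OF that, of b] assms(4,5) N by simp
  have "terminates (While (Less (Var i) (Var b)) ?c) ?\<sigma> (150 * (N - scalar ?\<sigma> i + 1))
     (\<lambda>\<sigma>'. ?I \<sigma>' \<and> \<not> eval_cond (Less (Var i) (Var b)) \<sigma>')"
    by (rule terminates_While_exec[where V = "\<lambda>\<sigma>'. N - scalar \<sigma>' i"])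
      (use assms(1,2) N init in \<open>auto simp: b ex dest: fr intro!: step\<close>)
  then have W: "terminates (While (Less (Var i) (Var b)) ?c) ?\<sigma> (150 * (N + 1)) (I N)"
    by (rule terminates_mono) (auto dest: b)
  have A: "terminates (Assign i (Const 0)) \<sigma> 2 (\<lambda>\<sigma>'. \<sigma>' = ?\<sigma>)"
    by (rule terminates_exec) auto
  have "terminates (for_loop i b c) \<sigma> (2 + 150 * (N + 1)) (I N)"
    unfolding for_loop_def by (rule terminates_Seq[OF A]) (use W in simp)
  then show ?thesis by (rule terminates_mono) (use N in auto)
qed

section \<open>Residual arcs, adjacency lists and the parity of a circulation\<close>

definition excess :: "int \<Rightarrow> (int \<Rightarrow> int) \<Rightarrow> (int \<Rightarrow> int) \<Rightarrow> (int \<Rightarrow> int) \<Rightarrow> int \<Rightarrow> int" where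
  "excess m ta he f v = (\<Sum>e\<in>{0..<m}. f e * (of_bool (he e = v) - of_bool (ta e = v)))"

lemma excess_update:
  assumes "e \<in> {0..<m}"
  shows "excess m ta he (f(e := x)) v =
    excess m ta he f v + (x - f e) * (of_bool (he e = v) - of_bool (ta e = v))"
  using assms unfolding excess_def
  by (simp add: sum.remove[of _ e] algebra_simps)

lemma excess_add: "excess m ta he (\<lambda>e. f e + g e) v = excess m ta he f v + excess m ta he g v"
  by (simp add: excess_def sum.distrib[symmetric] distrib_right)

lemma excess_diff: "excess m ta he (\<lambda>e. f e - g e) v = excess m ta he f v - excess m ta he g v"
  by (simp add: excess_def sum_subtractf[symmetric] left_diff_distrib)

lemma excess_mult: "excess m ta he (\<lambda>e. c * f e) v = c * excess m ta he f v"
  by (simp add: excess_def sum_distrib_left algebra_simps)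

lemma excess_cong: "(\<And>e. e \<in> {0..<m} \<Longrightarrow> f e = g e) \<Longrightarrow> excess m ta he f v = excess m ta he g v"
  by (simp add: excess_def)

text \<open>The net flow into a set: arcs with both ends in \<open>S\<close> cancel.\<close>

lemma sum_excess:
  assumes "finite S"
  shows "(\<Sum>v\<in>S. excess m ta he f v) = (\<Sum>e\<in>{0..<m}. f e * (of_bool (he e \<in> S) - of_bool (ta e \<in> S)))"
proof -
  have *: "(\<Sum>v\<in>S. of_bool (x = v)) = (of_bool (x \<in> S) :: int)" for x
    using assms by (simp add: of_bool_def sum.delta)
  have "(\<Sum>v\<in>S. excess m ta he f v)
      = (\<Sum>e\<in>{0..<m}. \<Sum>v\<in>S. f e * (of_bool (he e = v) - of_bool (ta e = v)))"
    unfolding excess_def by (rule sum.swap)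
  also have "\<dots> = (\<Sum>e\<in>{0..<m}. f e * (of_bool (he e \<in> S) - of_bool (ta e \<in> S)))"
    by (simp only: sum_distrib_left[symmetric] sum_subtractf *)
  finally show ?thesis .
qed

text \<open>The residual arcs \<open>2 * e\<close> and \<open>2 * e + 1\<close> are the arc \<open>e\<close> in forward and in backward
  direction; \<open>src ta he a\<close> is the node where the residual arc \<open>a\<close> starts, \<open>src he ta a\<close> the one
  where it ends.\<close>

definition src :: "(int \<Rightarrow> int) \<Rightarrow> (int \<Rightarrow> int) \<Rightarrow> int \<Rightarrow> int" where
  "src ta he a = (if even a then ta (a div 2) else he (a div 2))"

text \<open>A maximum shifted by one, so that 0 can stand for the maximum of the empty set. With
  \<open>f = src ta he\<close> these numbers are the links of the adjacency lists.\<close>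

definition greatest_below :: "(int \<Rightarrow> int) \<Rightarrow> int \<Rightarrow> int \<Rightarrow> int \<Rightarrow> bool" where
  "greatest_below f v k c \<longleftrightarrow>
     0 \<le> c \<and> c \<le> k \<and> (0 < c \<longrightarrow> f (c - 1) = v) \<and> (\<forall>b. c \<le> b \<and> b < k \<longrightarrow> f b \<noteq> v)"

lemma greatest_belowD: "greatest_below f v k c \<Longrightarrow> f b = v \<Longrightarrow> b < k \<Longrightarrow> b < c"
  by (metis greatest_below_def linorder_not_le)

text \<open>The residual arcs of a node form a linked list in decreasing order. A cell holds \<open>a + 1\<close> for
  the residual arc \<open>a\<close>, and 0 at the end of the list. So a cursor with value \<open>c\<close> has passed exactly
  the residual arcs \<open>b\<close> of its node with \<open>c \<le> b\<close>.\<close>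

definition adjacency ::
  "int \<Rightarrow> (int \<Rightarrow> int) \<Rightarrow> (int \<Rightarrow> int) \<Rightarrow> (int \<Rightarrow> int) \<Rightarrow> (int \<Rightarrow> int) \<Rightarrow> bool" where
  "adjacency m ta he first nxt \<longleftrightarrow>
     (\<forall>v. greatest_below (src ta he) v (2 * m) (first v)) \<and>
     (\<forall>a\<in>{0..<2 * m}. greatest_below (src ta he) (src ta he a) a (nxt a))"

text \<open>Acyclicity and conservation are left out on purpose: the same locale serves the DAG and
  its closure by the return arc, which has directed cycles.\<close>

locale network =
  fixes n m :: int and ta he first nxt :: "int \<Rightarrow> int"
  assumes n_nonneg: "0 \<le> n" and m_nonneg: "0 \<le> m"
    and tail_vertex: "e \<in> {0..<m} \<Longrightarrow> ta e \<in> {0..<n}"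
    and head_vertex: "e \<in> {0..<m} \<Longrightarrow> he e \<in> {0..<n}"
    and adjacency: "adjacency m ta he first nxt"
begin

abbreviation "ex \<equiv> excess m ta he"
abbreviation "from \<equiv> src ta he"
abbreviation "to \<equiv> src he ta"

lemma excess_outside: "v \<notin> {0..<n} \<Longrightarrow> ex f v = 0"
  unfolding excess_def using tail_vertex head_vertex by (intro sum.neutral) fastforce

lemma half_arc: "a \<in> {0..<2 * m} \<Longrightarrow> a div 2 \<in> {0..<m}"
  by auto

lemma incident_arc:
  assumes "e \<in> {0..<m}" "ta e = v \<or> he e = v"
  shows "\<exists>b\<in>{0..<2 * m}. b div 2 = e \<and> from b = v"
proof (cases "ta e = v")
  case True
  then show ?thesis using assms(1) by (intro bexI[of _ "2 * e"]) (auto simp: src_def)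
next
  case False
  then show ?thesis using assms by (intro bexI[of _ "2 * e + 1"]) (auto simp: src_def)
qed

lemma from_vertex: "a \<in> {0..<2 * m} \<Longrightarrow> from a \<in> {0..<n}"
  and to_vertex: "a \<in> {0..<2 * m} \<Longrightarrow> to a \<in> {0..<n}"
  unfolding src_def using half_arc tail_vertex head_vertex by presburger+

section \<open>Cursors into the adjacency lists and their amortised cost\<close>

definition cursor :: "(int \<Rightarrow> int) \<Rightarrow> bool" where
  "cursor cur \<longleftrightarrow> (\<forall>w\<in>{0..<n}. 0 \<le> cur w \<and> cur w \<le> 2 * m \<and> (0 < cur w \<longrightarrow> from (cur w - 1) = w))"

text \<open>The number of residual arcs not passed yet. As it never exceeds \<open>2 * m\<close>, it
  pays for all cursor movements between two resets.\<close>

definition cursor_potential :: "(int \<Rightarrow> int) \<Rightarrow> int" where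
  "cursor_potential cur = int (card {b \<in> {0..<2 * m}. b < cur (from b)})"

lemma cursor_potential_nonneg: "0 \<le> cursor_potential cur"
  by (simp add: cursor_potential_def)

lemma cursor_potential_le: "cursor_potential cur \<le> 2 * m"
proof -
  have "card {b \<in> {0..<2 * m}. b < cur (from b)} \<le> card {0..<2 * m}"
    by (rule card_mono) auto
  then show ?thesis using m_nonneg by (simp add: cursor_potential_def)
qed

lemma first_greatest: "greatest_below from v (2 * m) (first v)"
  and next_greatest: "a \<in> {0..<2 * m} \<Longrightarrow> greatest_below from (from a) a (nxt a)"
  using adjacency by (auto simp: adjacency_def)

lemma cursor_first: "\<forall>w\<in>{0..<n}. cur w = first w \<Longrightarrow> cursor cur"
  using first_greatest unfolding cursor_def greatest_below_def by simp

lemma first_greater: "b \<in> {0..<2 * m} \<Longrightarrow> b < first (from b)"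
  using first_greatest[of "from b"] greatest_belowD by auto

lemma cursor_first_update: "cursor cur \<Longrightarrow> cursor (cur(u := first u))"
  using first_greatest unfolding cursor_def greatest_below_def by simp

lemma cursor_range:
  "cursor cur \<Longrightarrow> u \<in> {0..<n} \<Longrightarrow> 0 < cur u \<Longrightarrow> cur u - 1 \<in> {0..<2 * m} \<and> from (cur u - 1) = u"
  by (auto simp: cursor_def)

text \<open>\<open>nxt\<close> leads to the next smaller residual arc of the same node, so
  \<open>cur u - 1\<close> is the only arc that becomes passed. The third claim lets the loop
  invariants check just this arc.\<close>

lemma cursor_advance:
  assumes "cursor cur" "u \<in> {0..<n}" "0 < cur u"
  defines "cur' \<equiv> cur(u := nxt (cur u - 1))"
  shows "cursor cur'" "cursor_potential cur' \<le> cursor_potential cur - 1"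
    "\<And>b. b \<in> {0..<2 * m} \<Longrightarrow> cur' (from b) \<le> b \<Longrightarrow> cur (from b) \<le> b \<or> b = cur u - 1"
    "\<And>w. cur' w \<le> cur w"
proof -
  let ?a = "cur u - 1"
  have a: "?a \<in> {0..<2 * m}" "from ?a = u" using cursor_range[OF assms(1-3)] by auto
  then have nx: "greatest_below from u ?a (nxt ?a)" using next_greatest by metis
  have "cur u \<le> 2 * m" using assms(1,2) unfolding cursor_def by blast
  then show "cursor cur'" using assms(1) nx unfolding cursor_def cur'_def
    by (simp add: greatest_below_def)
  show le: "cur' w \<le> cur w" for w using nx by (simp add: cur'_def greatest_below_def)
  show "cur (from b) \<le> b \<or> b = ?a" if "b \<in> {0..<2 * m}" "cur' (from b) \<le> b" for b
    using that nx by (auto simp: cur'_def greatest_below_def split: if_splits)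
  have "{b \<in> {0..<2 * m}. b < cur' (from b)} \<subset> {b \<in> {0..<2 * m}. b < cur (from b)}"
  proof
    show "{b \<in> {0..<2 * m}. b < cur' (from b)} \<subseteq> {b \<in> {0..<2 * m}. b < cur (from b)}"
      using le by (auto intro: less_le_trans)
    have "?a \<in> {b \<in> {0..<2 * m}. b < cur (from b)}" using a by simp
    moreover have "?a \<notin> {b \<in> {0..<2 * m}. b < cur' (from b)}"
      using nx a by (simp add: cur'_def greatest_below_def)
    ultimately show "{b \<in> {0..<2 * m}. b < cur' (from b)} \<noteq> {b \<in> {0..<2 * m}. b < cur (from b)}"
      by blast
  qed
  then have "card {b \<in> {0..<2 * m}. b < cur' (from b)} < card {b \<in> {0..<2 * m}. b < cur (from b)}"
    by (intro psubset_card_mono) (auto intro: finite_subset[of _ "{0..<2 * m}"])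
  then show "cursor_potential cur' \<le> cursor_potential cur - 1"
    by (simp add: cursor_potential_def)
qed

text \<open>\<open>Z\<close> consists of closed walks and one walk from \<open>v\<close> to the
  current node \<open>u\<close>, whence its excess; an arc with nonzero \<open>Z\<close> is used up.
  Nodes below \<open>v\<close> are exhausted, and \<open>u = v = n\<close> marks the end.\<close>

definition parity_inv :: "(int \<Rightarrow> int) \<Rightarrow> (int \<Rightarrow> int) \<Rightarrow> (int \<Rightarrow> int) \<Rightarrow> int \<Rightarrow> int \<Rightarrow> bool" where
  "parity_inv W Z cur u v \<longleftrightarrow>
     0 \<le> v \<and> 0 \<le> u \<and> (u < n \<and> v < n \<or> u = n \<and> v = n) \<and> cursor cur \<and>
     (\<forall>e\<in>{0..<m}. Z e \<in> {-1, 0, 1} \<and> (Z e \<noteq> 0 \<longrightarrow> odd (W e))) \<and>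
     (\<forall>w. ex Z w = of_bool (w = u) - of_bool (w = v)) \<and>
     (\<forall>b\<in>{0..<2 * m}. cur (from b) \<le> b \<or> from b < v \<longrightarrow> even (W (b div 2)) \<or> Z (b div 2) \<noteq> 0)"

text \<open>An iteration passes a residual arc, uses up an arc, or moves on to the next start node;
  each has its summand.\<close>

definition parity_potential :: "(int \<Rightarrow> int) \<Rightarrow> (int \<Rightarrow> int) \<Rightarrow> int \<Rightarrow> int" where
  "parity_potential Z cur v = cursor_potential cur + int (card {e \<in> {0..<m}. Z e = 0}) + (n - v)"

text \<open>At a node \<open>u\<close> without unused odd arcs, \<open>Z\<close> agrees with \<open>W\<close> modulo 2, hence its excess is even.
  But the excess of \<open>Z\<close> is odd at both ends of an open walk.\<close>

lemma parity_stuck: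
  assumes "parity_inv W Z cur u v" "u < n" "cur u \<le> 0" and circ: "\<And>w. w \<in> {0..<n} \<Longrightarrow> ex W w = 0"
  shows "parity_inv W Z cur (v + 1) (v + 1)"
proof -
  note I = assms(1)[unfolded parity_inv_def]
  have u: "u \<in> {0..<n}" using I assms(2) by auto
  have "even (W e - Z e)" if e: "e \<in> {0..<m}" "ta e = u \<or> he e = u" for e
  proof -
    obtain b where b: "b \<in> {0..<2 * m}" "b div 2 = e" "from b = u" using incident_arc[OF e] by blast
    then have "cur (from b) \<le> b" using assms(3) by simp
    then have "even (W e) \<or> Z e \<noteq> 0" using I b by blast
    moreover have "Z e \<in> {-1, 0, 1}" "Z e \<noteq> 0 \<longrightarrow> odd (W e)" using I e by blast+
    ultimately show ?thesis by auto
  qed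
  then have "even (ex (\<lambda>e. W e - Z e) u)"
    unfolding excess_def by (intro dvd_sum) (auto intro: dvd_mult2)
  then have "even (ex Z u)" using circ[OF u] by (simp add: excess_diff)
  then have uv: "u = v" using I by (auto split: if_splits)
  show ?thesis
    unfolding parity_inv_def
  proof (intro conjI ballI impI)
    fix b assume b: "b \<in> {0..<2 * m}" "cur (from b) \<le> b \<or> from b < v + 1"
    then have "cur (from b) \<le> b \<or> from b < v" using uv assms(3) by (auto simp: order_le_less)
    then show "even (W (b div 2)) \<or> Z (b div 2) \<noteq> 0" using I b(1) by blast
  qed (use I uv assms(2) in auto)
qed

lemma parity_advance:
  assumes "parity_inv W Z cur u v" "u < n" "0 < cur u"
    and "even (W ((cur u - 1) div 2)) \<or> Z ((cur u - 1) div 2) \<noteq> 0"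
  shows "parity_inv W Z (cur(u := nxt (cur u - 1))) u v"
    "parity_potential Z (cur(u := nxt (cur u - 1))) v \<le> parity_potential Z cur v - 1"
proof -
  note I = assms(1)[unfolded parity_inv_def]
  have u: "u \<in> {0..<n}" using I assms(2) by auto
  have cur: "cursor cur" using I by blast
  note adv = cursor_advance[OF cur u assms(3)]
  show "parity_inv W Z (cur(u := nxt (cur u - 1))) u v"
    unfolding parity_inv_def
  proof (intro conjI ballI impI)
    fix b assume b: "b \<in> {0..<2 * m}" "(cur(u := nxt (cur u - 1))) (from b) \<le> b \<or> from b < v"
    then have "cur (from b) \<le> b \<or> from b < v \<or> b = cur u - 1" using adv(3) by blast
    then show "even (W (b div 2)) \<or> Z (b div 2) \<noteq> 0" using I b(1) assms(4) by blast
  qed (use I adv(1) in blast)+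
  show "parity_potential Z (cur(u := nxt (cur u - 1))) v \<le> parity_potential Z cur v - 1"
    using adv(2) I by (simp add: parity_potential_def)
qed

text \<open>The cursor stays on the arc just traversed; what pays for the step is that an arc with
  \<open>Z e = 0\<close> is used up. The sign of \<open>x\<close> is the direction, so one unit
  moves from \<open>u\<close> to \<open>u'\<close>.\<close>

lemma parity_traverse:
  assumes "parity_inv W Z cur u v" "u < n" "0 < cur u"
  defines "e \<equiv> (cur u - 1) div 2"
  assumes "odd (W e)" "Z e = 0"
    and "u' = to (cur u - 1)" "x = (if even (cur u - 1) then 1 else -1)"
  shows "parity_inv W (Z(e := x)) cur u' v"
    "parity_potential (Z(e := x)) cur v \<le> parity_potential Z cur v - 1"
proof -
  note I = assms(1)[unfolded parity_inv_def]
  have u: "u \<in> {0..<n}" using I assms(2) by auto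
  have a: "cur u - 1 \<in> {0..<2 * m}" "from (cur u - 1) = u" using cursor_range I u assms(3) by auto
  have e: "e \<in> {0..<m}" using half_arc[OF a(1)] by (simp add: e_def)
  have u': "u' \<in> {0..<n}" using to_vertex[OF a(1)] assms by simp
  show "parity_inv W (Z(e := x)) cur u' v"
    unfolding parity_inv_def
  proof (intro conjI allI ballI impI)
    fix w
    have "ex (Z(e := x)) w = ex Z w + x * (of_bool (he e = w) - of_bool (ta e = w))"
      using excess_update[OF e] assms(6) by simp
    also have "x * (of_bool (he e = w) - of_bool (ta e = w)) = of_bool (w = u') - of_bool (w = u)"
      using a(2) assms(7,8) by (cases "even (cur u - 1)") (simp_all add: src_def e_def)
    finally show "ex (Z(e := x)) w = of_bool (w = u') - of_bool (w = v)"
      using I by (simp del: fun_upd_apply)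
  next
    fix b assume "b \<in> {0..<2 * m}" "cur (from b) \<le> b \<or> from b < v"
    then show "even (W (b div 2)) \<or> (Z(e := x)) (b div 2) \<noteq> 0" using I assms(8) by auto
  next
    fix e' assume "e' \<in> {0..<m}"
    then show "(Z(e := x)) e' \<in> {-1, 0, 1}" using I assms(8) by auto
  next
    fix e' assume "e' \<in> {0..<m}" "(Z(e := x)) e' \<noteq> 0"
    then show "odd (W e')" using I assms(5) by (auto split: if_splits)
  qed (use I u' assms(2) in auto)
  have "{e' \<in> {0..<m}. (Z(e := x)) e' = 0} \<subset> {e' \<in> {0..<m}. Z e' = 0}"
    using e assms(6,8) by (auto split: if_splits)
  then have "card {e' \<in> {0..<m}. (Z(e := x)) e' = 0} < card {e' \<in> {0..<m}. Z e' = 0}"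
    by (intro psubset_card_mono) (auto intro: finite_subset[of _ "{0..<m}"])
  then show "parity_potential (Z(e := x)) cur v \<le> parity_potential Z cur v - 1"
    by (simp add: parity_potential_def)
qed

lemma parity_final:
  assumes "parity_inv W Z cur u v" "\<not> u < n"
  shows "\<forall>e\<in>{0..<m}. Z e \<in> {-1, 0, 1} \<and> even (W e - Z e)" "\<forall>w. ex Z w = 0"
proof -
  note I = assms(1)[unfolded parity_inv_def]
  have uv: "u = n" "v = n" using I assms(2) by auto
  show "\<forall>w. ex Z w = 0" using I uv by simp
  show "\<forall>e\<in>{0..<m}. Z e \<in> {-1, 0, 1} \<and> even (W e - Z e)"
  proof
    fix e assume e: "e \<in> {0..<m}"
    \<comment> \<open>Every tail is below \<open>v = n\<close>, so the clause on exhausted nodes,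
      applied to the forward residual arc \<open>2 * e\<close>, covers all arcs.\<close>
    then have "2 * e \<in> {0..<2 * m}" by auto
    moreover have "from (2 * e) < v" using tail_vertex[OF e] uv by (simp add: src_def)
    ultimately have "even (W ((2 * e) div 2)) \<or> Z ((2 * e) div 2) \<noteq> 0" using I by blast
    then have "even (W e) \<or> Z e \<noteq> 0" by simp
    moreover have "Z e \<in> {-1, 0, 1}" "Z e \<noteq> 0 \<longrightarrow> odd (W e)" using I e by auto
    ultimately show "Z e \<in> {-1, 0, 1} \<and> even (W e - Z e)" by auto
  qed
qed

lemma parity_init:
  assumes "\<forall>e\<in>{0..<m}. Z e = 0" "\<forall>w\<in>{0..<n}. cur w = first w"
  shows "parity_inv W Z cur 0 0" "parity_potential Z cur 0 \<le> 3 * m + n"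
proof -
  have "ex Z w = 0" for w using assms(1) by (simp add: excess_def)
  moreover have "cursor cur" using assms(2) by (rule cursor_first)
  moreover have "\<not> cur (from b) \<le> b" if "b \<in> {0..<2 * m}" for b
    using first_greater[OF that] from_vertex[OF that] assms(2) by simp
  moreover have "\<not> from b < 0" if "b \<in> {0..<2 * m}" for b
    using from_vertex[OF that] by simp
  ultimately show "parity_inv W Z cur 0 0"
    using assms(1) n_nonneg by (auto simp: parity_inv_def)
  have "card {e \<in> {0..<m}. Z e = 0} \<le> card {0..<m}" by (rule card_mono) auto
  then show "parity_potential Z cur 0 \<le> 3 * m + n"
    using cursor_potential_le[of cur] m_nonneg by (simp add: parity_potential_def)
qed

end

section \<open>The parity program and its running time\<close>

definition reset_cursors :: prog where
  "reset_cursors = for_loop ''u'' ''n'' (Store ''cur'' (Var ''u'') (Elem ''first'' (Var ''u'')))"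

text \<open>The machine has no parity test. An entry of \<open>W\<close> is odd iff twice its half
  is smaller, and \<open>a\<close> is a forward arc iff \<open>a < 2 * e + 1\<close>.\<close>

definition parity_step :: prog where
  "parity_step =
     Seq (Assign ''a'' (Elem ''cur'' (Var ''u'')))
     (If (Less (Var ''a'') (Const 1))
        (Seq (Assign ''v'' (Add (Var ''v'') (Const 1))) (Assign ''u'' (Var ''v'')))
        (Seq (Assign ''a'' (Sub (Var ''a'') (Const 1)))
        (Seq (Assign ''e'' (Half (Var ''a'')))
        (If (And (Less (Add (Half (Elem ''W'' (Var ''e''))) (Half (Elem ''W'' (Var ''e'')))) (Elem ''W'' (Var ''e'')))
              (And (Not (Less (Const 0) (Elem ''Z'' (Var ''e'')))) (Not (Less (Elem ''Z'' (Var ''e'')) (Const 0)))))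
           (If (Less (Var ''a'') (Add (Add (Var ''e'') (Var ''e'')) (Const 1)))
              (Seq (Store ''Z'' (Var ''e'') (Const 1)) (Assign ''u'' (Elem ''head'' (Var ''e''))))
              (Seq (Store ''Z'' (Var ''e'') (Const (- 1))) (Assign ''u'' (Elem ''tail'' (Var ''e'')))))
           (Store ''cur'' (Var ''u'') (Elem ''next'' (Var ''a'')))))))"

definition parity_fix :: prog where
  "parity_fix = Seq reset_cursors (Seq (Seq (Assign ''u'' (Const 0)) (Assign ''v'' (Const 0)))
     (While (Less (Var ''u'') (Var ''n'')) parity_step))"

lemma even_iff_le_half: "(a :: int) \<le> 2 * (a div 2) \<longleftrightarrow> even a"
  by presburger

lemma odd_iff_half_less: "2 * ((a :: int) div 2) < a \<longleftrightarrow> odd a"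
  by presburger

context network
begin

definition represents :: "state \<Rightarrow> bool" where
  "represents \<sigma> \<longleftrightarrow> scalar \<sigma> ''n'' = n \<and> scalar \<sigma> ''m'' = m \<and>
     arr \<sigma> ''tail'' = ta \<and> arr \<sigma> ''head'' = he \<and> arr \<sigma> ''first'' = first \<and> arr \<sigma> ''next'' = nxt"

lemma represents_frame:
  "frame c \<sigma> \<sigma>' \<Longrightarrow> {''n'', ''m''} \<inter> scalars_of c = {} \<Longrightarrow>
   {''tail'', ''head'', ''first'', ''next''} \<inter> arrays_of c = {} \<Longrightarrow> represents \<sigma>' = represents \<sigma>"
  unfolding represents_def by (simp add: frame_def)

lemma terminates_reset_cursors:
  assumes "represents \<sigma>"
  shows "terminates reset_cursors \<sigma> (200 * (n + 1)) (\<lambda>\<sigma>'. \<forall>w\<in>{0..<n}. arr \<sigma>' ''cur'' w = first w)"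
  unfolding reset_cursors_def
  by (rule terminates_for_loop[where I = "\<lambda>k \<sigma>'. \<forall>w\<in>{0..<k}. arr \<sigma>' ''cur'' w = first w"])
    (use assms n_nonneg in \<open>auto simp: represents_def frame_def for_loop_def\<close>)

lemma terminates_parity_fix:
  assumes \<sigma>: "represents \<sigma>" and Z: "\<forall>e\<in>{0..<m}. arr \<sigma> ''Z'' e = 0"
    and W: "\<And>w. w \<in> {0..<n} \<Longrightarrow> ex (arr \<sigma> ''W'') w = 0"
  shows "terminates parity_fix \<sigma> (1000 * (n + m + 1)) (\<lambda>\<sigma>'.
    (\<forall>e\<in>{0..<m}. arr \<sigma>' ''Z'' e \<in> {-1, 0, 1} \<and> even (arr \<sigma> ''W'' e - arr \<sigma>' ''Z'' e)) \<and>
    (\<forall>w. ex (arr \<sigma>' ''Z'') w = 0))"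
proof -
  let ?I = "\<lambda>\<sigma>'. parity_inv (arr \<sigma> ''W'') (arr \<sigma>' ''Z'') (arr \<sigma>' ''cur'') (scalar \<sigma>' ''u'') (scalar \<sigma>' ''v'')"
  let ?V = "\<lambda>\<sigma>'. parity_potential (arr \<sigma>' ''Z'') (arr \<sigma>' ''cur'') (scalar \<sigma>' ''v'')"
  let ?w = "While (Less (Var ''u'') (Var ''n'')) parity_step"
  let ?Q = "\<lambda>\<sigma>'. (\<forall>e\<in>{0..<m}. arr \<sigma>' ''Z'' e \<in> {-1, 0, 1} \<and> even (arr \<sigma> ''W'' e - arr \<sigma>' ''Z'' e)) \<and>
    (\<forall>w. ex (arr \<sigma>' ''Z'') w = 0)"
  have loop: "terminates ?w \<sigma>1 (100 * (3 * m + n + 1)) ?Q"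
    if fr: "frame parity_fix \<sigma> \<sigma>1" and cur: "\<forall>w\<in>{0..<n}. arr \<sigma>1 ''cur'' w = first w"
      and uv: "scalar \<sigma>1 ''u'' = 0" "scalar \<sigma>1 ''v'' = 0" and Z1: "arr \<sigma>1 ''Z'' = arr \<sigma> ''Z''" for \<sigma>1
  proof -
    have init: "?I \<sigma>1" "?V \<sigma>1 \<le> 3 * m + n"
      using parity_init[of "arr \<sigma>1 ''Z''" "arr \<sigma>1 ''cur''"] Z Z1 cur uv by auto
    have nonneg: "v \<le> n \<Longrightarrow> 0 \<le> parity_potential Z cur v" for Z cur v
      using cursor_potential_nonneg[of cur] by (simp add: parity_potential_def)
    have step: "?I (exec parity_step \<sigma>') \<and> ?V (exec parity_step \<sigma>') \<le> ?V \<sigma>' - 1"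
      if f: "frame parity_step \<sigma>1 \<sigma>'" and I: "?I \<sigma>'" and b: "eval_cond (Less (Var ''u'') (Var ''n'')) \<sigma>'" for \<sigma>'
    proof -
      have f': "frame parity_fix \<sigma> \<sigma>'"
        using fr f by (simp add: frame_def parity_fix_def)
      have r: "represents \<sigma>'"
        using represents_frame[OF f'] \<sigma> by (simp add: parity_fix_def reset_cursors_def for_loop_def parity_step_def)
      have W': "arr \<sigma>' ''W'' = arr \<sigma> ''W''"
        using frame_arr[OF f'] by (simp add: parity_fix_def reset_cursors_def for_loop_def parity_step_def)
      have u: "scalar \<sigma>' ''u'' < n" using b r by (simp add: represents_def)
      let ?c = "arr \<sigma>' ''cur''" and ?u = "scalar \<sigma>' ''u''" and ?v = "scalar \<sigma>' ''v''" and ?Z = "arr \<sigma>' ''Z''"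
      show ?thesis
      proof (cases "?c ?u \<le> 0")
        case True
        then show ?thesis
          using parity_stuck[OF I u True W]
          by (simp add: parity_step_def parity_potential_def)
      next
        case False
        then have c: "0 < ?c ?u" by simp
        let ?e = "(?c ?u - 1) div 2"
        show ?thesis
        proof (cases "even (arr \<sigma> ''W'' ?e) \<or> ?Z ?e \<noteq> 0")
          case True
          then show ?thesis using False parity_advance[OF I u c True] r W'
            by (auto simp: parity_step_def represents_def odd_iff_half_less)
        next
          case odd: False
          then show ?thesis
            using False parity_traverse[OF I u c, OF _ _ refl refl] r W'
            by (cases "even (?c ?u - 1)")
              (auto simp: parity_step_def represents_def odd_iff_half_less even_iff_le_half src_def)
        qed
      qed
    qed
    have "terminates ?w \<sigma>1 (100 * (?V \<sigma>1 + 1)) (\<lambda>\<sigma>'. ?I \<sigma>' \<and> \<not> eval_cond (Less (Var ''u'') (Var ''n'')) \<sigma>')"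
    proof (rule terminates_While_exec[where I = ?I and V = ?V])
      show "0 \<le> ?V \<sigma>'" if "?I \<sigma>'" for \<sigma>'
        using that by (intro nonneg) (auto simp: parity_inv_def)
    qed (fact step init(1) | simp add: parity_step_def)+
    then show ?thesis
    proof (elim terminates_mono, goal_cases)
      case 1
      then show ?case using init(2) by simp
    next
      case (2 \<sigma>')
      have "scalar \<sigma>' ''n'' = n"
        using 2 fr \<sigma> by (simp add: frame_def parity_fix_def reset_cursors_def for_loop_def parity_step_def represents_def)
      then have "?I \<sigma>'" "\<not> scalar \<sigma>' ''u'' < n" using 2 by simp_all
      then show ?case using parity_final by blast
    qed
  qed
  let ?N = "200 * (n + 1) + (int 4 + 100 * (3 * m + n + 1))"
  have "terminates parity_fix \<sigma> ?N ?Q"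
    unfolding parity_fix_def
  proof (rule terminates_Seq[OF terminates_reset_cursors[OF \<sigma>]])
    fix \<sigma>' assume *: "frame reset_cursors \<sigma> \<sigma>'" "\<forall>w\<in>{0..<n}. arr \<sigma>' ''cur'' w = first w"
    let ?c = "Seq (Assign ''u'' (Const 0)) (Assign ''v'' (Const 0))"
    have "terminates ?w (exec ?c \<sigma>') (100 * (3 * m + n + 1)) ?Q"
      by (rule loop) (use * in \<open>simp_all add: frame_def parity_fix_def reset_cursors_def for_loop_def\<close>)
    from terminates_Seq_exec[OF _ this] show "terminates (Seq ?c ?w) \<sigma>' (int 4 + 100 * (3 * m + n + 1)) ?Q"
      by simp
  qed
  then show ?thesis by (rule terminates_mono) (use n_nonneg m_nonneg in auto)
qed

end

section \<open>A minimum flow covering the support\<close>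

context network
begin

text \<open>Arcs have lower bounds but no capacities: flow can always be increased, and decreased as
  long as it exceeds \<open>low\<close>.\<close>

definition residual :: "(int \<Rightarrow> int) \<Rightarrow> (int \<Rightarrow> int) \<Rightarrow> int \<Rightarrow> bool" where
  "residual low F b \<longleftrightarrow> (odd b \<longrightarrow> low (b div 2) < F (b div 2))"

text \<open>Push-relabel with a single travelling unit: \<open>u\<close> is its position,
  \<open>v\<close> the node scanned for surplus. Deficits keep label 0, so labels are lower bounds
  for the distance to a deficit; a label \<open>n\<close> means that the node is given up. The two
  clauses on residual arcs are validity of the labels and the absence of admissible arcs behind the
  cursors.\<close>

definition drain_inv ::
  "(int \<Rightarrow> int) \<Rightarrow> (int \<Rightarrow> int) \<Rightarrow> (int \<Rightarrow> int) \<Rightarrow> (int \<Rightarrow> int) \<Rightarrow> (int \<Rightarrow> int) \<Rightarrow> int \<Rightarrow> int \<Rightarrow> bool" where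
  "drain_inv low F x d cur u v \<longleftrightarrow>
     0 \<le> v \<and> 0 \<le> u \<and> (u < n \<and> v < n \<or> u = n \<and> v = n) \<and> cursor cur \<and>
     (\<forall>e\<in>{0..<m}. low e \<le> F e) \<and> (\<forall>w. x w = ex F w) \<and>
     (\<forall>w. 0 \<le> d w \<and> d w \<le> n) \<and> (\<forall>w. x w < 0 \<longrightarrow> d w = 0) \<and>
     (\<forall>b\<in>{0..<2 * m}. residual low F b \<longrightarrow> d (from b) \<le> d (to b) + 1) \<and>
     (\<forall>b\<in>{0..<2 * m}. cur (from b) \<le> b \<and> residual low F b \<longrightarrow> d (from b) \<le> d (to b)) \<and>
     (\<forall>w\<in>{0..<v}. d w = n \<or> x w \<le> of_bool (w = u))"

text \<open>A relabelling of \<open>u\<close> resets its cursor; this is paid for by the second sum, in which the label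
  of \<open>u\<close> counts once for each of its residual arcs. The factor \<open>2 * n + 4\<close> pays for the restart at
  a node with a high label after a unit has reached a deficit.\<close>

definition drain_potential ::
  "(int \<Rightarrow> int) \<Rightarrow> (int \<Rightarrow> int) \<Rightarrow> (int \<Rightarrow> int) \<Rightarrow> int \<Rightarrow> int \<Rightarrow> int" where
  "drain_potential x d cur u v =
     (\<Sum>w\<in>{0..<n}. 4 * (n - d w)) + (\<Sum>b\<in>{0..<2 * m}. n - d (from b)) + cursor_potential cur +
     (2 * n + 4) * (\<Sum>w\<in>{0..<n}. if d w < n then max 0 (x w) else 0) +
     2 * (if 0 < x u \<and> d u < n then d u else n) + 2 * (n - v) + of_bool (u \<noteq> v)"

lemma drain_potential_nonneg:
  assumes "drain_inv low F x d cur u v"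
  shows "0 \<le> drain_potential x d cur u v"
proof -
  have d: "0 \<le> d w" "d w \<le> n" for w using assms by (auto simp: drain_inv_def)
  moreover have "v \<le> n" using assms by (auto simp: drain_inv_def)
  ultimately show ?thesis
    unfolding drain_potential_def using cursor_potential_nonneg[of cur] n_nonneg
    by (intro add_nonneg_nonneg sum_nonneg mult_nonneg_nonneg) auto
qed

lemma drain_potential_init:
  assumes "\<And>w. d w = 0" "(\<Sum>w\<in>{0..<n}. max 0 (x w)) \<le> m"
  shows "drain_potential x d cur 0 0 \<le> 4 * n * n + 2 * m * n + 2 * m + (2 * n + 4) * m + 4 * n"
proof -
  have "(\<Sum>w\<in>{0..<n}. if d w < n then max 0 (x w) else 0) \<le> (\<Sum>w\<in>{0..<n}. max 0 (x w))"
    by (rule sum_mono) auto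
  then have "(2 * n + 4) * (\<Sum>w\<in>{0..<n}. if d w < n then max 0 (x w) else 0) \<le> (2 * n + 4) * m"
    using assms(2) n_nonneg by (intro mult_left_mono) auto
  moreover have "(\<Sum>w\<in>{0..<n}. 4 * (n - d w)) = 4 * n * n" "(\<Sum>b\<in>{0..<2 * m}. n - d (from b)) = 2 * m * n"
    using assms(1) n_nonneg m_nonneg by auto
  moreover have "(if 0 < x 0 \<and> d 0 < n then d 0 else n) \<le> n" using assms(1) n_nonneg by auto
  ultimately show ?thesis
    using cursor_potential_le[of cur] unfolding drain_potential_def by simp
qed

text \<open>If the unit has come to rest away from \<open>v\<close>, the scan resumes at
  \<open>v\<close>, which may hold further units; only an idle \<open>v\<close> itself is left
  behind.\<close>

lemma drain_skip:
  assumes I: "drain_inv low F x d cur u v" and "u < n" "\<not> (0 < x u \<and> d u < n)"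
  defines "v' \<equiv> if u = v then v + 1 else v"
  shows "drain_inv low F x d cur v' v'"
    "drain_potential x d cur v' v' \<le> drain_potential x d cur u v - 1"
proof -
  note I' = I[unfolded drain_inv_def]
  have u: "d u = n \<or> x u \<le> 0" using I' assms(3) by (metis linorder_not_le order_le_less)
  have "d w = n \<or> x w \<le> of_bool (w = v')" if "w \<in> {0..<v'}" for w
  proof (cases "w = u")
    case True
    then show ?thesis using u that by auto
  next
    case False
    then have "w \<in> {0..<v}" using that by (auto simp: v'_def split: if_splits)
    then show ?thesis using I' False that by auto
  qed
  then show "drain_inv low F x d cur v' v'"
    unfolding drain_inv_def using I' assms(2) by (auto simp: v'_def)
  have "d v' \<le> n" using I' by blast
  then show "drain_potential x d cur v' v' \<le> drain_potential x d cur u v - 1"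
    using assms(3) unfolding drain_potential_def v'_def by auto
qed

lemma drain_advance:
  assumes I: "drain_inv low F x d cur u v" and "u < n" "0 < cur u"
    and "\<not> (residual low F (cur u - 1) \<and> d (to (cur u - 1)) < d u)"
  defines "cur' \<equiv> cur(u := nxt (cur u - 1))"
  shows "drain_inv low F x d cur' u v"
    "drain_potential x d cur' u v \<le> drain_potential x d cur u v - 1"
proof -
  note I' = I[unfolded drain_inv_def]
  have u: "u \<in> {0..<n}" and cur: "cursor cur" using I' assms(2) by auto
  note adv = cursor_advance[OF cur u assms(3), folded cur'_def]
  have "from (cur u - 1) = u" using cursor_range[OF cur u assms(3)] by simp
  then have "d (from b) \<le> d (to b)" if "b \<in> {0..<2 * m}" "cur' (from b) \<le> b" "residual low F b" for b
    using adv(3)[OF that(1,2)] I' that assms(4) by (metis linorder_not_le)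
  then show "drain_inv low F x d cur' u v"
    unfolding drain_inv_def
    by (intro conjI ballI impI) (use I' adv(1) in blast)+
  show "drain_potential x d cur' u v \<le> drain_potential x d cur u v - 1"
    using adv(2) by (simp add: drain_potential_def)
qed

text \<open>With its whole list passed, every residual arc out of \<open>u\<close> ends at a label
  of at least \<open>d u\<close>, so the increment keeps the labels valid; arcs into
  \<open>u\<close> can only gain. The cursor restarts because its passed arcs may have become
  admissible.\<close>

lemma drain_relabel:
  assumes I: "drain_inv low F x d cur u v" and "u < n" "cur u \<le> 0" "0 < x u" "d u < n"
  defines "cur' \<equiv> cur(u := first u)" and "d' \<equiv> d(u := d u + 1)"
  shows "drain_inv low F x d' cur' u v"
    "drain_potential x d' cur' u v \<le> drain_potential x d cur u v - 1"
proof -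
  note I' = I[unfolded drain_inv_def]
  have u: "u \<in> {0..<n}" and cur: "cursor cur" using I' assms(2) by auto
  have d': "d w \<le> d' w" "0 \<le> d w" for w using I' by (auto simp: d'_def)
  have v1: "d (from b) \<le> d (to b) + 1" "cur (from b) \<le> b \<Longrightarrow> d (from b) \<le> d (to b)"
    if "b \<in> {0..<2 * m}" "residual low F b" for b using I' that by blast+
  have "d' (from b) \<le> d' (to b) + 1" if "b \<in> {0..<2 * m}" "residual low F b" for b
    using v1[OF that] that(1) d'(1)[of "to b"] assms(3) by (cases "from b = u") (auto simp: d'_def)
  moreover have "d' (from b) \<le> d' (to b)"
    if "b \<in> {0..<2 * m}" "cur' (from b) \<le> b" "residual low F b" for b
    using v1(2)[OF that(1,3)] that(2) first_greater[OF that(1)] d'(1)[of "to b"]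
    by (cases "from b = u") (auto simp: d'_def cur'_def)
  moreover have "d' w = n \<or> x w \<le> of_bool (w = u)" if "w \<in> {0..<v}" for w
    using I' that assms(5) by (force simp: d'_def)
  ultimately show "drain_inv low F x d' cur' u v"
    unfolding drain_inv_def using I' cursor_first_update[OF cur, of u, folded cur'_def] assms(4,5)
    by (simp add: d'_def)
  have "(\<Sum>w\<in>{0..<n}. 4 * (n - d' w)) = (\<Sum>w\<in>{0..<n}. 4 * (n - d w) - (if w = u then 4 else 0))"
    by (rule sum.cong) (auto simp: d'_def)
  then have 1: "(\<Sum>w\<in>{0..<n}. 4 * (n - d' w)) = (\<Sum>w\<in>{0..<n}. 4 * (n - d w)) - 4"
    using u by (simp add: sum_subtractf)
  have "(\<Sum>b\<in>{0..<2 * m}. n - d' (from b)) = (\<Sum>b\<in>{0..<2 * m}. (n - d (from b)) - of_bool (from b = u))"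
    by (rule sum.cong) (auto simp: d'_def)
  moreover have "(\<Sum>b\<in>{0..<2 * m}. of_bool (from b = u)) = int (card {b \<in> {0..<2 * m}. from b = u})"
    by (simp add: Int_def)
  ultimately have 2: "(\<Sum>b\<in>{0..<2 * m}. n - d' (from b)) =
      (\<Sum>b\<in>{0..<2 * m}. n - d (from b)) - int (card {b \<in> {0..<2 * m}. from b = u})"
    by (simp only: sum_subtractf)
  \<comment> \<open>The reset brings back at most the residual arcs of \<open>u\<close>, and their
    number is what the second sum has just lost.\<close>
  have "{b \<in> {0..<2 * m}. b < cur' (from b)} \<subseteq>
      {b \<in> {0..<2 * m}. b < cur (from b)} \<union> {b \<in> {0..<2 * m}. from b = u}"
    by (auto simp: cur'_def split: if_splits)
  then have "card {b \<in> {0..<2 * m}. b < cur' (from b)} \<le>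
      card ({b \<in> {0..<2 * m}. b < cur (from b)} \<union> {b \<in> {0..<2 * m}. from b = u})"
    by (intro card_mono) (auto intro: finite_subset[of _ "{0..<2 * m}"])
  also have "\<dots> \<le> card {b \<in> {0..<2 * m}. b < cur (from b)} + card {b \<in> {0..<2 * m}. from b = u}"
    by (rule card_Un_le)
  finally have 3: "cursor_potential cur' \<le> cursor_potential cur + int (card {b \<in> {0..<2 * m}. from b = u})"
    by (simp add: cursor_potential_def)
  have "(\<Sum>w\<in>{0..<n}. if d' w < n then max 0 (x w) else 0) \<le> (\<Sum>w\<in>{0..<n}. if d w < n then max 0 (x w) else 0)"
    by (rule sum_mono) (auto simp: d'_def)
  then have 4: "(2 * n + 4) * (\<Sum>w\<in>{0..<n}. if d' w < n then max 0 (x w) else 0)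
      \<le> (2 * n + 4) * (\<Sum>w\<in>{0..<n}. if d w < n then max 0 (x w) else 0)"
    using n_nonneg by (intro mult_left_mono) auto
  have 5: "(if 0 < x u \<and> d' u < n then d' u else n) = (if 0 < x u \<and> d u < n then d u else n) + 1"
    using assms(4,5) by (auto simp: d'_def)
  show "drain_potential x d' cur' u v \<le> drain_potential x d cur u v - 1"
    unfolding drain_potential_def using 1 2 3 4 5 by linarith
qed

text \<open>The only residual arc that a push can create is the reverse one. It leads from
  \<open>w\<close> up to the higher label of \<open>u\<close>, so it satisfies both clauses on
  residual arcs.\<close>

lemma drain_push:
  assumes I: "drain_inv low F x d cur u v" and "u < n" "0 < cur u" "0 < x u" "d u < n"
  defines "b \<equiv> cur u - 1"
  defines "w \<equiv> to b"
  assumes res: "residual low F b" and dw: "d w < d u"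
  defines "F' \<equiv> F(b div 2 := F (b div 2) + (if even b then 1 else -1))"
    and "x' \<equiv> (x(u := x u - 1))(w := x w + 1)"
  shows "drain_inv low F' x' d cur w v"
    "drain_potential x' d cur w v \<le> drain_potential x d cur u v - 1"
proof -
  note I' = I[unfolded drain_inv_def]
  have u: "u \<in> {0..<n}" and cur: "cursor cur" using I' assms(2) by auto
  have b: "b \<in> {0..<2 * m}" "from b = u" using cursor_range[OF cur u assms(3)] by (auto simp: b_def)
  have e: "b div 2 \<in> {0..<m}" using half_arc[OF b(1)] .
  have w: "w \<in> {0..<n}" using to_vertex[OF b(1)] by (simp add: w_def)
  have uw: "u \<noteq> w" using dw by auto
  have ends: "even b \<Longrightarrow> ta (b div 2) = u \<and> he (b div 2) = w" "odd b \<Longrightarrow> he (b div 2) = u \<and> ta (b div 2) = w"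
    using b(2) w_def by (auto simp: src_def)
  have x': "x' y = ex F' y" for y
    using excess_update[OF e, of ta he F] ends I' uw unfolding F'_def x'_def
    by (cases "even b") auto
  have res': "residual low F c \<or> from c = w \<and> to c = u" if "residual low F' c" for c
  proof (cases "odd c \<and> even b \<and> c div 2 = b div 2")
    case True
    then show ?thesis using ends(1) by (simp add: src_def)
  next
    case False
    then have "F' (c div 2) \<le> F (c div 2) \<or> even c" by (auto simp: F'_def)
    then show ?thesis using that by (auto simp: residual_def)
  qed
  have valid: "d (from c) \<le> d (to c) + 1" "cur (from c) \<le> c \<Longrightarrow> d (from c) \<le> d (to c)"
    if "c \<in> {0..<2 * m}" "residual low F' c" for c
  proof -
    show "d (from c) \<le> d (to c) + 1" using res'[OF that(2)]
    proof
      assume "residual low F c"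
      then show ?thesis using I' that(1) by blast
    qed (use dw in simp)
    show "d (from c) \<le> d (to c)" if c: "cur (from c) \<le> c" using res'[OF \<open>residual low F' c\<close>]
    proof
      assume "residual low F c"
      then show ?thesis using I' c \<open>c \<in> {0..<2 * m}\<close> by blast
    qed (use dw in simp)
  qed
  have low: "low e \<le> F' e" if "e \<in> {0..<m}" for e
  proof -
    have "low e \<le> F e" using I' that by blast
    then show ?thesis using res by (cases "even b") (auto simp: F'_def residual_def)
  qed
  have sink: "d y = 0" if "x' y < 0" for y
  proof -
    have "x y < 0" using that assms(4) by (auto simp: x'_def split: if_splits)
    then show ?thesis using I' by blast
  qed
  have early: "d y = n \<or> x' y \<le> of_bool (y = w)" if "y \<in> {0..<v}" for y
  proof -
    have "d y = n \<or> x y \<le> of_bool (y = u)" using I' that by blast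
    moreover have "d w < n" using dw assms(5) by simp
    ultimately show ?thesis using uw by (auto simp: x'_def split: if_splits)
  qed
  show "drain_inv low F' x' d cur w v"
  proof -
    have "0 \<le> v" "cursor cur" "\<forall>w. 0 \<le> d w \<and> d w \<le> n" using I' by blast+
    moreover have "0 \<le> w" "w < n \<and> v < n \<or> w = n \<and> v = n" using I' w assms(2) by auto
    moreover have "\<forall>e\<in>{0..<m}. low e \<le> F' e" using low by blast
    moreover have "\<forall>y. x' y = ex F' y" using x' by blast
    moreover have "\<forall>y. x' y < 0 \<longrightarrow> d y = 0" using sink by blast
    moreover have "\<forall>c\<in>{0..<2 * m}. residual low F' c \<longrightarrow> d (from c) \<le> d (to c) + 1"
      using valid(1) by blast
    moreover have "\<forall>c\<in>{0..<2 * m}. cur (from c) \<le> c \<and> residual low F' c \<longrightarrow> d (from c) \<le> d (to c)"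
      using valid(2) by blast
    moreover have "\<forall>y\<in>{0..<v}. d y = n \<or> x' y \<le> of_bool (y = w)" using early by blast
    ultimately show ?thesis unfolding drain_inv_def by (intro conjI) assumption+
  qed
  let ?T = "\<lambda>x. \<Sum>y\<in>{0..<n}. if d y < n then max 0 (x y) else 0"
  have dwn: "d w < n" using dw assms(5) by simp
  \<comment> \<open>The surplus below the cap falls by one at \<open>u\<close> and reappears at
    \<open>w\<close> unless it meets a deficit there.\<close>
  have "?T x' = (\<Sum>y\<in>{0..<n}. (if d y < n then max 0 (x y) else 0) - (if y = u then 1 else 0)
      + (if y = w then of_bool (0 \<le> x w) else 0))"
    using uw dwn assms(4,5) by (intro sum.cong) (auto simp: x'_def)
  then have T: "?T x' = ?T x - 1 + of_bool (0 \<le> x w)"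
    using u w by (simp add: sum.distrib sum_subtractf)
  have d: "0 \<le> d w" "d u \<le> n" "0 \<le> d u" using I' by auto
  \<comment> \<open>If the unit travels on, the doubled label falls by at least 2, which outweighs a
    change of \<open>of_bool\<close>. If a deficit absorbs it, \<open>2 * n + 4\<close> pays for the
    jump of the doubled term to \<open>2 * n\<close>.\<close>
  show "drain_potential x' d cur w v \<le> drain_potential x d cur u v - 1"
  proof (cases "0 \<le> x w")
    case True
    then have "?T x' = ?T x" using T by simp
    moreover have "(if 0 < x' w \<and> d w < n then d w else n) = d w" using True dwn by (simp add: x'_def)
    ultimately show ?thesis using dw uw assms(4,5) unfolding drain_potential_def
      by (auto simp: of_bool_def)
  next
    case False
    then have "?T x' = ?T x - 1" using T by simp
    then have "(2 * n + 4) * ?T x' = (2 * n + 4) * ?T x - (2 * n + 4)"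
      by (simp only: right_diff_distrib mult_1_right)
    moreover have "(if 0 < x' w \<and> d w < n then d w else n) = n" using False by (simp add: x'_def)
    moreover have "(if 0 < x u \<and> d u < n then d u else n) = d u" using assms(4,5) by simp
    moreover have "of_bool (w \<noteq> v) \<le> (1 :: int)" "0 \<le> (of_bool (u \<noteq> v) :: int)" by simp_all
    ultimately show ?thesis using d(3) unfolding drain_potential_def by linarith
  qed
qed

text \<open>Some value in \<open>{0..n}\<close> is the label of none of the \<open>n\<close> nodes, and along residual arcs labels
  drop by at most 1. Hence the nodes with larger labels form the closed set \<open>R\<close>.\<close>

lemma drain_cut:
  assumes I: "drain_inv low F x d cur u v" and "\<not> u < n"
  obtains R where "R \<subseteq> {0..<n}" "\<And>w. 0 < ex F w \<Longrightarrow> w \<in> R" "\<And>w. ex F w < 0 \<Longrightarrow> w \<notin> R"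
    "\<And>b. b \<in> {0..<2 * m} \<Longrightarrow> residual low F b \<Longrightarrow> from b \<in> R \<Longrightarrow> to b \<in> R"
proof -
  note I' = I[unfolded drain_inv_def]
  have "v = n" using I' assms(2) by auto
  then have settled: "d w = n \<or> ex F w \<le> 0" if "w \<in> {0..<n}" for w using I' that assms(2) by force
  have "card (d ` {0..<n}) \<le> card {0..<n}" by (rule card_image_le) simp
  also have "\<dots> < card {0..n}" using n_nonneg by simp
  finally have "\<not> {0..n} \<subseteq> d ` {0..<n}" by (meson card_mono finite_atLeastLessThan_int finite_imageI not_le)
  then obtain k where k: "0 \<le> k" "k \<le> n" "k \<notin> d ` {0..<n}"
    by (meson atLeastAtMost_iff subsetI)
  let ?R = "{w \<in> {0..<n}. k < d w}"
  have above: "w \<in> ?R" if "w \<in> {0..<n}" "k \<le> d w" for w using that k(3) by (auto simp: order_le_less)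
  show thesis
  proof (rule that[of ?R])
    fix w assume "0 < ex F w"
    moreover from this have "w \<in> {0..<n}" using excess_outside by force
    ultimately show "w \<in> ?R" using settled above k(2) by force
  next
    fix w assume "ex F w < 0"
    then have "d w = 0" using I' by simp
    then show "w \<notin> ?R" using k(1) by simp
  next
    fix b assume b: "b \<in> {0..<2 * m}" "residual low F b" "from b \<in> ?R"
    then have "d (from b) \<le> d (to b) + 1" using I' by blast
    then show "to b \<in> ?R" using above[OF to_vertex[OF b(1)]] b(3) by simp
  qed auto
qed

end

section \<open>The push-relabel program and its running time\<close>

abbreviation neq :: "exp \<Rightarrow> exp \<Rightarrow> cond" where
  "neq e f \<equiv> Not (And (Not (Less e f)) (Not (Less f e)))"

definition drain_step :: prog where
  "drain_step =
     If (And (Less (Const 0) (Elem ''ex'' (Var ''u''))) (Less (Elem ''d'' (Var ''u'')) (Var ''n'')))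
       (Seq (Assign ''a'' (Elem ''cur'' (Var ''u'')))
       (If (Less (Var ''a'') (Const 1))
         (Seq (Store ''d'' (Var ''u'') (Add (Elem ''d'' (Var ''u'')) (Const 1)))
              (Store ''cur'' (Var ''u'') (Elem ''first'' (Var ''u''))))
         (Seq (Assign ''a'' (Sub (Var ''a'') (Const 1)))
         (Seq (Assign ''e'' (Half (Var ''a'')))
         (If (Less (Var ''a'') (Add (Add (Var ''e'') (Var ''e'')) (Const 1)))
           (Seq (Assign ''w'' (Elem ''head'' (Var ''e'')))
           (If (Less (Elem ''d'' (Var ''w'')) (Elem ''d'' (Var ''u'')))
             (Seq (Store ''F'' (Var ''e'') (Add (Elem ''F'' (Var ''e'')) (Const 1)))
             (Seq (Store ''ex'' (Var ''u'') (Sub (Elem ''ex'' (Var ''u'')) (Const 1)))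
             (Seq (Store ''ex'' (Var ''w'') (Add (Elem ''ex'' (Var ''w'')) (Const 1)))
             (Assign ''u'' (Var ''w'')))))
             (Store ''cur'' (Var ''u'') (Elem ''next'' (Var ''a'')))))
           (Seq (Assign ''w'' (Elem ''tail'' (Var ''e'')))
           (If (And (Less (Elem ''low'' (Var ''e'')) (Elem ''F'' (Var ''e'')))
                    (Less (Elem ''d'' (Var ''w'')) (Elem ''d'' (Var ''u''))))
             (Seq (Store ''F'' (Var ''e'') (Sub (Elem ''F'' (Var ''e'')) (Const 1)))
             (Seq (Store ''ex'' (Var ''u'') (Sub (Elem ''ex'' (Var ''u'')) (Const 1)))
             (Seq (Store ''ex'' (Var ''w'') (Add (Elem ''ex'' (Var ''w'')) (Const 1)))
             (Assign ''u'' (Var ''w'')))))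
             (Store ''cur'' (Var ''u'') (Elem ''next'' (Var ''a''))))))))))
       (Seq (If (neq (Var ''u'') (Var ''v'')) (Assign ''v'' (Var ''v'')) (Assign ''v'' (Add (Var ''v'') (Const 1))))
         (Assign ''u'' (Var ''v'')))"

definition drain :: prog where
  "drain = Seq reset_cursors (Seq (Seq (Assign ''u'' (Const 0)) (Assign ''v'' (Const 0)))
     (While (Less (Var ''u'') (Var ''n'')) drain_step))"

context network
begin

text \<open>Complementary slackness, the certificate of minimality that push-relabel leaves behind.
  It makes sense while surplus and deficits remain, so \<open>settle\<close> can preserve it; once
  only \<open>s\<close> and \<open>t\<close> are unbalanced, it turns into the equality of value and
  cut.\<close>

definition is_cut :: "int set \<Rightarrow> (int \<Rightarrow> int) \<Rightarrow> (int \<Rightarrow> int) \<Rightarrow> bool" where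
  "is_cut R low F \<longleftrightarrow> R \<subseteq> {0..<n} \<and> (\<forall>e\<in>{0..<m}. low e \<le> F e) \<and>
     (\<forall>w. 0 < ex F w \<longrightarrow> w \<in> R) \<and> (\<forall>w. ex F w < 0 \<longrightarrow> w \<notin> R) \<and>
     (\<forall>e\<in>{0..<m}. ta e \<in> R \<longrightarrow> he e \<in> R) \<and>
     (\<forall>e\<in>{0..<m}. he e \<in> R \<and> ta e \<notin> R \<longrightarrow> F e = low e)"

lemma drain_is_cut:
  assumes I: "drain_inv low F x d cur u v" and "\<not> u < n"
  shows "\<exists>R. is_cut R low F"
proof (rule drain_cut[OF assms])
  fix R assume R: "R \<subseteq> {0..<n}" "\<And>w. 0 < ex F w \<Longrightarrow> w \<in> R" "\<And>w. ex F w < 0 \<Longrightarrow> w \<notin> R"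
    "\<And>b. b \<in> {0..<2 * m} \<Longrightarrow> residual low F b \<Longrightarrow> from b \<in> R \<Longrightarrow> to b \<in> R"
  have low: "low e \<le> F e" if "e \<in> {0..<m}" for e using I that by (simp add: drain_inv_def)
  \<comment> \<open>The forward arc \<open>2 * e\<close> is always residual, so no arc leaves
    \<open>R\<close>. The backward arc \<open>2 * e + 1\<close> of an arc entering \<open>R\<close>
    would lead out of it, so it cannot be residual, which forces \<open>F e = low e\<close>.\<close>
  have "he e \<in> R" if "e \<in> {0..<m}" "ta e \<in> R" for e
    using R(4)[of "2 * e"] that by (simp add: residual_def src_def)
  moreover have "F e = low e" if "e \<in> {0..<m}" "he e \<in> R" "ta e \<notin> R" for e
    using R(4)[of "2 * e + 1"] that low[OF that(1)]
    by (cases "low e < F e") (simp_all add: residual_def src_def)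
  ultimately have "is_cut R low F" using R(1-3) low by (simp add: is_cut_def)
  then show ?thesis ..
qed

lemma drain_init:
  assumes "\<forall>w\<in>{0..<n}. cur w = first w" "\<And>w. d w = 0" "\<And>e. e \<in> {0..<m} \<Longrightarrow> low e \<le> F e"
    "\<And>w. x w = ex F w"
  shows "drain_inv low F x d cur 0 0"
proof -
  have "\<not> cur (from b) \<le> b" if "b \<in> {0..<2 * m}" for b
    using first_greater[OF that] from_vertex[OF that] assms(1) by simp
  then show ?thesis
    unfolding drain_inv_def using assms cursor_first[OF assms(1)] n_nonneg by auto
qed

lemma terminates_drain:
  assumes \<sigma>: "represents \<sigma>" and d: "\<And>w. arr \<sigma> ''d'' w = 0"
    and F: "\<And>e. e \<in> {0..<m} \<Longrightarrow> arr \<sigma> ''low'' e \<le> arr \<sigma> ''F'' e"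
    and x: "\<And>w. arr \<sigma> ''ex'' w = ex (arr \<sigma> ''F'') w"
    and sur: "(\<Sum>w\<in>{0..<n}. max 0 (arr \<sigma> ''ex'' w)) \<le> m"
  shows "terminates drain \<sigma> (1000 * (n * n + m * n + n + m + 1)) (\<lambda>\<sigma>'.
    (\<forall>w. arr \<sigma>' ''ex'' w = ex (arr \<sigma>' ''F'') w) \<and> (\<exists>R. is_cut R (arr \<sigma> ''low'') (arr \<sigma>' ''F'')))"
proof -
  let ?low = "arr \<sigma> ''low''"
  let ?I = "\<lambda>\<sigma>'. drain_inv ?low (arr \<sigma>' ''F'') (arr \<sigma>' ''ex'') (arr \<sigma>' ''d'') (arr \<sigma>' ''cur'')
    (scalar \<sigma>' ''u'') (scalar \<sigma>' ''v'')"
  let ?V = "\<lambda>\<sigma>'. drain_potential (arr \<sigma>' ''ex'') (arr \<sigma>' ''d'') (arr \<sigma>' ''cur'') (scalar \<sigma>' ''u'') (scalar \<sigma>' ''v'')"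
  let ?w = "While (Less (Var ''u'') (Var ''n'')) drain_step"
  let ?Q = "\<lambda>\<sigma>'. (\<forall>w. arr \<sigma>' ''ex'' w = ex (arr \<sigma>' ''F'') w) \<and> (\<exists>R. is_cut R ?low (arr \<sigma>' ''F''))"
  let ?P = "4 * n * n + 2 * m * n + 2 * m + (2 * n + 4) * m + 4 * n"
  note defs = drain_def reset_cursors_def for_loop_def drain_step_def
  have loop: "terminates ?w \<sigma>1 (100 * (?P + 1)) ?Q"
    if fr: "frame drain \<sigma> \<sigma>1" and cur: "\<forall>w\<in>{0..<n}. arr \<sigma>1 ''cur'' w = first w"
      and uv: "scalar \<sigma>1 ''u'' = 0" "scalar \<sigma>1 ''v'' = 0"
      and same: "arr \<sigma>1 ''F'' = arr \<sigma> ''F''" "arr \<sigma>1 ''ex'' = arr \<sigma> ''ex''" "arr \<sigma>1 ''d'' = arr \<sigma> ''d''" for \<sigma>1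
  proof -
    have init: "?I \<sigma>1" "?V \<sigma>1 \<le> ?P"
      using drain_init[OF cur, of "arr \<sigma> ''d''" ?low "arr \<sigma> ''F''" "arr \<sigma> ''ex''"]
        drain_potential_init[of "arr \<sigma> ''d''" "arr \<sigma> ''ex''" "arr \<sigma>1 ''cur''"] d F x sur same uv by auto
    have step: "?I (exec drain_step \<sigma>') \<and> ?V (exec drain_step \<sigma>') \<le> ?V \<sigma>' - 1"
      if f: "frame drain_step \<sigma>1 \<sigma>'" and I: "?I \<sigma>'" and b: "eval_cond (Less (Var ''u'') (Var ''n'')) \<sigma>'" for \<sigma>'
    proof -
      have f': "frame drain \<sigma> \<sigma>'"
        using fr f by (simp add: frame_def drain_def)
      have r: "represents \<sigma>'"
        using represents_frame[OF f'] \<sigma> by (simp add: defs)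
      have low: "arr \<sigma>' ''low'' = ?low"
        using frame_arr[OF f'] by (simp add: defs)
      have u: "scalar \<sigma>' ''u'' < n" using b r by (simp add: represents_def)
      let ?c = "arr \<sigma>' ''cur''" and ?u = "scalar \<sigma>' ''u''" and ?v = "scalar \<sigma>' ''v''"
        and ?d = "arr \<sigma>' ''d''" and ?x = "arr \<sigma>' ''ex''" and ?F = "arr \<sigma>' ''F''"
      show ?thesis
      proof (cases "0 < ?x ?u \<and> ?d ?u < n")
        case False
        note skip = drain_skip[OF I u False]
        have "\<not> 0 < ?x ?u \<or> (0 < ?x ?u \<and> \<not> ?d ?u < n)" using False by blast
        then show ?thesis
        proof (elim disjE conjE)
          assume "\<not> 0 < ?x ?u"
          then show ?thesis using skip by (cases "?u = ?v"; cases "?u < ?v") (simp_all add: drain_step_def)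
        next
          assume "0 < ?x ?u" "\<not> ?d ?u < n"
          then show ?thesis using skip r
            by (cases "?u = ?v"; cases "?u < ?v") (simp_all add: drain_step_def represents_def)
        qed
      next
        case active: True
        show ?thesis
        proof (cases "?c ?u \<le> 0")
          case True
          then show ?thesis using drain_relabel[OF I u True conjunct1[OF active] conjunct2[OF active]] active r
            by (simp add: drain_step_def represents_def)
        next
          case False
          then have c: "0 < ?c ?u" by simp
          let ?b = "?c ?u - 1"
          show ?thesis
          proof (cases "residual ?low ?F ?b \<and> ?d (to ?b) < ?d ?u")
            case False
            then show ?thesis using c active drain_advance[OF I u c False] r low
              by (cases "even ?b"; cases "?d (to ?b) < ?d ?u")
                (simp_all add: drain_step_def represents_def even_iff_le_half src_def residual_def)
          next
            case True
            then have "to ?b \<noteq> ?u" by auto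
            then show ?thesis
              using c active True r low
                drain_push[OF I u c conjunct1[OF active] conjunct2[OF active] conjunct1[OF True] conjunct2[OF True]]
              by (cases "even ?b")
                (simp_all add: drain_step_def represents_def even_iff_le_half src_def residual_def)
          qed
        qed
      qed
    qed
    have "terminates ?w \<sigma>1 (100 * (?V \<sigma>1 + 1)) (\<lambda>\<sigma>'. ?I \<sigma>' \<and> \<not> eval_cond (Less (Var ''u'') (Var ''n'')) \<sigma>')"
    proof (rule terminates_While_exec[where I = ?I and V = ?V])
      show "0 \<le> ?V \<sigma>'" if "?I \<sigma>'" for \<sigma>'
        using drain_potential_nonneg[OF that] .
    qed (fact step init(1) | simp add: drain_step_def)+
    then show ?thesis
    proof (elim terminates_mono, goal_cases)
      case 1
      then show ?case using init(2) by simp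
    next
      case (2 \<sigma>')
      have "scalar \<sigma>' ''n'' = n"
        using 2 fr \<sigma> by (simp add: frame_def defs represents_def)
      then have "?I \<sigma>'" "\<not> scalar \<sigma>' ''u'' < n" using 2 by simp_all
      moreover from this have "\<forall>w. arr \<sigma>' ''ex'' w = ex (arr \<sigma>' ''F'') w"
        unfolding drain_inv_def by blast
      ultimately show ?case using drain_is_cut by blast
    qed
  qed
  let ?N = "200 * (n + 1) + (int 4 + 100 * (?P + 1))"
  have "terminates drain \<sigma> ?N ?Q"
    unfolding drain_def
  proof (rule terminates_Seq[OF terminates_reset_cursors[OF \<sigma>]])
    fix \<sigma>' assume *: "frame reset_cursors \<sigma> \<sigma>'" "\<forall>w\<in>{0..<n}. arr \<sigma>' ''cur'' w = first w"
    let ?c = "Seq (Assign ''u'' (Const 0)) (Assign ''v'' (Const 0))"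
    have "terminates ?w (exec ?c \<sigma>') (100 * (?P + 1)) ?Q"
      by (rule loop) (use * in \<open>simp_all add: frame_def drain_def reset_cursors_def for_loop_def\<close>)
    from terminates_Seq_exec[OF _ this] show "terminates (Seq ?c ?w) \<sigma>' (int 4 + 100 * (?P + 1)) ?Q"
      by simp
  qed
  moreover have "0 \<le> n * n" "0 \<le> m * n" using n_nonneg m_nonneg by simp_all
  ultimately show ?thesis by (elim terminates_mono) (use n_nonneg m_nonneg in \<open>auto simp: algebra_simps\<close>)
qed

end

section \<open>Routing the remaining surplus to \<open>t\<close> and filling the remaining deficits
  from \<open>s\<close>\<close>

definition settle_step :: prog where
  "settle_step =
     If (And (Less (Const 0) (Elem ''ex'' (Var ''u''))) (neq (Var ''u'') (Var ''t'')))
       (Seq (Assign ''e'' (Elem ''out'' (Var ''u'')))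
       (Seq (Assign ''w'' (Elem ''head'' (Var ''e'')))
       (Seq (Store ''F'' (Var ''e'') (Add (Elem ''F'' (Var ''e'')) (Elem ''ex'' (Var ''u''))))
       (Seq (Store ''ex'' (Var ''w'') (Add (Elem ''ex'' (Var ''w'')) (Elem ''ex'' (Var ''u''))))
       (Seq (Store ''ex'' (Var ''u'') (Const 0)) (Assign ''u'' (Var ''w'')))))))
       (If (And (Less (Elem ''ex'' (Var ''u'')) (Const 0)) (neq (Var ''u'') (Var ''s'')))
         (Seq (Assign ''e'' (Elem ''in'' (Var ''u'')))
         (Seq (Assign ''w'' (Elem ''tail'' (Var ''e'')))
         (Seq (Store ''F'' (Var ''e'') (Sub (Elem ''F'' (Var ''e'')) (Elem ''ex'' (Var ''u''))))
         (Seq (Store ''ex'' (Var ''w'') (Add (Elem ''ex'' (Var ''w'')) (Elem ''ex'' (Var ''u''))))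
         (Seq (Store ''ex'' (Var ''u'') (Const 0)) (Assign ''u'' (Var ''w'')))))))
         (Seq (Assign ''v'' (Add (Var ''v'') (Const 1))) (Assign ''u'' (Var ''v''))))"

definition settle :: prog where
  "settle = Seq (Seq (Assign ''u'' (Const 0)) (Assign ''v'' (Const 0)))
     (While (Less (Var ''u'') (Var ''n'')) settle_step)"

text \<open>\<open>rk\<close> is a topological numbering. One arbitrary arc out of each node and one
  into it are enough, since following them can only end in \<open>t\<close> and in \<open>s\<close>,
  respectively.\<close>

locale dag_network = network +
  fixes s t :: int and rk oa ia :: "int \<Rightarrow> int"
  assumes rk_range: "v \<in> {0..<n} \<Longrightarrow> 0 \<le> rk v \<and> rk v < n"
    and rk_less: "e \<in> {0..<m} \<Longrightarrow> rk (ta e) < rk (he e)"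
    and out_arc: "v \<in> {0..<n} \<Longrightarrow> v \<noteq> t \<Longrightarrow> oa v \<in> {0..<m} \<and> ta (oa v) = v"
    and in_arc: "v \<in> {0..<n} \<Longrightarrow> v \<noteq> s \<Longrightarrow> ia v \<in> {0..<m} \<and> he (ia v) = v"
begin

definition represents_dag :: "state \<Rightarrow> bool" where
  "represents_dag \<sigma> \<longleftrightarrow> represents \<sigma> \<and> scalar \<sigma> ''s'' = s \<and> scalar \<sigma> ''t'' = t \<and>
     arr \<sigma> ''out'' = oa \<and> arr \<sigma> ''in'' = ia"

definition balanced :: "(int \<Rightarrow> int) \<Rightarrow> int \<Rightarrow> bool" where
  "balanced x u \<longleftrightarrow> \<not> (0 < x u \<and> u \<noteq> t) \<and> \<not> (x u < 0 \<and> u \<noteq> s)"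

text \<open>Unlike in \<open>drain\<close>, the whole excess of a node moves at once, so among the
  nodes up to \<open>v\<close> only the current \<open>u\<close> can be unbalanced, and the scan
  never has to return to \<open>v\<close>.\<close>

definition settle_inv ::
  "int set \<Rightarrow> (int \<Rightarrow> int) \<Rightarrow> (int \<Rightarrow> int) \<Rightarrow> (int \<Rightarrow> int) \<Rightarrow> int \<Rightarrow> int \<Rightarrow> bool" where
  "settle_inv R low F x u v \<longleftrightarrow>
     0 \<le> v \<and> 0 \<le> u \<and> (u < n \<and> v < n \<or> u = n \<and> v = n) \<and> is_cut R low F \<and>
     (\<forall>w. x w = ex F w) \<and> (\<forall>w\<in>{0..v}. w = u \<or> balanced x w)"

text \<open>Since \<open>R\<close> is closed, a unit of excess is only moved forward inside \<open>R\<close> and a unit of deficit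
  only backward outside of \<open>R\<close>, so the rank of \<open>u\<close> changes monotonically.\<close>

definition settle_potential :: "int set \<Rightarrow> (int \<Rightarrow> int) \<Rightarrow> int \<Rightarrow> int \<Rightarrow> int" where
  "settle_potential R x u v = (n - v) * (n + 2) +
     (if balanced x u then 0 else if u \<in> R then n - rk u else rk u + 1)"

lemma settle_potential_nonneg:
  assumes "settle_inv R low F x u v"
  shows "0 \<le> settle_potential R x u v"
proof -
  have "v \<le> n" "0 \<le> u" "u \<le> n" "x n = 0"
    using assms excess_outside[of n] by (auto simp: settle_inv_def)
  then have "balanced x u \<or> u \<in> {0..<n}" by (cases "u = n") (auto simp: balanced_def)
  then have "0 \<le> (if balanced x u then 0 else if u \<in> R then n - rk u else rk u + 1)"
    using rk_range[of u] by auto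
  moreover have "0 \<le> (n - v) * (n + 2)" using \<open>v \<le> n\<close> n_nonneg by simp
  ultimately show ?thesis by (simp add: settle_potential_def)
qed

text \<open>Leaving \<open>v\<close> frees \<open>n + 2\<close>, more than the potential, at most
  \<open>n\<close>, of the walk that may start at \<open>v + 1\<close>.\<close>

lemma settle_next:
  assumes I: "settle_inv R low F x u v" and "u < n" "balanced x u"
  shows "settle_inv R low F x (v + 1) (v + 1)"
    "settle_potential R x (v + 1) (v + 1) \<le> settle_potential R x u v - 1"
proof -
  show J: "settle_inv R low F x (v + 1) (v + 1)"
    using assms by (auto simp: settle_inv_def)
  have x: "x n = 0" using I excess_outside[of n] by (simp add: settle_inv_def)
  define q where "q = (if balanced x (v + 1) then 0 else if v + 1 \<in> R then n - rk (v + 1) else rk (v + 1) + 1)"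
  have "balanced x (v + 1) \<or> v + 1 \<in> {0..<n}"
    using J x by (cases "v + 1 = n") (auto simp: balanced_def settle_inv_def)
  then have "q \<le> n" using rk_range[of "v + 1"] n_nonneg by (auto simp: q_def)
  moreover have "settle_potential R x (v + 1) (v + 1) = (n - v) * (n + 2) - (n + 2) + q"
    by (simp add: settle_potential_def q_def algebra_simps)
  ultimately show "settle_potential R x (v + 1) (v + 1) \<le> settle_potential R x u v - 1"
    using assms(3) by (simp add: settle_potential_def)
qed

text \<open>Surplus puts \<open>u\<close> into the closed set \<open>R\<close>, and hence also
  \<open>w\<close>. So the arc does not enter \<open>R\<close> from outside and the tight arcs stay
  tight; moreover, \<open>w\<close> has no deficit, so its excess stays nonnegative.\<close>

lemma settle_push:
  assumes I: "settle_inv R low F x u v" and "u < n" "0 < x u" "u \<noteq> t"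
  defines "e \<equiv> oa u"
  defines "w \<equiv> he e"
  defines "F' \<equiv> F(e := F e + x u)" and "x' \<equiv> x(w := x w + x u, u := 0)"
  shows "settle_inv R low F' x' w v"
    "settle_potential R x' w v \<le> settle_potential R x u v - 1" "u \<noteq> w"
proof -
  note I' = I[unfolded settle_inv_def]
  have u: "u \<in> {0..<n}" using I' assms(2) by auto
  have e: "e \<in> {0..<m}" "ta e = u" using out_arc[OF u assms(4)] by (auto simp: e_def)
  have rk: "rk u < rk w" using rk_less[OF e(1)] e(2) by (simp add: w_def)
  then show uw: "u \<noteq> w" by auto
  have w: "w \<in> {0..<n}" using head_vertex[OF e(1)] by (simp add: w_def)
  have cut: "is_cut R low F" and x: "\<And>y. x y = ex F y" using I' by auto
  note C = cut[unfolded is_cut_def]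
  have uR: "u \<in> R" using C assms(3) x by metis
  have wR: "w \<in> R" using C uR e by (auto simp: w_def)
  have x': "x' y = ex F' y" for y
    using excess_update[OF e(1), of ta he F "F e + x u" y] x e(2) uw by (simp add: x'_def F'_def w_def)
  have pos: "0 \<le> x w" using C wR x by (metis linorder_not_le)
  have "F e' \<le> F' e'" for e' using assms(3) by (simp add: F'_def)
  then have "\<forall>e'\<in>{0..<m}. low e' \<le> F' e'" using C by (meson order_trans)
  moreover have "\<forall>y. 0 < ex F' y \<longrightarrow> y \<in> R"
    unfolding x'[symmetric] x'_def using C x wR by (metis fun_upd_apply less_irrefl)
  moreover have "\<forall>y. ex F' y < 0 \<longrightarrow> y \<notin> R"
    unfolding x'[symmetric] x'_def using C x pos assms(3) by (auto split: if_splits)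
  moreover have "\<forall>e'\<in>{0..<m}. he e' \<in> R \<and> ta e' \<notin> R \<longrightarrow> F' e' = low e'"
    using C uR e(2) by (auto simp: F'_def)
  ultimately have "is_cut R low F'" unfolding is_cut_def using C by (intro conjI) (assumption | simp)+
  moreover have "\<forall>y\<in>{0..v}. y = w \<or> balanced x' y"
    using I' by (auto simp: balanced_def x'_def)
  ultimately show "settle_inv R low F' x' w v"
    unfolding settle_inv_def using I' x' w assms(2) by auto
  have "rk w < n" using rk_range[OF w] by simp
  moreover have "\<not> balanced x u" using assms(3,4) by (simp add: balanced_def)
  ultimately show "settle_potential R x' w v \<le> settle_potential R x u v - 1"
    using rk uR wR by (simp add: settle_potential_def)
qed

text \<open>The mirror image of \<open>settle_push\<close>: as no arc leaves \<open>R\<close>, an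
  arc that ends outside of \<open>R\<close> also starts there, so its flow may grow without touching
  a tight arc.\<close>

lemma settle_pull:
  assumes I: "settle_inv R low F x u v" and "u < n" "x u < 0" "u \<noteq> s"
  defines "e \<equiv> ia u"
  defines "w \<equiv> ta e"
  defines "F' \<equiv> F(e := F e - x u)" and "x' \<equiv> x(w := x w + x u, u := 0)"
  shows "settle_inv R low F' x' w v"
    "settle_potential R x' w v \<le> settle_potential R x u v - 1" "u \<noteq> w"
proof -
  note I' = I[unfolded settle_inv_def]
  have u: "u \<in> {0..<n}" using I' assms(2) by auto
  have e: "e \<in> {0..<m}" "he e = u" using in_arc[OF u assms(4)] by (auto simp: e_def)
  have rk: "rk w < rk u" using rk_less[OF e(1)] e(2) by (simp add: w_def)
  then show uw: "u \<noteq> w" by auto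
  have w: "w \<in> {0..<n}" using tail_vertex[OF e(1)] by (simp add: w_def)
  have cut: "is_cut R low F" and x: "\<And>y. x y = ex F y" using I' by auto
  note C = cut[unfolded is_cut_def]
  have uR: "u \<notin> R" using C assms(3) x by metis
  have wR: "w \<notin> R" using C uR e by (auto simp: w_def)
  have x': "x' y = ex F' y" for y
    using excess_update[OF e(1), of ta he F "F e - x u" y] x e(2) uw by (simp add: x'_def F'_def w_def)
  have pos: "x w \<le> 0" using C wR x by (metis linorder_not_le)
  have "F e' \<le> F' e'" for e' using assms(3) by (simp add: F'_def)
  then have "\<forall>e'\<in>{0..<m}. low e' \<le> F' e'" using C by (meson order_trans)
  moreover have "\<forall>y. 0 < ex F' y \<longrightarrow> y \<in> R"
    unfolding x'[symmetric] x'_def using C x pos assms(3) by (auto split: if_splits)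
  moreover have "\<forall>y. ex F' y < 0 \<longrightarrow> y \<notin> R"
    unfolding x'[symmetric] x'_def using C x wR by (metis fun_upd_apply less_irrefl)
  moreover have "\<forall>e'\<in>{0..<m}. he e' \<in> R \<and> ta e' \<notin> R \<longrightarrow> F' e' = low e'"
    using C uR e(2) by (auto simp: F'_def)
  ultimately have "is_cut R low F'" unfolding is_cut_def using C by (intro conjI) (assumption | simp)+
  moreover have "\<forall>y\<in>{0..v}. y = w \<or> balanced x' y"
    using I' by (auto simp: balanced_def x'_def)
  ultimately show "settle_inv R low F' x' w v"
    unfolding settle_inv_def using I' x' w assms(2) by auto
  have "0 \<le> rk w" using rk_range[OF w] by simp
  moreover have "\<not> balanced x u" using assms(3,4) by (simp add: balanced_def)
  ultimately show "settle_potential R x' w v \<le> settle_potential R x u v - 1"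
    using rk uR wR by (simp add: settle_potential_def)
qed

lemma terminates_settle:
  assumes \<sigma>: "represents_dag \<sigma>" and x: "\<And>w. arr \<sigma> ''ex'' w = ex (arr \<sigma> ''F'') w"
    and cut: "is_cut R low (arr \<sigma> ''F'')"
  shows "terminates settle \<sigma> (1000 * (n * n + n + 1)) (\<lambda>\<sigma>'.
    (\<forall>w. arr \<sigma>' ''ex'' w = ex (arr \<sigma>' ''F'') w) \<and> is_cut R low (arr \<sigma>' ''F'') \<and>
    (\<forall>w. w \<noteq> s \<and> w \<noteq> t \<longrightarrow> ex (arr \<sigma>' ''F'') w = 0))"
proof -
  let ?I = "\<lambda>\<sigma>'. settle_inv R low (arr \<sigma>' ''F'') (arr \<sigma>' ''ex'') (scalar \<sigma>' ''u'') (scalar \<sigma>' ''v'')"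
  let ?V = "\<lambda>\<sigma>'. settle_potential R (arr \<sigma>' ''ex'') (scalar \<sigma>' ''u'') (scalar \<sigma>' ''v'')"
  let ?w = "While (Less (Var ''u'') (Var ''n'')) settle_step"
  let ?Q = "\<lambda>\<sigma>'. (\<forall>w. arr \<sigma>' ''ex'' w = ex (arr \<sigma>' ''F'') w) \<and> is_cut R low (arr \<sigma>' ''F'') \<and>
    (\<forall>w. w \<noteq> s \<and> w \<noteq> t \<longrightarrow> ex (arr \<sigma>' ''F'') w = 0)"
  let ?c = "Seq (Assign ''u'' (Const 0)) (Assign ''v'' (Const 0))"
  let ?\<sigma> = "exec ?c \<sigma>"
  have "0 < n" if "\<not> balanced (arr \<sigma> ''ex'') 0"
    using that excess_outside[of 0 "arr \<sigma> ''F''"] x n_nonneg by (fastforce simp: balanced_def)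
  then have init: "?I ?\<sigma>" "?V ?\<sigma> \<le> n * (n + 2) + n"
    using x cut n_nonneg rk_range[of 0] by (auto simp: settle_inv_def settle_potential_def)
  have step: "?I (exec settle_step \<sigma>') \<and> ?V (exec settle_step \<sigma>') \<le> ?V \<sigma>' - 1"
    if f: "frame settle_step ?\<sigma> \<sigma>'" and I: "?I \<sigma>'" and b: "eval_cond (Less (Var ''u'') (Var ''n'')) \<sigma>'" for \<sigma>'
  proof -
    have r: "represents_dag \<sigma>'"
      using f \<sigma> by (simp add: frame_def represents_dag_def represents_def settle_step_def)
    have u: "scalar \<sigma>' ''u'' < n" using b r by (simp add: represents_dag_def represents_def)
    let ?u = "scalar \<sigma>' ''u''" and ?x = "arr \<sigma>' ''ex''"
    consider "0 < ?x ?u" "?u \<noteq> t" | "?x ?u < 0" "?u \<noteq> s" | "balanced ?x ?u"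
      by (auto simp: balanced_def)
    then show ?thesis
    proof cases
      case 1
      then show ?thesis using settle_push[OF I u 1] r
        by (cases "?u < t") (simp_all add: settle_step_def represents_dag_def represents_def)
    next
      case 2
      then show ?thesis using settle_pull[OF I u 2] r
        by (cases "?u < s") (simp_all add: settle_step_def represents_dag_def represents_def)
    next
      case 3
      then have "\<not> 0 < ?x ?u \<or> ?u = t" "\<not> ?x ?u < 0 \<or> ?u = s" by (auto simp: balanced_def)
      then show ?thesis using settle_next[OF I u 3] r
        by (elim disjE) (simp_all add: settle_step_def represents_dag_def represents_def)
    qed
  qed
  have "terminates ?w ?\<sigma> (100 * (?V ?\<sigma> + 1)) (\<lambda>\<sigma>'. ?I \<sigma>' \<and> \<not> eval_cond (Less (Var ''u'') (Var ''n'')) \<sigma>')"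
  proof (rule terminates_While_exec[where I = ?I and V = ?V])
    show "0 \<le> ?V \<sigma>'" if "?I \<sigma>'" for \<sigma>'
      using settle_potential_nonneg[OF that] .
  qed (fact step init(1) | simp add: settle_step_def)+
  then have "terminates ?w ?\<sigma> (100 * (n * (n + 2) + n + 1)) ?Q"
  proof (elim terminates_mono, goal_cases)
    case 1
    then show ?case using init(2) by simp
  next
    case (2 \<sigma>')
    have "scalar \<sigma>' ''n'' = n"
      using 2 \<sigma> by (simp add: frame_def settle_step_def represents_dag_def represents_def)
    then have *: "?I \<sigma>'" "\<not> scalar \<sigma>' ''u'' < n" using 2 by simp_all
    have "ex (arr \<sigma>' ''F'') w = 0" if "w \<noteq> s" "w \<noteq> t" for w
    proof (cases "w \<in> {0..<n}")
      case True
      then have "balanced (arr \<sigma>' ''ex'') w" using * unfolding settle_inv_def by force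
      moreover have "arr \<sigma>' ''ex'' w = ex (arr \<sigma>' ''F'') w" using * unfolding settle_inv_def by blast
      ultimately show ?thesis using that by (simp add: balanced_def)
    qed (rule excess_outside)
    then show ?case using *(1) unfolding settle_inv_def by blast
  qed
  from terminates_Seq_exec[OF _ this]
  have "terminates settle \<sigma> (4 + 100 * (n * (n + 2) + n + 1)) ?Q"
    by (simp add: settle_def)
  moreover have "0 \<le> n * n" using n_nonneg by simp
  ultimately show ?thesis by (elim terminates_mono) (use n_nonneg in \<open>auto simp: algebra_simps\<close>)
qed

end

section \<open>Extracting paths\<close>

definition extract_step :: prog where
  "extract_step =
     If (neq (Var ''u'') (Var ''t''))
       (Seq (Assign ''a'' (Sub (Elem ''cur'' (Var ''u'')) (Const 1)))
       (Seq (Assign ''e'' (Half (Var ''a'')))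
       (If (And (Less (Var ''a'') (Add (Add (Var ''e'') (Var ''e'')) (Const 1))) (Less (Const 0) (Elem ''A'' (Var ''e''))))
         (Seq (Store ''path'' (Var ''len'') (Var ''e''))
         (Seq (Assign ''len'' (Add (Var ''len'') (Const 1)))
         (Seq (Store ''A'' (Var ''e'') (Sub (Elem ''A'' (Var ''e'')) (Const 1)))
         (Assign ''u'' (Elem ''head'' (Var ''e''))))))
         (Store ''cur'' (Var ''u'') (Elem ''next'' (Var ''a''))))))
       (Seq (Store ''weight'' (Var ''size'') (Var ''q''))
       (Seq (Assign ''size'' (Add (Var ''size'') (Const 1)))
       (Seq (Store ''start'' (Var ''size'') (Var ''len''))
       (Seq (Assign ''u'' (Var ''s''))
       (Assign ''k'' (Sub (Var ''k'') (Const 1)))))))"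

definition extract_paths :: prog where
  "extract_paths = Seq reset_cursors (Seq (Assign ''u'' (Var ''s''))
     (While (Less (Const 0) (Var ''k'')) extract_step))"

text \<open>The output consists of the weighted paths in \<open>D\<close>; the cells of the array \<open>path\<close> beyond
  them hold the initial segment \<open>p\<close> of the path being extracted.\<close>

definition written :: "state \<Rightarrow> (int \<times> int list) list \<Rightarrow> int list \<Rightarrow> bool" where
  "written \<sigma> D p \<longleftrightarrow> scalar \<sigma> ''size'' = int (length D) \<and>
     (\<forall>i<length D. arr \<sigma> ''weight'' (int i) = fst (D ! i) \<and>
       map (arr \<sigma> ''path'') [arr \<sigma> ''start'' (int i) .. arr \<sigma> ''start'' (int i + 1) - 1] = snd (D ! i)) \<and>
     (\<forall>i\<le>length D. arr \<sigma> ''start'' (int i) \<le> arr \<sigma> ''start'' (int (length D))) \<and>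
     arr \<sigma> ''start'' (int (length D)) \<le> scalar \<sigma> ''len'' \<and>
     map (arr \<sigma> ''path'') [arr \<sigma> ''start'' (int (length D)) .. scalar \<sigma> ''len'' - 1] = p"

lemma written_cong:
  assumes "scalar \<sigma>' ''size'' = scalar \<sigma> ''size''" "scalar \<sigma>' ''len'' = scalar \<sigma> ''len''"
    "arr \<sigma>' ''weight'' = arr \<sigma> ''weight''" "arr \<sigma>' ''path'' = arr \<sigma> ''path''"
    "arr \<sigma>' ''start'' = arr \<sigma> ''start''"
  shows "written \<sigma>' D p = written \<sigma> D p"
  using assms by (simp add: written_def)

text \<open>All finished segments end before the cell \<open>len\<close>, so writing to it leaves
  them intact.\<close>

lemma written_append_arc:
  assumes W: "written \<sigma> D p"
    and \<sigma>': "scalar \<sigma>' ''size'' = scalar \<sigma> ''size''" "scalar \<sigma>' ''len'' = scalar \<sigma> ''len'' + 1"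
    "arr \<sigma>' ''weight'' = arr \<sigma> ''weight''" "arr \<sigma>' ''path'' = (arr \<sigma> ''path'')(scalar \<sigma> ''len'' := e)"
    "arr \<sigma>' ''start'' = arr \<sigma> ''start''"
  shows "written \<sigma>' D (p @ [e])"
proof -
  let ?st = "arr \<sigma> ''start''" and ?len = "scalar \<sigma> ''len''"
  note W' = W[unfolded written_def]
  have "map (arr \<sigma>' ''path'') [?st (int i)..?st (int i + 1) - 1] = map (arr \<sigma> ''path'') [?st (int i)..?st (int i + 1) - 1]"
    if "i < length D" for i
  proof -
    have "?st (int (Suc i)) \<le> ?st (int (length D))" using W' that Suc_leI by blast
    then have "?st (int i + 1) \<le> ?len" using W' by (simp add: add.commute)
    then show ?thesis using \<sigma>' by auto
  qed
  moreover have "[?st (int (length D))..?len] = [?st (int (length D))..?len - 1] @ [?len]"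
    using W' by (intro upto_rec2) simp
  ultimately show ?thesis using W' \<sigma>' by (simp add: written_def)
qed

lemma written_finish_path:
  assumes W: "written \<sigma> D p"
    and \<sigma>': "scalar \<sigma>' ''size'' = scalar \<sigma> ''size'' + 1" "scalar \<sigma>' ''len'' = scalar \<sigma> ''len''"
    "arr \<sigma>' ''weight'' = (arr \<sigma> ''weight'')(scalar \<sigma> ''size'' := w)" "arr \<sigma>' ''path'' = arr \<sigma> ''path''"
    "arr \<sigma>' ''start'' = (arr \<sigma> ''start'')(scalar \<sigma> ''size'' + 1 := scalar \<sigma> ''len'')"
  shows "written \<sigma>' (D @ [(w, p)]) []"
proof -
  note W' = W[unfolded written_def]
  have "arr \<sigma>' ''weight'' (int i) = fst ((D @ [(w, p)]) ! i) \<and>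
      map (arr \<sigma>' ''path'') [arr \<sigma>' ''start'' (int i) .. arr \<sigma>' ''start'' (int i + 1) - 1] = snd ((D @ [(w, p)]) ! i)"
    if "i < length (D @ [(w, p)])" for i
  proof (cases "i = length D")
    case True
    then show ?thesis using W' \<sigma>' by simp
  next
    case False
    then have "i < length D" using that by simp
    then show ?thesis using W' \<sigma>' by (simp add: nth_append)
  qed
  moreover have "arr \<sigma>' ''start'' (int i) \<le> arr \<sigma>' ''start'' (int (length (D @ [(w, p)])))"
    if "i \<le> length (D @ [(w, p)])" for i
  proof (cases "i = Suc (length D)")
    case True
    then show ?thesis by simp
  next
    case False
    then have "i \<le> length D" using that by simp
    then have "arr \<sigma> ''start'' (int i) \<le> scalar \<sigma> ''len''" using W' order_trans by blast
    then show ?thesis using W' \<sigma>' \<open>i \<le> length D\<close> by (simp add: add.commute)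
  qed
  ultimately show ?thesis using W' \<sigma>' unfolding written_def by (simp add: add.commute)
qed

fun arc_walk :: "int \<Rightarrow> (int \<Rightarrow> int) \<Rightarrow> (int \<Rightarrow> int) \<Rightarrow> int \<Rightarrow> int list \<Rightarrow> int \<Rightarrow> bool" where
  "arc_walk m ta he u [] v \<longleftrightarrow> u = v"
| "arc_walk m ta he u (e # p) v \<longleftrightarrow> e \<in> {0..<m} \<and> ta e = u \<and> arc_walk m ta he (he e) p v"

context network
begin

abbreviation "walk \<equiv> arc_walk m ta he"

lemma walk_snoc: "walk u (p @ [e]) v \<longleftrightarrow> walk u p (ta e) \<and> e \<in> {0..<m} \<and> he e = v"
  by (induction p arbitrary: u) auto

definition multiplicity :: "int list list \<Rightarrow> int \<Rightarrow> int" where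
  "multiplicity Ps e = (\<Sum>P\<leftarrow>Ps. int (count_list P e))"

text \<open>\<open>A\<close> is what is still to be extracted: \<open>k\<close> units that end in
  \<open>t\<close>, all but one starting at \<open>s\<close>, and the last one at \<open>u\<close>,
  where the current path \<open>p\<close> stands. For \<open>k = 0\<close> the excess vanishes and
  \<open>A\<close> is a circulation. As flow only decreases, a passed empty arc stays empty.\<close>

definition extract_inv ::
  "int \<Rightarrow> int \<Rightarrow> (int \<Rightarrow> int) \<Rightarrow> (int \<Rightarrow> int) \<Rightarrow> (int \<Rightarrow> int) \<Rightarrow> int \<Rightarrow> int \<Rightarrow> int list \<Rightarrow> int list list \<Rightarrow> bool" where
  "extract_inv s t A\<^sub>0 A cur u k p Ps \<longleftrightarrow>
     u \<in> {0..<n} \<and> 0 \<le> k \<and> cursor cur \<and> (k = 0 \<longrightarrow> u = s \<and> p = []) \<and>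
     (\<forall>e\<in>{0..<m}. 0 \<le> A e \<and> A\<^sub>0 e = A e + multiplicity Ps e + int (count_list p e)) \<and>
     (\<forall>w. ex A w = k * of_bool (w = t) - (k - 1) * of_bool (w = s) - of_bool (w = u)) \<and>
     walk s p u \<and> (\<forall>P\<in>set Ps. walk s P t) \<and>
     (\<forall>b\<in>{0..<2 * m}. even b \<and> cur (from b) \<le> b \<longrightarrow> A (b div 2) = 0)"

text \<open>The sum of \<open>A\<close> bounds the number of path cells still to be written; it
  makes the cost proportional to the amount of flow on the arcs.\<close>

definition extract_potential :: "(int \<Rightarrow> int) \<Rightarrow> (int \<Rightarrow> int) \<Rightarrow> int \<Rightarrow> int" where
  "extract_potential A cur k = cursor_potential cur + (\<Sum>e\<in>{0..<m}. A e) + k"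

lemma extract_potential_nonneg: "extract_inv s t A\<^sub>0 A cur u k p Ps \<Longrightarrow> 0 \<le> extract_potential A cur k"
  unfolding extract_potential_def extract_inv_def using cursor_potential_nonneg
  by (intro add_nonneg_nonneg sum_nonneg) auto

text \<open>With an exhausted list no flow would leave \<open>u\<close>, so its excess would be
  nonnegative, whereas the travelling unit makes it negative.\<close>

lemma extract_cursor_pos:
  assumes I: "extract_inv s t A\<^sub>0 A cur u k p Ps" and "0 < k" "u \<noteq> t"
  shows "0 < cur u"
proof (rule ccontr)
  assume "\<not> 0 < cur u"
  note I' = I[unfolded extract_inv_def]
  have "A e = 0" if "e \<in> {0..<m}" "ta e = u" for e
  proof -
    have "2 * e \<in> {0..<2 * m}" "even (2 * e)" "cur (from (2 * e)) \<le> 2 * e"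
      using that \<open>\<not> 0 < cur u\<close> by (auto simp: src_def)
    then have "A (2 * e div 2) = 0" using I' by blast
    then show ?thesis by simp
  qed
  moreover have "\<forall>e\<in>{0..<m}. 0 \<le> A e" using I' by blast
  ultimately have "0 \<le> ex A u"
    unfolding excess_def by (intro sum_nonneg) (auto simp: of_bool_def)
  moreover have "ex A u = - (k - 1) * of_bool (u = s) - 1" using I' assms(3) by simp
  ultimately show False using assms(2) by (cases "u = s") simp_all
qed

lemma extract_finish:
  assumes I: "extract_inv s t A\<^sub>0 A cur u k p Ps" and "0 < k" "u = t" and s: "s \<in> {0..<n}"
  shows "extract_inv s t A\<^sub>0 A cur s (k - 1) [] (Ps @ [p])"
    "extract_potential A cur (k - 1) \<le> extract_potential A cur k - 1"
proof -
  show "extract_inv s t A\<^sub>0 A cur s (k - 1) [] (Ps @ [p])"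
    using assms by (auto simp: extract_inv_def multiplicity_def algebra_simps)
qed (simp add: extract_potential_def)

lemma extract_advance:
  assumes I: "extract_inv s t A\<^sub>0 A cur u k p Ps" and "0 < cur u"
    and b: "\<not> (even (cur u - 1) \<and> 0 < A ((cur u - 1) div 2))"
  shows "extract_inv s t A\<^sub>0 A (cur(u := nxt (cur u - 1))) u k p Ps"
    "extract_potential A (cur(u := nxt (cur u - 1))) k \<le> extract_potential A cur k - 1"
proof -
  note I' = I[unfolded extract_inv_def]
  have u: "u \<in> {0..<n}" and cur: "cursor cur" using I' by blast+
  note adv = cursor_advance[OF cur u assms(2)]
  have "(cur u - 1) div 2 \<in> {0..<m}" using half_arc cursor_range[OF cur u assms(2)] by blast
  then have "0 \<le> A ((cur u - 1) div 2)" using I' by blast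
  then have "even (cur u - 1) \<Longrightarrow> A ((cur u - 1) div 2) = 0" using b by simp
  then have "A (b div 2) = 0" if "b \<in> {0..<2 * m}" "even b" "(cur(u := nxt (cur u - 1))) (from b) \<le> b" for b
    using adv(3)[OF that(1,3)] I' that(1,2) by blast
  then show "extract_inv s t A\<^sub>0 A (cur(u := nxt (cur u - 1))) u k p Ps"
    unfolding extract_inv_def using I' adv(1) by blast
  show "extract_potential A (cur(u := nxt (cur u - 1))) k \<le> extract_potential A cur k - 1"
    using adv(2) by (simp add: extract_potential_def)
qed

lemma extract_traverse:
  assumes I: "extract_inv s t A\<^sub>0 A cur u k p Ps" and "0 < cur u" "0 < k"
  defines "e \<equiv> (cur u - 1) div 2"
  assumes b: "even (cur u - 1)" "0 < A e"
  shows "extract_inv s t A\<^sub>0 (A(e := A e - 1)) cur (he e) k (p @ [e]) Ps"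
    "extract_potential (A(e := A e - 1)) cur k \<le> extract_potential A cur k - 1"
proof -
  note I' = I[unfolded extract_inv_def]
  have u: "u \<in> {0..<n}" and cur: "cursor cur" using I' by blast+
  have e: "e \<in> {0..<m}" "ta e = u"
    using cursor_range[OF cur u assms(2)] half_arc b(1) by (auto simp: e_def src_def)
  have "ex (A(e := A e - 1)) w = k * of_bool (w = t) - (k - 1) * of_bool (w = s) - of_bool (w = he e)" for w
    using excess_update[OF e(1), of ta he A "A e - 1" w] I' e(2) by auto
  moreover have "0 \<le> (A(e := A e - 1)) e' \<and>
      A\<^sub>0 e' = (A(e := A e - 1)) e' + multiplicity Ps e' + int (count_list (p @ [e]) e')" if "e' \<in> {0..<m}" for e'
    using I' that b(2) by auto
  moreover have "(A(e := A e - 1)) (b div 2) = 0" if "b \<in> {0..<2 * m}" "even b \<and> cur (from b) \<le> b" for b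
    using I' that b(2) by force
  ultimately show "extract_inv s t A\<^sub>0 (A(e := A e - 1)) cur (he e) k (p @ [e]) Ps"
    unfolding extract_inv_def using I' e head_vertex[OF e(1)] assms(3)
    by (intro conjI) (simp_all add: walk_snoc)
  show "extract_potential (A(e := A e - 1)) cur k \<le> extract_potential A cur k - 1"
    using e(1) by (simp add: extract_potential_def sum.remove[of _ e])
qed

lemma terminates_extract:
  assumes \<sigma>: "represents \<sigma>" "scalar \<sigma> ''s'' = s" "scalar \<sigma> ''t'' = t" "scalar \<sigma> ''k'' = K" "scalar \<sigma> ''q'' = q"
    and s: "s \<in> {0..<n}" and K: "0 \<le> K"
    and A: "\<And>e. e \<in> {0..<m} \<Longrightarrow> 0 \<le> arr \<sigma> ''A'' e"
    and ex: "\<And>w. ex (arr \<sigma> ''A'') w = K * of_bool (w = t) - K * of_bool (w = s)"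
    and D: "written \<sigma> D []"
  shows "terminates extract_paths \<sigma> (200 * (n + 1) + (2 + 100 * (2 * m + (\<Sum>e\<in>{0..<m}. arr \<sigma> ''A'' e) + K + 1))) (\<lambda>\<sigma>'.
    \<exists>Ps A'. length Ps = nat K \<and> (\<forall>P\<in>set Ps. walk s P t) \<and> written \<sigma>' (D @ map (Pair q) Ps) [] \<and>
      (\<forall>e\<in>{0..<m}. 0 \<le> A' e \<and> arr \<sigma> ''A'' e = A' e + multiplicity Ps e) \<and> (\<forall>w. ex A' w = 0))"
    (is "terminates _ _ _ ?Q")
proof -
  let ?A = "arr \<sigma> ''A''"
  let ?J = "\<lambda>\<sigma>' p Ps. int (length Ps) = K - scalar \<sigma>' ''k'' \<and> written \<sigma>' (D @ map (Pair q) Ps) p \<and>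
    extract_inv s t ?A (arr \<sigma>' ''A'') (arr \<sigma>' ''cur'') (scalar \<sigma>' ''u'') (scalar \<sigma>' ''k'') p Ps"
  let ?I = "\<lambda>\<sigma>'. \<exists>p Ps. ?J \<sigma>' p Ps"
  let ?V = "\<lambda>\<sigma>'. extract_potential (arr \<sigma>' ''A'') (arr \<sigma>' ''cur'') (scalar \<sigma>' ''k'')"
  let ?w = "While (Less (Const 0) (Var ''k'')) extract_step"
  let ?P = "2 * m + (\<Sum>e\<in>{0..<m}. ?A e) + K"
  have loop: "terminates ?w \<sigma>1 (100 * (?P + 1)) ?Q"
    if fr: "frame reset_cursors \<sigma> \<sigma>0" and cur: "\<forall>w\<in>{0..<n}. arr \<sigma>0 ''cur'' w = first w"
      and \<sigma>1: "\<sigma>1 = exec (Assign ''u'' (Var ''s'')) \<sigma>0" for \<sigma>0 \<sigma>1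
  proof -
    have same: "scalar \<sigma>1 ''k'' = K" "scalar \<sigma>1 ''u'' = s" "arr \<sigma>1 ''A'' = ?A" "arr \<sigma>1 ''cur'' = arr \<sigma>0 ''cur''"
      "written \<sigma>1 D []"
      using fr \<sigma> \<sigma>1 D by (auto simp: frame_def reset_cursors_def for_loop_def cong: written_cong)
    have "\<not> arr \<sigma>0 ''cur'' (from b) \<le> b" if "b \<in> {0..<2 * m}" for b
      using first_greater[OF that] from_vertex[OF that] cur by simp
    then have init: "?J \<sigma>1 [] []"
      using same s K A ex cursor_first[OF cur] by (auto simp: extract_inv_def multiplicity_def algebra_simps)
    have step: "?I (exec extract_step \<sigma>') \<and> ?V (exec extract_step \<sigma>') \<le> ?V \<sigma>' - 1"
      if f: "frame extract_step \<sigma>1 \<sigma>'" and I: "?I \<sigma>'" and b: "eval_cond (Less (Const 0) (Var ''k'')) \<sigma>'" for \<sigma>'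
    proof -
      obtain p Ps where J: "int (length Ps) = K - scalar \<sigma>' ''k''" "written \<sigma>' (D @ map (Pair q) Ps) p"
        "extract_inv s t ?A (arr \<sigma>' ''A'') (arr \<sigma>' ''cur'') (scalar \<sigma>' ''u'') (scalar \<sigma>' ''k'') p Ps"
        using I by blast
      have r1: "represents \<sigma>1" "scalar \<sigma>1 ''s'' = s" "scalar \<sigma>1 ''t'' = t" "scalar \<sigma>1 ''q'' = q"
        using \<sigma> \<sigma>1 fr by (simp_all add: frame_def reset_cursors_def for_loop_def represents_def)
      have r: "represents \<sigma>'" "scalar \<sigma>' ''s'' = s" "scalar \<sigma>' ''t'' = t" "scalar \<sigma>' ''q'' = q"
        using r1 f by (simp_all add: frame_def extract_step_def represents_def)
      have k: "0 < scalar \<sigma>' ''k''" using b by simp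
      let ?c = "arr \<sigma>' ''cur''" and ?u = "scalar \<sigma>' ''u''" and ?B = "arr \<sigma>' ''A''"
      show ?thesis
      proof (cases "?u = t")
        case True
        let ?\<sigma> = "exec extract_step \<sigma>'"
        have "?J ?\<sigma> [] (Ps @ [p])"
          using extract_finish(1)[OF J(3) k True s] J(1) r(2-4) True
            written_finish_path[OF J(2), of ?\<sigma> q]
          by (simp add: extract_step_def)
        moreover have "?V ?\<sigma> \<le> ?V \<sigma>' - 1"
          using extract_finish(2)[OF J(3) k True s] r(2-4) True by (simp add: extract_step_def)
        ultimately show ?thesis by blast
      next
        case False
        have c: "0 < ?c ?u" using extract_cursor_pos[OF J(3) k False] .
        have neq: "?u < t \<or> (\<not> ?u < t \<and> t < ?u)" using False by auto
        let ?\<sigma> = "exec extract_step \<sigma>'"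
        let ?b = "?c ?u - 1"
        show ?thesis
        proof (cases "even ?b \<and> 0 < ?B (?b div 2)")
          case True
          have "?J ?\<sigma> (p @ [?b div 2]) Ps \<and> ?V ?\<sigma> \<le> ?V \<sigma>' - 1"
            using neq extract_traverse[OF J(3) c k conjunct1[OF True] conjunct2[OF True]] J(1) r True
              written_append_arc[OF J(2), of ?\<sigma> "?b div 2"]
            by (elim disjE) (simp_all add: extract_step_def represents_def even_iff_le_half)
          then show ?thesis by blast
        next
          case odd: False
          have "?J ?\<sigma> p Ps \<and> ?V ?\<sigma> \<le> ?V \<sigma>' - 1"
            using neq extract_advance[OF J(3) c odd] J(1,2) r odd
              written_cong[of ?\<sigma> \<sigma>' "D @ map (Pair q) Ps" p]
            by (cases "even ?b"; elim disjE) (simp_all add: extract_step_def represents_def even_iff_le_half)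
          then show ?thesis by blast
        qed
      qed
    qed
    have "?I \<sigma>1" using init by blast
    have "terminates ?w \<sigma>1 (100 * (?V \<sigma>1 + 1)) (\<lambda>\<sigma>'. ?I \<sigma>' \<and> \<not> eval_cond (Less (Const 0) (Var ''k'')) \<sigma>')"
    proof (rule terminates_While_exec[where I = ?I and V = ?V])
      show "0 \<le> ?V \<sigma>'" if "?I \<sigma>'" for \<sigma>'
        using that extract_potential_nonneg by blast
    qed (fact step \<open>?I \<sigma>1\<close> | simp add: extract_step_def)+
    then show ?thesis
    proof (rule terminates_mono)
      show "100 * (?V \<sigma>1 + 1) \<le> 100 * (?P + 1)"
        using cursor_potential_le[of "arr \<sigma>1 ''cur''"] same by (simp add: extract_potential_def)
    next
      fix \<sigma>' assume "?I \<sigma>' \<and> \<not> eval_cond (Less (Const 0) (Var ''k'')) \<sigma>'"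
      then obtain p Ps where J: "?J \<sigma>' p Ps" and "\<not> 0 < scalar \<sigma>' ''k''" by auto
      then have "scalar \<sigma>' ''k'' = 0" by (simp add: extract_inv_def)
      with J have "p = []" "length Ps = nat K" "\<forall>w. ex (arr \<sigma>' ''A'') w = 0"
        by (auto simp: extract_inv_def)
      with J show "?Q \<sigma>'" unfolding extract_inv_def
        by (intro exI[of _ Ps] exI[of _ "arr \<sigma>' ''A''"]) auto
    qed
  qed
  show ?thesis
    unfolding extract_paths_def
  proof (rule terminates_Seq[OF terminates_reset_cursors[OF \<sigma>(1)]])
    fix \<sigma>' assume *: "frame reset_cursors \<sigma> \<sigma>'" "\<forall>w\<in>{0..<n}. arr \<sigma>' ''cur'' w = first w"
    from terminates_Seq_exec[OF _ loop[OF * refl]]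
    show "terminates (Seq (Assign ''u'' (Var ''s'')) ?w) \<sigma>' (2 + 100 * (?P + 1)) ?Q" by simp
  qed
qed

end

section \<open>Rounding and emitting one binary digit\<close>

definition prepare_parity :: "exp \<Rightarrow> prog" where
  "prepare_parity x = for_loop ''e'' ''m'' (Seq (Store ''W'' (Var ''e'') x) (Store ''Z'' (Var ''e'') (Const 0)))"

text \<open>\<open>W\<close> holds \<open>F + Y\<close>. Rather than negating \<open>Z\<close>, each
  pass decides by the entry of \<open>Z\<close> on the return arc whether to add or to
  subtract.\<close>

definition split_flow :: prog where
  "split_flow = for_loop ''e'' ''m''
     (Seq (If (Less (Const 0) (Elem ''Z'' (Sub (Var ''m'') (Const 1))))
       (Store ''A'' (Var ''e'') (Half (Sub (Elem ''W'' (Var ''e'')) (Elem ''Z'' (Var ''e'')))))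
       (Store ''A'' (Var ''e'') (Half (Add (Elem ''W'' (Var ''e'')) (Elem ''Z'' (Var ''e''))))))
     (Store ''B'' (Var ''e'') (Sub (Elem ''A'' (Var ''e'')) (Elem ''Y'' (Var ''e'')))))"

text \<open>Arc \<open>m - 1\<close> is the arc from \<open>t\<close> to \<open>s\<close> that closes flows to circulations; it carries the
  number of paths to be extracted.\<close>

definition open_flow :: "exp \<Rightarrow> prog" where
  "open_flow x = Seq (Assign ''k'' (Elem ''A'' (Sub (Var ''m'') (Const 1))))
     (Seq (Store ''A'' (Sub (Var ''m'') (Const 1)) (Const 0)) (Assign ''q'' x))"

definition emit :: prog where
  "emit =
     Seq (prepare_parity (Add (Elem ''F'' (Var ''e'')) (Elem ''Y'' (Var ''e''))))
     (Seq parity_fix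
     (Seq split_flow
     (Seq (open_flow (Var ''p''))
     (Seq extract_paths
     (Seq (for_loop ''e'' ''m'' (Store ''A'' (Var ''e'') (Elem ''B'' (Var ''e''))))
     (Seq (open_flow (Sub (Const 0) (Var ''p'')))
     extract_paths))))))"

definition decomposed :: "(int \<times> int list) list \<Rightarrow> int \<Rightarrow> int" where
  "decomposed D e = (\<Sum>(w, P)\<leftarrow>D. w * int (count_list P e))"

lemma decomposed_append: "decomposed (D @ E) e = decomposed D e + decomposed E e"
  by (simp add: decomposed_def)

context network
begin

lemma decomposed_Pair: "decomposed (map (Pair w) Ps) e = w * multiplicity Ps e"
  by (induction Ps) (simp_all add: decomposed_def multiplicity_def algebra_simps)

lemma terminates_prepare_parity:
  assumes "represents \<sigma>" and "cost_exp x \<le> 90"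
    and x: "\<And>\<sigma>'. frame (prepare_parity x) \<sigma> \<sigma>' \<Longrightarrow> eval_exp x \<sigma>' = f (scalar \<sigma>' ''e'')"
  shows "terminates (prepare_parity x) \<sigma> (200 * (m + 1))
    (\<lambda>\<sigma>'. \<forall>e\<in>{0..<m}. arr \<sigma>' ''W'' e = f e \<and> arr \<sigma>' ''Z'' e = 0)"
  unfolding prepare_parity_def
  by (rule terminates_for_loop[where I = "\<lambda>k \<sigma>'. \<forall>e\<in>{0..<k}. arr \<sigma>' ''W'' e = f e \<and> arr \<sigma>' ''Z'' e = 0"])
    (use assms m_nonneg in \<open>auto simp: represents_def prepare_parity_def\<close>)

end

section \<open>Circulations through the return arc, and emitting one level\<close>

locale circulation_network = network +
  fixes s t :: int and rk F :: "int \<Rightarrow> int"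
  assumes m_pos: "0 < m"
    and return_arc: "ta (m - 1) = t" "he (m - 1) = s"
    and rk_range: "v \<in> {0..<n} \<Longrightarrow> 0 \<le> rk v \<and> rk v < n"
    and rk_less: "e \<in> {0..<m - 1} \<Longrightarrow> rk (ta e) < rk (he e)"
    and no_out: "e \<in> {0..<m - 1} \<Longrightarrow> ta e \<noteq> t"
    and s_neq_t: "s \<noteq> t"
    and F_circ: "ex F w = 0"
    and F_nonneg: "e \<in> {0..<m - 1} \<Longrightarrow> 0 \<le> F e"
begin

lemma st_vertex: "s \<in> {0..<n}" "t \<in> {0..<n}"
  using tail_vertex[of "m - 1"] head_vertex[of "m - 1"] return_arc m_pos by auto

lemma sum_arcs: "(\<Sum>e\<in>{0..<m}. f e) = (\<Sum>e\<in>{0..<m - 1}. f e) + (f (m - 1) :: int)"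
proof -
  have "{0..<m} = insert (m - 1) {0..<m - 1}" using m_pos by auto
  then show ?thesis by simp
qed

lemma excess_open: "ex (A(m - 1 := 0)) w = ex A w + A (m - 1) * of_bool (w = t) - A (m - 1) * of_bool (w = s)"
  using excess_update[of "m - 1" m ta he A 0 w] m_pos return_arc by (auto simp: algebra_simps)

text \<open>What enters \<open>t\<close> can leave it only through the return arc.\<close>

lemma return_flow_nonneg:
  assumes "\<And>e. e \<in> {0..<m - 1} \<Longrightarrow> 0 \<le> A e" "ex A t = 0"
  shows "0 \<le> A (m - 1)"
proof -
  have "0 \<le> ex (A(m - 1 := 0)) t"
    unfolding excess_def using assms(1) no_out
    by (subst sum_arcs) (auto intro!: sum_nonneg)
  then show ?thesis using excess_open[of A t] assms(2) s_neq_t by simp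
qed

lemma F_return_nonneg: "0 \<le> F (m - 1)"
  using return_flow_nonneg F_nonneg F_circ by blast

text \<open>Summation by parts: pairing \<open>A\<close> with rank differences along arcs is pairing
  its excess with ranks at nodes. For a circulation both sides vanish, which is the source of the
  next two results.\<close>

lemma rank_sum: "(\<Sum>e\<in>{0..<m}. A e * (rk (he e) - rk (ta e))) = (\<Sum>w\<in>{0..<n}. rk w * ex A w)"
proof -
  have "(\<Sum>w\<in>{0..<n}. rk w * ex A w) = (\<Sum>e\<in>{0..<m}. \<Sum>w\<in>{0..<n}. rk w * (A e * (of_bool (he e = w) - of_bool (ta e = w))))"
    unfolding excess_def sum_distrib_left by (rule sum.swap)
  also have "\<dots> = (\<Sum>e\<in>{0..<m}. A e * (rk (he e) - rk (ta e)))"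
  proof (rule sum.cong[OF refl])
    fix e assume e: "e \<in> {0..<m}"
    have *: "(\<Sum>w\<in>{0..<n}. rk w * (A e * of_bool (v = w))) = A e * rk v" if "v \<in> {0..<n}" for v
    proof -
      have "(\<Sum>w\<in>{0..<n}. rk w * (A e * of_bool (v = w))) = (\<Sum>w\<in>{0..<n}. if v = w then A e * rk v else 0)"
        by (rule sum.cong) auto
      then show ?thesis using that by simp
    qed
    have "(\<Sum>w\<in>{0..<n}. rk w * (A e * (of_bool (he e = w) - of_bool (ta e = w)))) =
      (\<Sum>w\<in>{0..<n}. rk w * (A e * of_bool (he e = w))) - (\<Sum>w\<in>{0..<n}. rk w * (A e * of_bool (ta e = w)))"
      by (simp add: right_diff_distrib sum_subtractf del: sum_of_bool_mult_eq sum_mult_of_bool_eq)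
    then show "(\<Sum>w\<in>{0..<n}. rk w * (A e * (of_bool (he e = w) - of_bool (ta e = w)))) = A e * (rk (he e) - rk (ta e))"
      using *[OF head_vertex[OF e]] *[OF tail_vertex[OF e]] by (simp add: right_diff_distrib)
  qed
  finally show ?thesis ..
qed

text \<open>Ordinary arcs raise the rank by at least 1, and by \<open>rank_sum\<close> these gains
  are undone by the return arc, which loses \<open>rk t - rk s\<close>, less than \<open>n\<close>,
  per unit. This bounds the length of all paths of a level together.\<close>

lemma sum_F_le: "(\<Sum>e\<in>{0..<m - 1}. F e) \<le> F (m - 1) * n"
proof -
  have "(\<Sum>e\<in>{0..<m - 1}. F e) \<le> (\<Sum>e\<in>{0..<m - 1}. F e * (rk (he e) - rk (ta e)))"
  proof (rule sum_mono)
    fix e assume e: "e \<in> {0..<m - 1}"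
    then have "F e * 1 \<le> F e * (rk (he e) - rk (ta e))"
      using rk_less[OF e] F_nonneg[OF e] by (intro mult_left_mono) auto
    then show "F e \<le> F e * (rk (he e) - rk (ta e))" by simp
  qed
  also have "\<dots> = F (m - 1) * (rk t - rk s)"
    using rank_sum[of F] F_circ return_arc by (simp add: sum_arcs algebra_simps)
  also have "\<dots> \<le> F (m - 1) * n"
    using rk_range[OF st_vertex(1)] rk_range[OF st_vertex(2)] F_return_nonneg
    by (intro mult_left_mono) auto
  finally show ?thesis .
qed

text \<open>With nothing on the return arc, the left side of \<open>rank_sum\<close> is a vanishing
  sum of nonnegative terms with positive rank differences. It follows that extraction leaves nothing
  behind.\<close>

lemma circulation_zero:
  assumes "\<And>e. e \<in> {0..<m} \<Longrightarrow> 0 \<le> A e" "A (m - 1) = 0" "\<And>w. ex A w = 0" "e \<in> {0..<m}"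
  shows "A e = 0"
proof (cases "e = m - 1")
  case False
  then have e: "e \<in> {0..<m - 1}" using assms(4) by auto
  have "(\<Sum>e\<in>{0..<m - 1}. A e * (rk (he e) - rk (ta e))) = 0"
    using rank_sum[of A] assms(2,3) by (simp add: sum_arcs)
  moreover have "0 \<le> A e * (rk (he e) - rk (ta e))" if "e \<in> {0..<m - 1}" for e
    using rk_less[OF that] assms(1) that by simp
  ultimately have "A e * (rk (he e) - rk (ta e)) = 0"
    using e sum_nonneg_eq_0_iff[of "{0..<m - 1}" "\<lambda>e. A e * (rk (he e) - rk (ta e))"] by blast
  then show ?thesis using rk_less[OF e] by simp
qed (use assms(2) in simp)

definition carries :: "state \<Rightarrow> bool" where
  "carries \<sigma> \<longleftrightarrow> represents \<sigma> \<and> scalar \<sigma> ''s'' = s \<and> scalar \<sigma> ''t'' = t \<and> arr \<sigma> ''F'' = F"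


text \<open>On ordinary arcs \<open>2 * A = F + Y + Z\<close> is at least -1 and even, hence
  nonnegative; likewise \<open>2 * B = F - Y + Z\<close>. On the return arc
  \<open>A + B = F + Z\<close> is at most \<open>F\<close>, which keeps the paths of a level within
  the value of \<open>F\<close>.\<close>

lemma split_flow_bounds:
  assumes Y: "\<And>e. e \<in> {0..<m - 1} \<Longrightarrow> \<bar>Y e\<bar> \<le> F e" "\<And>w. ex Y w = 0"
    and Z: "\<And>e. e \<in> {0..<m} \<Longrightarrow> Z e \<in> {-1, 0, 1} \<and> even (F e + Y e + Z e)" "\<And>w. ex Z w = 0"
      "Z (m - 1) \<le> 0"
    and A: "\<And>e. e \<in> {0..<m} \<Longrightarrow> A e = (F e + Y e + Z e) div 2"
    and B: "\<And>e. e \<in> {0..<m} \<Longrightarrow> B e = A e - Y e"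
  shows "\<And>e. e \<in> {0..<m - 1} \<Longrightarrow> 0 \<le> A e \<and> 0 \<le> B e \<and> A e + B e \<le> F e + 1"
    "\<And>w. ex A w = 0" "\<And>w. ex B w = 0" "A (m - 1) + B (m - 1) \<le> F (m - 1)"
proof -
  have A2: "2 * A e = F e + Y e + Z e" and B2: "2 * B e = F e - Y e + Z e" if "e \<in> {0..<m}" for e
    using A[OF that] B[OF that] Z(1)[OF that] by auto
  show "0 \<le> A e \<and> 0 \<le> B e \<and> A e + B e \<le> F e + 1" if e: "e \<in> {0..<m - 1}" for e
  proof -
    have e': "e \<in> {0..<m}" using e by auto
    have "Z e = -1 \<or> Z e = 0 \<or> Z e = 1" using Z(1)[OF e'] by auto
    then show ?thesis using A2[OF e'] B2[OF e'] Y(1)[OF e] by presburger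
  qed
  have "ex (\<lambda>e. 2 * A e) w = ex (\<lambda>e. F e + Y e + Z e) w" for w
    by (rule excess_cong) (rule A2)
  then show exA: "ex A w = 0" for w
    using F_circ Y(2) Z(2) by (simp add: excess_mult excess_add)
  have "ex B w = ex (\<lambda>e. A e - Y e) w" for w
    by (rule excess_cong) (rule B)
  then show "ex B w = 0" for w using exA Y(2) by (simp add: excess_diff)
  show "A (m - 1) + B (m - 1) \<le> F (m - 1)"
    using A2[of "m - 1"] B2[of "m - 1"] Z(3) m_pos by simp
qed



lemma terminates_extract_open:
  assumes \<sigma>: "carries \<sigma>" "arr \<sigma> ''A'' = A(m - 1 := 0)" "scalar \<sigma> ''k'' = A (m - 1)" "scalar \<sigma> ''q'' = q"
    and A: "\<And>e. e \<in> {0..<m - 1} \<Longrightarrow> 0 \<le> A e \<and> A e \<le> F e + 1" "A (m - 1) \<le> F (m - 1)" "\<And>w. ex A w = 0"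
    and D: "written \<sigma> D []"
  shows "terminates extract_paths \<sigma> (500 * (n + m + F (m - 1) * n + 1)) (\<lambda>\<sigma>'.
    \<exists>Ps. int (length Ps) = A (m - 1) \<and> (\<forall>P\<in>set Ps. walk s P t \<and> m - 1 \<notin> set P) \<and>
      written \<sigma>' (D @ map (Pair q) Ps) [] \<and> (\<forall>e\<in>{0..<m - 1}. multiplicity Ps e = A e))"
proof -
  have r: "represents \<sigma>" "scalar \<sigma> ''s'' = s" "scalar \<sigma> ''t'' = t"
    using \<sigma>(1) by (auto simp: carries_def)
  have K: "0 \<le> A (m - 1)" using return_flow_nonneg A by blast
  have nonneg: "0 \<le> arr \<sigma> ''A'' e" if "e \<in> {0..<m}" for e
    using \<sigma>(2) A(1)[of e] that by auto
  have ex: "ex (arr \<sigma> ''A'') w = A (m - 1) * of_bool (w = t) - A (m - 1) * of_bool (w = s)" for w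
    using excess_open[of A w] A(3) \<sigma>(2) by simp
  have "(\<Sum>e\<in>{0..<m}. arr \<sigma> ''A'' e) \<le> (\<Sum>e\<in>{0..<m - 1}. F e + 1)"
    using A(1) \<sigma>(2) by (simp add: sum_arcs) (rule sum_mono, auto)
  also have "\<dots> \<le> F (m - 1) * n + m" using sum_F_le m_pos by (simp add: sum.distrib)
  finally have sum: "(\<Sum>e\<in>{0..<m}. arr \<sigma> ''A'' e) \<le> F (m - 1) * n + m" .
  have "A (m - 1) * 1 \<le> F (m - 1) * n"
    using A(2) F_return_nonneg st_vertex by (intro mult_mono) auto
  then have bound: "200 * (n + 1) + (2 + 100 * (2 * m + (\<Sum>e\<in>{0..<m}. arr \<sigma> ''A'' e) + A (m - 1) + 1))
      \<le> 500 * (n + m + F (m - 1) * n + 1)"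
    using sum n_nonneg m_nonneg mult_nonneg_nonneg[OF F_return_nonneg n_nonneg] by simp
  show ?thesis
  proof (rule terminates_mono[OF terminates_extract[OF r \<sigma>(3,4) st_vertex(1) K nonneg ex D] bound])
    fix \<sigma>'
    assume "\<exists>Ps A'. length Ps = nat (A (m - 1)) \<and> (\<forall>P\<in>set Ps. walk s P t) \<and> written \<sigma>' (D @ map (Pair q) Ps) [] \<and>
      (\<forall>e\<in>{0..<m}. 0 \<le> A' e \<and> arr \<sigma> ''A'' e = A' e + multiplicity Ps e) \<and> (\<forall>w. ex A' w = 0)"
    then obtain Ps A' where P: "length Ps = nat (A (m - 1))" "\<forall>P\<in>set Ps. walk s P t"
      "written \<sigma>' (D @ map (Pair q) Ps) []"
      and A': "\<And>e. e \<in> {0..<m} \<Longrightarrow> 0 \<le> A' e \<and> arr \<sigma> ''A'' e = A' e + multiplicity Ps e" "\<And>w. ex A' w = 0"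
      by blast
    have mult: "0 \<le> multiplicity Ps e" for e unfolding multiplicity_def by (intro sum_list_nonneg) auto
    \<comment> \<open>The return arc was emptied before the extraction, so neither a path nor the
      leftover can use it.\<close>
    have last: "A' (m - 1) = 0" "multiplicity Ps (m - 1) = 0"
      using A'(1)[of "m - 1"] mult[of "m - 1"] \<sigma>(2) m_pos by auto
    have "A' e = 0" if "e \<in> {0..<m}" for e
      using circulation_zero[of A'] A' last that by blast
    then have "multiplicity Ps e = A e" if "e \<in> {0..<m - 1}" for e
      using A'(1)[of e] \<sigma>(2) that by auto
    moreover have "m - 1 \<notin> set P" if "P \<in> set Ps" for P
    proof -
      have "int (count_list P (m - 1)) \<le> multiplicity Ps (m - 1)"
        unfolding multiplicity_def using that by (intro member_le_sum_list) auto
      then show ?thesis using last by (simp add: count_list_0_iff)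
    qed
    ultimately show "\<exists>Ps. int (length Ps) = A (m - 1) \<and> (\<forall>P\<in>set Ps. walk s P t \<and> m - 1 \<notin> set P) \<and>
      written \<sigma>' (D @ map (Pair q) Ps) [] \<and> (\<forall>e\<in>{0..<m - 1}. multiplicity Ps e = A e)"
      using P K by (intro exI[of _ Ps]) auto
  qed
qed

end

context circulation_network
begin

lemma carries_frame:
  "frame c \<sigma> \<sigma>' \<Longrightarrow> {''n'', ''m'', ''s'', ''t''} \<inter> scalars_of c = {} \<Longrightarrow>
   {''tail'', ''head'', ''first'', ''next'', ''F''} \<inter> arrays_of c = {} \<Longrightarrow> carries \<sigma>' = carries \<sigma>"
  unfolding carries_def represents_def by (simp add: frame_def)

lemma terminates_split_flow:
  assumes "represents \<sigma>"
  shows "terminates split_flow \<sigma> (200 * (m + 1)) (\<lambda>\<sigma>'. \<forall>e\<in>{0..<m}.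
    arr \<sigma>' ''A'' e = (if 0 < arr \<sigma> ''Z'' (m - 1) then arr \<sigma> ''W'' e - arr \<sigma> ''Z'' e else arr \<sigma> ''W'' e + arr \<sigma> ''Z'' e) div 2 \<and>
    arr \<sigma>' ''B'' e = arr \<sigma>' ''A'' e - arr \<sigma> ''Y'' e)"
  unfolding split_flow_def
proof (rule terminates_for_loop[where I = "\<lambda>k \<sigma>'. \<forall>e\<in>{0..<k}.
    arr \<sigma>' ''A'' e = (if 0 < arr \<sigma> ''Z'' (m - 1) then arr \<sigma> ''W'' e - arr \<sigma> ''Z'' e else arr \<sigma> ''W'' e + arr \<sigma> ''Z'' e) div 2 \<and>
    arr \<sigma>' ''B'' e = arr \<sigma>' ''A'' e - arr \<sigma> ''Y'' e"], goal_cases)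
  case (9 \<sigma>' k)
  have "arr \<sigma>' ''W'' = arr \<sigma> ''W''" "arr \<sigma>' ''Z'' = arr \<sigma> ''Z''" "arr \<sigma>' ''Y'' = arr \<sigma> ''Y''" "scalar \<sigma>' ''m'' = m"
    using 9(1) assms by (auto simp: frame_def for_loop_def represents_def)
  with 9 show ?case by (cases "0 < arr \<sigma> ''Z'' (m - 1)") auto
qed (use assms m_nonneg in \<open>auto simp: represents_def\<close>)

lemma terminates_emit:
  assumes \<sigma>: "carries \<sigma>" and D: "written \<sigma> D []"
    and Y: "\<And>e. e \<in> {0..<m - 1} \<Longrightarrow> \<bar>arr \<sigma> ''Y'' e\<bar> \<le> F e" "\<And>w. ex (arr \<sigma> ''Y'') w = 0"
  shows "terminates emit \<sigma> (3000 * (n + m + F (m - 1) * n + 1)) (\<lambda>\<sigma>'.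
    \<exists>E. written \<sigma>' (D @ E) [] \<and> int (length E) \<le> F (m - 1) \<and>
      (\<forall>(w, P)\<in>set E. walk s P t \<and> m - 1 \<notin> set P) \<and>
      (\<forall>e\<in>{0..<m - 1}. decomposed E e = scalar \<sigma> ''p'' * arr \<sigma> ''Y'' e))"
proof -
  let ?Y = "arr \<sigma> ''Y''" and ?p = "scalar \<sigma> ''p''" and ?c = "m - 1"
  let ?N = "500 * (n + m + F (m - 1) * n + 1)"
  let ?Q = "\<lambda>\<sigma>'. \<exists>E. written \<sigma>' (D @ E) [] \<and> int (length E) \<le> F (m - 1) \<and>
      (\<forall>(w, P)\<in>set E. walk s P t \<and> m - 1 \<notin> set P) \<and> (\<forall>e\<in>{0..<m - 1}. decomposed E e = ?p * ?Y e)"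
  note defs = prepare_parity_def parity_fix_def parity_step_def reset_cursors_def split_flow_def
    open_flow_def extract_paths_def extract_step_def for_loop_def
  let ?prep = "prepare_parity (Add (Elem ''F'' (Var ''e'')) (Elem ''Y'' (Var ''e'')))"
  let ?copy = "for_loop ''e'' ''m'' (Store ''A'' (Var ''e'') (Elem ''B'' (Var ''e'')))"
  let ?neg = "open_flow (Sub (Const 0) (Var ''p''))"
  \<comment> \<open>The suffixes of \<open>emit\<close> are verified from the end:
    \<open>last\<close>, \<open>second\<close>, \<open>first\<close>. The flows \<open>A\<close> and
    \<open>B\<close> are fixed functions here, since both are extracted from the same array in
    turn.\<close>
  have last: "terminates extract_paths \<sigma>5 ?N ?Q"
    if \<sigma>5: "carries \<sigma>5" "arr \<sigma>5 ''A'' = B(?c := 0)" "scalar \<sigma>5 ''k'' = B ?c" "scalar \<sigma>5 ''q'' = - ?p"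
      and B: "\<And>e. e \<in> {0..<?c} \<Longrightarrow> 0 \<le> B e \<and> B e \<le> F e + 1" "B ?c \<le> F ?c" "\<And>w. ex B w = 0"
      and Ps: "int (length Ps) = A ?c" "\<forall>P\<in>set Ps. walk s P t \<and> ?c \<notin> set P" "\<forall>e\<in>{0..<?c}. multiplicity Ps e = A e"
        "written \<sigma>5 (D @ map (Pair ?p) Ps) []"
      and AB: "A ?c + B ?c \<le> F ?c" "\<And>e. e \<in> {0..<?c} \<Longrightarrow> A e - B e = ?Y e" for \<sigma>5 A B Ps
  proof (rule terminates_mono[OF terminates_extract_open[OF \<sigma>5 B Ps(4)] order_refl])
    fix \<sigma>' assume "\<exists>Qs. int (length Qs) = B ?c \<and> (\<forall>P\<in>set Qs. walk s P t \<and> ?c \<notin> set P) \<and>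
      written \<sigma>' ((D @ map (Pair ?p) Ps) @ map (Pair (- ?p)) Qs) [] \<and> (\<forall>e\<in>{0..<?c}. multiplicity Qs e = B e)"
    then obtain Qs where Qs: "int (length Qs) = B ?c" "\<forall>P\<in>set Qs. walk s P t \<and> ?c \<notin> set P"
      "written \<sigma>' ((D @ map (Pair ?p) Ps) @ map (Pair (- ?p)) Qs) []" "\<forall>e\<in>{0..<?c}. multiplicity Qs e = B e"
      by blast
    let ?E = "map (Pair ?p) Ps @ map (Pair (- ?p)) Qs"
    have "decomposed ?E e = ?p * ?Y e" if "e \<in> {0..<?c}" for e
    proof -
      have "decomposed ?E e = ?p * A e - ?p * B e"
        using Ps(3) Qs(4) that by (simp add: decomposed_append decomposed_Pair)
      then show ?thesis using AB(2)[OF that] by (simp add: right_diff_distrib[symmetric])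
    qed
    then show "?Q \<sigma>'" using Qs Ps AB(1) by (intro exI[of _ ?E]) auto
  qed
  have second: "terminates (Seq ?copy (Seq ?neg extract_paths)) \<sigma>4 (200 * (m + 1) + (30 + ?N)) ?Q"
    if \<sigma>4: "carries \<sigma>4" "\<And>e. e \<in> {0..<m} \<Longrightarrow> arr \<sigma>4 ''B'' e = B e" "scalar \<sigma>4 ''p'' = ?p"
      and B: "\<And>e. e \<in> {0..<?c} \<Longrightarrow> 0 \<le> B e \<and> B e \<le> F e + 1" "B ?c \<le> F ?c" "\<And>w. ex B w = 0"
      and Ps: "int (length Ps) = A ?c" "\<forall>P\<in>set Ps. walk s P t \<and> ?c \<notin> set P" "\<forall>e\<in>{0..<?c}. multiplicity Ps e = A e"
        "written \<sigma>4 (D @ map (Pair ?p) Ps) []"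
      and AB: "A ?c + B ?c \<le> F ?c" "\<And>e. e \<in> {0..<?c} \<Longrightarrow> A e - B e = ?Y e" for \<sigma>4 A B Ps
  proof (rule terminates_Seq)
    show "terminates ?copy \<sigma>4 (200 * (m + 1)) (\<lambda>\<sigma>'. \<forall>e\<in>{0..<m}. arr \<sigma>' ''A'' e = arr \<sigma>4 ''B'' e)"
      by (rule terminates_for_loop[where I = "\<lambda>k \<sigma>'. \<forall>e\<in>{0..<k}. arr \<sigma>' ''A'' e = arr \<sigma>4 ''B'' e"])
        (use \<sigma>4(1) m_nonneg in \<open>auto simp: carries_def represents_def frame_def for_loop_def\<close>)
    fix \<sigma>' assume f: "frame ?copy \<sigma>4 \<sigma>'" and A': "\<forall>e\<in>{0..<m}. arr \<sigma>' ''A'' e = arr \<sigma>4 ''B'' e"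
    let ?B = "arr \<sigma>' ''A''"
    have eq: "?B e = B e" if "e \<in> {0..<m}" for e using A' \<sigma>4(2) that by simp
    have eq': "?B e = B e" if "e \<in> {0..<?c}" for e using eq that by simp
    have eqc: "?B ?c = B ?c" using eq m_pos by simp
    have c: "carries \<sigma>'" using carries_frame[OF f] \<sigma>4(1) by (simp add: for_loop_def)
    then have m: "scalar \<sigma>' ''m'' = m" by (simp add: carries_def represents_def)
    have p: "scalar \<sigma>' ''p'' = ?p" using frame_scalar[OF f] \<sigma>4(3) by (simp add: for_loop_def)
    have w: "written \<sigma>' (D @ map (Pair ?p) Ps) []"
      using Ps(4) f by (subst written_cong[of _ \<sigma>4]) (simp_all add: frame_def for_loop_def)
    have exB: "ex ?B w = 0" for w using B(3) excess_cong[of m ?B B, OF eq] by simp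
    have "terminates extract_paths (exec ?neg \<sigma>') ?N ?Q"
    proof (rule last)
      show "carries (exec ?neg \<sigma>')" using c by (simp add: carries_def represents_def open_flow_def)
      show "written (exec ?neg \<sigma>') (D @ map (Pair ?p) Ps) []"
        using w by (subst written_cong[of _ \<sigma>']) (simp_all add: open_flow_def)
      show "arr (exec ?neg \<sigma>') ''A'' = ?B(?c := 0)" "scalar (exec ?neg \<sigma>') ''k'' = ?B ?c" "scalar (exec ?neg \<sigma>') ''q'' = - ?p"
        using m p by (simp_all add: open_flow_def)
    qed (use B Ps AB eq' eqc exB in auto)
    from terminates_Seq_exec[OF _ this]
    show "terminates (Seq ?neg extract_paths) \<sigma>' (30 + ?N) ?Q"
      by (rule terminates_mono) (auto simp: open_flow_def)
  qed
  have first: "terminates (Seq (open_flow (Var ''p'')) (Seq extract_paths (Seq ?copy (Seq ?neg extract_paths)))) \<sigma>3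
      (30 + (?N + (200 * (m + 1) + (30 + ?N)))) ?Q"
    if \<sigma>3: "carries \<sigma>3" "\<And>e. e \<in> {0..<m} \<Longrightarrow> arr \<sigma>3 ''B'' e = B e" "scalar \<sigma>3 ''p'' = ?p"
      "\<And>e. e \<in> {0..<m} \<Longrightarrow> arr \<sigma>3 ''A'' e = A e" "written \<sigma>3 D []"
      and AB: "\<And>e. e \<in> {0..<?c} \<Longrightarrow> 0 \<le> A e \<and> 0 \<le> B e \<and> A e + B e \<le> F e + 1"
      "\<And>w. ex A w = 0" "\<And>w. ex B w = 0" "A ?c + B ?c \<le> F ?c" "\<And>e. e \<in> {0..<?c} \<Longrightarrow> A e - B e = ?Y e" for \<sigma>3 A B
  proof -
    let ?pos = "open_flow (Var ''p'')"
    let ?\<sigma> = "exec ?pos \<sigma>3" and ?A = "arr \<sigma>3 ''A''"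
    have eq': "?A e = A e" if "e \<in> {0..<?c}" for e using \<sigma>3(4) that by simp
    have eqc: "?A ?c = A ?c" using \<sigma>3(4) m_pos by simp
    have exA: "ex ?A w = 0" for w using AB(2) excess_cong[of m ?A A, OF \<sigma>3(4)] by simp
    have nn: "0 \<le> A ?c" "0 \<le> B ?c" using return_flow_nonneg AB by blast+
    have m: "scalar \<sigma>3 ''m'' = m" using \<sigma>3(1) by (simp add: carries_def represents_def)
    have c: "carries ?\<sigma>" using \<sigma>3(1) by (simp add: carries_def represents_def open_flow_def)
    have w: "written ?\<sigma> D []"
      using \<sigma>3(5) by (subst written_cong[of _ \<sigma>3]) (simp_all add: open_flow_def)
    have "terminates (Seq extract_paths (Seq ?copy (Seq ?neg extract_paths))) ?\<sigma> (?N + (200 * (m + 1) + (30 + ?N))) ?Q"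
    proof (rule terminates_Seq[OF terminates_extract_open[OF c, of ?A ?p D]])
      show "arr ?\<sigma> ''A'' = ?A(?c := 0)" "scalar ?\<sigma> ''k'' = ?A ?c" "scalar ?\<sigma> ''q'' = ?p"
        using m \<sigma>3(3) by (simp_all add: open_flow_def)
      show "0 \<le> ?A e \<and> ?A e \<le> F e + 1" if "e \<in> {0..<?c}" for e
        using AB(1)[OF that] eq'[OF that] by auto
      show "?A ?c \<le> F ?c" using AB(4) nn eqc by simp
      fix \<sigma>' assume f: "frame extract_paths ?\<sigma> \<sigma>'" and "\<exists>Ps. int (length Ps) = ?A ?c \<and>
        (\<forall>P\<in>set Ps. walk s P t \<and> ?c \<notin> set P) \<and> written \<sigma>' (D @ map (Pair ?p) Ps) [] \<and>
        (\<forall>e\<in>{0..<?c}. multiplicity Ps e = ?A e)"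
      then obtain Ps where Ps: "int (length Ps) = A ?c" "\<forall>P\<in>set Ps. walk s P t \<and> ?c \<notin> set P"
        "\<forall>e\<in>{0..<?c}. multiplicity Ps e = A e" "written \<sigma>' (D @ map (Pair ?p) Ps) []"
        using eq' eqc by auto
      show "terminates (Seq ?copy (Seq ?neg extract_paths)) \<sigma>' (200 * (m + 1) + (30 + ?N)) ?Q"
      proof (rule second[where A = A and B = B and Ps = Ps])
        show "carries \<sigma>'" using carries_frame[OF f] c by (simp add: defs)
        show "arr \<sigma>' ''B'' e = B e" if "e \<in> {0..<m}" for e
          using frame_arr[OF f, of "''B''"] \<sigma>3(2)[OF that] by (simp add: defs)
        show "scalar \<sigma>' ''p'' = ?p"
          using frame_scalar[OF f, of "''p''"] \<sigma>3(3) by (simp add: defs)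
        show "0 \<le> B e \<and> B e \<le> F e + 1" if "e \<in> {0..<?c}" for e using AB(1)[OF that] by auto
        show "B ?c \<le> F ?c" using AB(4) nn by simp
      qed (use Ps AB in auto)
    qed (use exA w in auto)
    from terminates_Seq_exec[OF _ this] show ?thesis
      by (rule terminates_mono) (auto simp: open_flow_def)
  qed
  have r: "represents \<sigma>" using \<sigma> by (simp add: carries_def)
  let ?M = "30 + (?N + (200 * (m + 1) + (30 + ?N)))"
  have "terminates emit \<sigma> (200 * (m + 1) + (1000 * (n + m + 1) + (200 * (m + 1) + ?M))) ?Q"
    unfolding emit_def
  proof (rule terminates_Seq[OF terminates_prepare_parity[OF r, where f = "\<lambda>e. F e + ?Y e"]])
    show "eval_exp (Add (Elem ''F'' (Var ''e'')) (Elem ''Y'' (Var ''e''))) \<sigma>' = F (scalar \<sigma>' ''e'') + ?Y (scalar \<sigma>' ''e'')"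
      if "frame ?prep \<sigma> \<sigma>'" for \<sigma>'
      using that \<sigma> by (simp add: frame_def defs carries_def)
    fix \<sigma>1 assume f1: "frame ?prep \<sigma> \<sigma>1" and W: "\<forall>e\<in>{0..<m}. arr \<sigma>1 ''W'' e = F e + ?Y e \<and> arr \<sigma>1 ''Z'' e = 0"
    have c1: "carries \<sigma>1" using carries_frame[OF f1] \<sigma> by (simp add: defs)
    then have r1: "represents \<sigma>1" by (simp add: carries_def)
    have "ex (arr \<sigma>1 ''W'') w = ex (\<lambda>e. F e + ?Y e) w" for w
      by (rule excess_cong) (use W in simp)
    then have exW: "ex (arr \<sigma>1 ''W'') w = 0" for w using F_circ Y(2) by (simp add: excess_add)
    show "terminates (Seq parity_fix (Seq split_flow (Seq (open_flow (Var ''p''))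
      (Seq extract_paths (Seq ?copy (Seq ?neg extract_paths)))))) \<sigma>1 (1000 * (n + m + 1) + (200 * (m + 1) + ?M)) ?Q"
    proof (rule terminates_Seq[OF terminates_parity_fix[OF r1]])
      fix \<sigma>2 assume f2: "frame parity_fix \<sigma>1 \<sigma>2" and Z: "(\<forall>e\<in>{0..<m}. arr \<sigma>2 ''Z'' e \<in> {-1, 0, 1} \<and>
        even (arr \<sigma>1 ''W'' e - arr \<sigma>2 ''Z'' e)) \<and> (\<forall>w. ex (arr \<sigma>2 ''Z'') w = 0)"
      have c2: "carries \<sigma>2" using carries_frame[OF f2] c1 by (simp add: defs)
      then have r2: "represents \<sigma>2" by (simp add: carries_def)
      have W2: "arr \<sigma>2 ''W'' = arr \<sigma>1 ''W''" "arr \<sigma>2 ''Y'' = ?Y" "scalar \<sigma>2 ''p'' = ?p"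
        using f1 f2 by (simp_all add: frame_def defs)
      have w2: "written \<sigma>2 D []"
        using D f1 f2 by (subst written_cong[of _ \<sigma>]) (simp_all add: frame_def defs)
      show "terminates (Seq split_flow (Seq (open_flow (Var ''p''))
        (Seq extract_paths (Seq ?copy (Seq ?neg extract_paths))))) \<sigma>2 (200 * (m + 1) + ?M) ?Q"
      proof (rule terminates_Seq[OF terminates_split_flow[OF r2]])
        fix \<sigma>3 assume f3: "frame split_flow \<sigma>2 \<sigma>3" and AB: "\<forall>e\<in>{0..<m}.
          arr \<sigma>3 ''A'' e = (if 0 < arr \<sigma>2 ''Z'' (m - 1) then arr \<sigma>2 ''W'' e - arr \<sigma>2 ''Z'' e else arr \<sigma>2 ''W'' e + arr \<sigma>2 ''Z'' e) div 2 \<and>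
          arr \<sigma>3 ''B'' e = arr \<sigma>3 ''A'' e - arr \<sigma>2 ''Y'' e"
        \<comment> \<open>The parity fix after the choice of sign; a change of sign affects neither
          its parities nor its conservation.\<close>
        define Z' where "Z' = (\<lambda>e. (if 0 < arr \<sigma>2 ''Z'' (m - 1) then -1 else 1) * arr \<sigma>2 ''Z'' e)"
        have Z': "Z' e \<in> {-1, 0, 1} \<and> even (F e + ?Y e + Z' e)" if "e \<in> {0..<m}" for e
          using Z W that by (auto simp: Z'_def)
        have exZ': "ex Z' w = 0" for w unfolding Z'_def excess_mult using Z by simp
        have "Z' ?c \<le> 0" by (simp add: Z'_def)
        note bounds = split_flow_bounds[where Y = ?Y and Z = Z' and A = "arr \<sigma>3 ''A''" and B = "arr \<sigma>3 ''B''",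
            OF Y Z' exZ' this]
        have A: "arr \<sigma>3 ''A'' e = (F e + ?Y e + Z' e) div 2" "arr \<sigma>3 ''B'' e = arr \<sigma>3 ''A'' e - ?Y e"
          if "e \<in> {0..<m}" for e
          using AB W W2 that by (auto simp: Z'_def)
        show "terminates (Seq (open_flow (Var ''p''))
          (Seq extract_paths (Seq ?copy (Seq ?neg extract_paths)))) \<sigma>3 ?M ?Q"
        proof (rule first[where A = "arr \<sigma>3 ''A''" and B = "arr \<sigma>3 ''B''"])
          show "carries \<sigma>3" using carries_frame[OF f3] c2 by (simp add: defs)
          show "scalar \<sigma>3 ''p'' = ?p" using frame_scalar[OF f3, of "''p''"] W2 by (simp add: defs)
          show "written \<sigma>3 D []"
            using w2 f3 by (subst written_cong[of _ \<sigma>2]) (simp_all add: frame_def defs)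
          show "arr \<sigma>3 ''A'' e - arr \<sigma>3 ''B'' e = ?Y e" if "e \<in> {0..<?c}" for e
            using A(2)[of e] that by simp
        qed (use bounds A in auto)
      qed
    qed (use W exW in auto)
  qed simp
  moreover have "0 \<le> n * F ?c" using F_return_nonneg n_nonneg by simp
  ultimately show ?thesis by (elim terminates_mono) (use n_nonneg m_nonneg in auto)
qed

end

section \<open>Binary levels: repeated halving of the flow\<close>

definition halve_flow :: prog where
  "halve_flow = for_loop ''e'' ''m'' (Seq (Store ''Y'' (Var ''e'') (Elem ''Z'' (Var ''e'')))
     (Store ''flow'' (Var ''e'') (Half (Sub (Elem ''flow'' (Var ''e'')) (Elem ''Z'' (Var ''e''))))))"

text \<open>Without multiplication the weight \<open>p\<close> is doubled by an addition.
  \<open>i\<close> is a ghost counter of the levels done, linked to the weight by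
  \<open>p = 2 ^ i\<close>.\<close>

definition level :: prog where
  "level = Seq (prepare_parity (Elem ''flow'' (Var ''e''))) (Seq parity_fix (Seq halve_flow
     (Seq emit (Seq (Assign ''p'' (Add (Var ''p'') (Var ''p''))) (Assign ''i'' (Add (Var ''i'') (Const 1)))))))"

definition levels :: prog where
  "levels = Seq (While (Less (Var ''p'') (Var ''norm'')) level)
     (Seq (for_loop ''e'' ''m'' (Store ''Y'' (Var ''e'') (Elem ''flow'' (Var ''e'')))) emit)"

context circulation_network
begin

definition st_walks :: "(int \<times> int list) list \<Rightarrow> bool" where
  "st_walks D \<longleftrightarrow> (\<forall>(w, P)\<in>set D. walk s P t \<and> m - 1 \<notin> set P)"

lemma st_walks_append: "st_walks (D @ E) \<longleftrightarrow> st_walks D \<and> st_walks E"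
  by (auto simp: st_walks_def)

text \<open>The last bound is invariant because \<open>2 * (\<bar>(x - y) div 2\<bar> - 1) \<le> \<bar>x\<bar> - 1\<close> for \<open>y \<in> {-1, 0, 1}\<close>
  of the parity of \<open>x\<close>; it gives \<open>\<bar>x\<bar> \<le> 1\<close> as soon as the scale \<open>2 ^ i\<close> reaches the norm \<open>N\<close>.\<close>

definition level_inv :: "(int \<Rightarrow> int) \<Rightarrow> int \<Rightarrow> (int \<times> int list) list \<Rightarrow> state \<Rightarrow> bool" where
  "level_inv X N D \<sigma> \<longleftrightarrow> carries \<sigma> \<and> scalar \<sigma> ''norm'' = N \<and> written \<sigma> D [] \<and> st_walks D \<and>
     0 \<le> scalar \<sigma> ''i'' \<and> scalar \<sigma> ''p'' = 2 ^ nat (scalar \<sigma> ''i'') \<and>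
     int (length D) \<le> scalar \<sigma> ''i'' * F (m - 1) \<and> (\<forall>w. ex (arr \<sigma> ''flow'') w = 0) \<and>
     (\<forall>e\<in>{0..<m - 1}. X e = scalar \<sigma> ''p'' * arr \<sigma> ''flow'' e + decomposed D e \<and>
       (arr \<sigma> ''flow'' e \<noteq> 0 \<longrightarrow> 1 \<le> F e) \<and> (\<bar>arr \<sigma> ''flow'' e\<bar> - 1) * scalar \<sigma> ''p'' < N)"

lemma terminates_halve_flow:
  assumes "represents \<sigma>"
  shows "terminates halve_flow \<sigma> (200 * (m + 1)) (\<lambda>\<sigma>'. \<forall>e\<in>{0..<m}.
    arr \<sigma>' ''Y'' e = arr \<sigma> ''Z'' e \<and> arr \<sigma>' ''flow'' e = (arr \<sigma> ''flow'' e - arr \<sigma> ''Z'' e) div 2)"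
proof (rule terminates_mono)
  \<comment> \<open>\<open>flow\<close> is overwritten in place, so the invariant must also record
    that the cells from \<open>k\<close> on are still the old ones.\<close>
  let ?I = "\<lambda>k \<sigma>'. (\<forall>e\<in>{0..<k}. arr \<sigma>' ''Y'' e = arr \<sigma> ''Z'' e \<and>
      arr \<sigma>' ''flow'' e = (arr \<sigma> ''flow'' e - arr \<sigma> ''Z'' e) div 2) \<and>
    (\<forall>e. k \<le> e \<longrightarrow> arr \<sigma>' ''flow'' e = arr \<sigma> ''flow'' e)"
  show "terminates halve_flow \<sigma> (200 * (m + 1)) (?I m)"
    unfolding halve_flow_def
    by (rule terminates_for_loop[where I = ?I])
      (use assms m_nonneg in \<open>auto simp: represents_def frame_def for_loop_def\<close>)
qed auto

lemma terminates_level: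
  assumes I: "level_inv X N D \<sigma>"
  shows "terminates level \<sigma> (5000 * (n + m + F (m - 1) * n + 1)) (\<lambda>\<sigma>'.
    (\<exists>D'. level_inv X N D' \<sigma>') \<and> scalar \<sigma>' ''i'' = scalar \<sigma> ''i'' + 1)"
    (is "terminates _ _ _ ?Q")
proof -
  let ?f = "arr \<sigma> ''flow''" and ?p = "scalar \<sigma> ''p''" and ?i = "scalar \<sigma> ''i''" and ?c = "m - 1"
  note I' = I[unfolded level_inv_def]
  note defs = prepare_parity_def parity_fix_def parity_step_def reset_cursors_def split_flow_def
    open_flow_def extract_paths_def extract_step_def for_loop_def halve_flow_def emit_def
  have r: "represents \<sigma>" using I' by (simp add: carries_def)
  let ?inc = "Seq (Assign ''p'' (Add (Var ''p'') (Var ''p''))) (Assign ''i'' (Add (Var ''i'') (Const 1)))"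
  let ?M = "3000 * (n + m + F ?c * n + 1) + 10"
  have "terminates level \<sigma> (200 * (m + 1) + (1000 * (n + m + 1) + (200 * (m + 1) + ?M))) ?Q"
    unfolding level_def
  proof (rule terminates_Seq[OF terminates_prepare_parity[OF r, where f = ?f]])
    show "eval_exp (Elem ''flow'' (Var ''e'')) \<sigma>' = ?f (scalar \<sigma>' ''e'')"
      if "frame (prepare_parity (Elem ''flow'' (Var ''e''))) \<sigma> \<sigma>'" for \<sigma>'
      using that by (simp add: frame_def defs)
    fix \<sigma>1 assume f1: "frame (prepare_parity (Elem ''flow'' (Var ''e''))) \<sigma> \<sigma>1"
      and W: "\<forall>e\<in>{0..<m}. arr \<sigma>1 ''W'' e = ?f e \<and> arr \<sigma>1 ''Z'' e = 0"
    have c1: "carries \<sigma>1" using carries_frame[OF f1] I' by (simp add: defs)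
    then have r1: "represents \<sigma>1" by (simp add: carries_def)
    have exW: "ex (arr \<sigma>1 ''W'') w = 0" for w
      using excess_cong[of m "arr \<sigma>1 ''W''" ?f] W I' by simp
    show "terminates (Seq parity_fix (Seq halve_flow (Seq emit ?inc))) \<sigma>1
      (1000 * (n + m + 1) + (200 * (m + 1) + ?M)) ?Q"
    proof (rule terminates_Seq[OF terminates_parity_fix[OF r1]])
      fix \<sigma>2 assume f2: "frame parity_fix \<sigma>1 \<sigma>2" and Z: "(\<forall>e\<in>{0..<m}. arr \<sigma>2 ''Z'' e \<in> {-1, 0, 1} \<and>
        even (arr \<sigma>1 ''W'' e - arr \<sigma>2 ''Z'' e)) \<and> (\<forall>w. ex (arr \<sigma>2 ''Z'') w = 0)"
      have c2: "carries \<sigma>2" using carries_frame[OF f2] c1 by (simp add: defs)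
      then have r2: "represents \<sigma>2" by (simp add: carries_def)
      have W2: "arr \<sigma>2 ''flow'' = ?f" using f1 f2 by (simp add: frame_def defs)
      show "terminates (Seq halve_flow (Seq emit ?inc)) \<sigma>2 (200 * (m + 1) + ?M) ?Q"
      proof (rule terminates_Seq[OF terminates_halve_flow[OF r2]])
        fix \<sigma>3 assume f3: "frame halve_flow \<sigma>2 \<sigma>3" and Y: "\<forall>e\<in>{0..<m}.
          arr \<sigma>3 ''Y'' e = arr \<sigma>2 ''Z'' e \<and> arr \<sigma>3 ''flow'' e = (arr \<sigma>2 ''flow'' e - arr \<sigma>2 ''Z'' e) div 2"
        let ?Y = "arr \<sigma>3 ''Y''" and ?g = "arr \<sigma>3 ''flow''"
        have c3: "carries \<sigma>3" using carries_frame[OF f3] c2 by (simp add: defs)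
        have s3: "scalar \<sigma>3 ''p'' = ?p" "scalar \<sigma>3 ''i'' = ?i" "scalar \<sigma>3 ''norm'' = N"
          using f1 f2 f3 I' by (simp_all add: frame_def defs)
        have w3: "written \<sigma>3 D []"
          using I' f1 f2 f3 by (subst written_cong[of _ \<sigma>]) (simp_all add: frame_def defs)
        have Y01: "?Y e \<in> {-1, 0, 1}" "?f e = 2 * ?g e + ?Y e" if "e \<in> {0..<m}" for e
        proof -
          have "even (?f e - ?Y e)" "?Y e \<in> {-1, 0, 1}" "?g e = (?f e - ?Y e) div 2"
            using W Z Y W2 that by (simp_all)
          then show "?Y e \<in> {-1, 0, 1}" "?f e = 2 * ?g e + ?Y e" by simp_all
        qed
        have exY: "ex ?Y w = 0" for w
          using excess_cong[of m ?Y "arr \<sigma>2 ''Z''"] Y Z by simp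
        have "ex ?f w = ex (\<lambda>e. 2 * ?g e + ?Y e) w" for w by (rule excess_cong) (rule Y01)
        then have exg: "ex ?g w = 0" for w using I' exY by (simp add: excess_add excess_mult)
        \<comment> \<open>Where \<open>?f\<close> is 0, its parity fix and its half are 0 too, so
          the support never grows. The last bound is \<open>2 * |?g e| <= |?f e| + 1\<close> in
          another form.\<close>
        have Yg: "(?Y e \<noteq> 0 \<longrightarrow> 1 \<le> F e) \<and> (?g e \<noteq> 0 \<longrightarrow> 1 \<le> F e) \<and> 2 * (\<bar>?g e\<bar> - 1) \<le> \<bar>?f e\<bar> - 1"
          if e: "e \<in> {0..<?c}" for e
        proof -
          have e': "e \<in> {0..<m}" using e by auto
          have "?Y e = -1 \<or> ?Y e = 0 \<or> ?Y e = 1" using Y01(1)[OF e'] by auto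
          moreover from this have "?Y e \<noteq> 0 \<or> ?g e \<noteq> 0 \<Longrightarrow> ?f e \<noteq> 0"
            using Y01(2)[OF e'] by presburger
          moreover have "?f e \<noteq> 0 \<longrightarrow> 1 \<le> F e" using I' e by blast
          ultimately show ?thesis using Y01(2)[OF e'] by auto
        qed
        have YF: "\<bar>?Y e\<bar> \<le> F e" if e: "e \<in> {0..<?c}" for e
        proof -
          have "?Y e \<in> {-1, 0, 1}" using Y01(1)[of e] e by simp
          then show ?thesis using Yg[OF e] F_nonneg[OF e] by auto
        qed
        show "terminates (Seq emit ?inc) \<sigma>3 ?M ?Q"
        proof (rule terminates_Seq[OF terminates_emit[OF c3 w3 YF exY]])
          fix \<sigma>4 assume f4: "frame emit \<sigma>3 \<sigma>4" and "\<exists>E. written \<sigma>4 (D @ E) [] \<and> int (length E) \<le> F ?c \<and>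
            (\<forall>(w, P)\<in>set E. walk s P t \<and> m - 1 \<notin> set P) \<and>
            (\<forall>e\<in>{0..<?c}. decomposed E e = scalar \<sigma>3 ''p'' * ?Y e)"
          then obtain E where E: "written \<sigma>4 (D @ E) []" "int (length E) \<le> F ?c" "st_walks E"
            "\<forall>e\<in>{0..<?c}. decomposed E e = ?p * ?Y e"
            using s3 by (auto simp: st_walks_def)
          have c4: "carries \<sigma>4" using carries_frame[OF f4] c3 by (simp add: defs)
          have s4: "scalar \<sigma>4 ''p'' = ?p" "scalar \<sigma>4 ''i'' = ?i" "scalar \<sigma>4 ''norm'' = N" "arr \<sigma>4 ''flow'' = ?g"
            using f4 s3 by (simp_all add: frame_def defs)
          let ?\<sigma> = "exec ?inc \<sigma>4"
          have "level_inv X N (D @ E) ?\<sigma>"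
            unfolding level_inv_def
          proof (intro conjI ballI allI)
            show "carries ?\<sigma>" using c4 by (simp add: carries_def represents_def)
            show "scalar ?\<sigma> ''norm'' = N" "0 \<le> scalar ?\<sigma> ''i''" using s4 I' by simp_all
            show "written ?\<sigma> (D @ E) []" using E(1) by (subst written_cong[of _ \<sigma>4]) simp_all
            show "st_walks (D @ E)" using I' E(3) by (simp add: st_walks_append)
            have "?p = 2 ^ nat ?i" "0 \<le> ?i" using I' by blast+
            then show "scalar ?\<sigma> ''p'' = 2 ^ nat (scalar ?\<sigma> ''i'')" using s4 by (simp add: nat_add_distrib)
            show "int (length (D @ E)) \<le> scalar ?\<sigma> ''i'' * F ?c"
              using I' E(2) s4 by (simp add: algebra_simps)
            show "ex (arr ?\<sigma> ''flow'') w = 0" for w using exg s4 by simp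
            fix e assume e: "e \<in> {0..<?c}"
            then have e': "e \<in> {0..<m}" by auto
            have "X e = ?p * ?f e + decomposed D e" using I' e by blast
            also have "\<dots> = scalar ?\<sigma> ''p'' * arr ?\<sigma> ''flow'' e + decomposed (D @ E) e"
              using Y01(2)[OF e'] E(4) e s4 by (simp add: decomposed_append algebra_simps)
            finally show "X e = scalar ?\<sigma> ''p'' * arr ?\<sigma> ''flow'' e + decomposed (D @ E) e" .
            show "arr ?\<sigma> ''flow'' e \<noteq> 0 \<longrightarrow> 1 \<le> F e" using Yg[OF e] s4 by simp
            have "0 < ?p" using I' by simp
            moreover have "2 * (\<bar>?g e\<bar> - 1) \<le> \<bar>?f e\<bar> - 1" using Yg[OF e] by blast
            ultimately have "2 * (\<bar>?g e\<bar> - 1) * ?p \<le> (\<bar>?f e\<bar> - 1) * ?p" by (intro mult_right_mono) auto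
            also have "\<dots> < N" using I' e by blast
            finally show "(\<bar>arr ?\<sigma> ''flow'' e\<bar> - 1) * scalar ?\<sigma> ''p'' < N" using s4 by (simp add: algebra_simps)
          qed
          then show "terminates ?inc \<sigma>4 10 ?Q" using s4 by (intro terminates_exec) auto
        qed
      qed
    qed (use W exW in auto)
  qed simp
  moreover have "0 \<le> n * F ?c" using F_return_nonneg n_nonneg by simp
  ultimately show ?thesis by (elim terminates_mono) (use n_nonneg m_nonneg in auto)
qed

text \<open>While the loop runs, \<open>2 ^ i = p < N \<le> 2 ^ L\<close>, so there are at most
  \<open>L\<close> halvings; emitting the remaining flow adds the 1 in the bound on the
  size.\<close>

lemma terminates_levels:
  assumes \<sigma>: "carries \<sigma>" "scalar \<sigma> ''norm'' = N" "scalar \<sigma> ''i'' = 0" "scalar \<sigma> ''p'' = 1" "written \<sigma> [] []"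
    and X: "\<And>w. ex (arr \<sigma> ''flow'') w = 0"
      "\<And>e. e \<in> {0..<m - 1} \<Longrightarrow> (arr \<sigma> ''flow'' e \<noteq> 0 \<longrightarrow> 1 \<le> F e) \<and> \<bar>arr \<sigma> ''flow'' e\<bar> \<le> N"
    and L: "N \<le> 2 ^ L" and N: "0 < N"
  shows "terminates levels \<sigma> (6000 * (n + m + F (m - 1) * n + 1) * (int L + 2)) (\<lambda>\<sigma>'.
    \<exists>D. written \<sigma>' D [] \<and> st_walks D \<and> int (length D) \<le> (int L + 1) * F (m - 1) \<and>
      (\<forall>e\<in>{0..<m - 1}. arr \<sigma> ''flow'' e = decomposed D e))"
    (is "terminates _ _ _ ?Q")
proof -
  let ?X = "arr \<sigma> ''flow''" and ?c = "m - 1"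
  let ?S = "n + m + F (m - 1) * n + 1"
  let ?I = "\<lambda>\<sigma>'. \<exists>D. level_inv ?X N D \<sigma>'"
  let ?J = "\<lambda>\<sigma>'. ?I \<sigma>' \<and> scalar \<sigma>' ''i'' \<le> int L"
  let ?V = "\<lambda>\<sigma>'. int L - scalar \<sigma>' ''i''"
  note defs = prepare_parity_def parity_fix_def parity_step_def reset_cursors_def split_flow_def
    open_flow_def extract_paths_def extract_step_def for_loop_def halve_flow_def emit_def
  have S: "1 \<le> ?S" using n_nonneg m_pos F_return_nonneg by simp
  have "\<bar>?X e\<bar> - 1 < N" if "e \<in> {0..<?c}" for e using X(2)[OF that] by linarith
  then have init: "level_inv ?X N [] \<sigma>"
    using \<sigma> X F_return_nonneg by (auto simp: level_inv_def decomposed_def st_walks_def)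
  have loop: "terminates (While (Less (Var ''p'') (Var ''norm'')) level) \<sigma> (5500 * ?S * (?V \<sigma> + 1))
    (\<lambda>\<sigma>'. ?J \<sigma>' \<and> \<not> eval_cond (Less (Var ''p'') (Var ''norm'')) \<sigma>')"
  proof (rule terminates_While[where I = ?J and V = ?V])
    fix \<sigma>' assume "?J \<sigma>'" and b: "eval_cond (Less (Var ''p'') (Var ''norm'')) \<sigma>'"
    then obtain D where D: "level_inv ?X N D \<sigma>'" and le: "scalar \<sigma>' ''i'' \<le> int L" by blast
    let ?i = "scalar \<sigma>' ''i''"
    have "0 \<le> ?i" "scalar \<sigma>' ''p'' = 2 ^ nat ?i" "scalar \<sigma>' ''norm'' = N"
      using D unfolding level_inv_def by blast+
    moreover have "scalar \<sigma>' ''p'' < scalar \<sigma>' ''norm''" using b by simp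
    ultimately have "(2 :: int) ^ nat ?i < 2 ^ L" using L by linarith
    then have "nat ?i < L" by simp
    then have lt: "?i + 1 \<le> int L" by linarith
    moreover have "terminates level \<sigma>' (5500 * ?S - 1 - int (cost_cond (Less (Var ''p'') (Var ''norm''))))
        (\<lambda>\<sigma>''. ?J \<sigma>'' \<and> ?V \<sigma>'' \<le> ?V \<sigma>' - 1)"
      by (rule terminates_mono[OF terminates_level[OF D]]) (use S lt in \<open>auto simp: algebra_simps\<close>)
    ultimately show "1 \<le> ?V \<sigma>' \<and> terminates level \<sigma>' (5500 * ?S - 1 - int (cost_cond (Less (Var ''p'') (Var ''norm''))))
        (\<lambda>\<sigma>''. ?J \<sigma>'' \<and> ?V \<sigma>'' \<le> ?V \<sigma>' - 1)" by simp
  qed (use init \<sigma> S in auto)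
  let ?fin = "for_loop ''e'' ''m'' (Store ''Y'' (Var ''e'') (Elem ''flow'' (Var ''e'')))"
  have "terminates levels \<sigma> (5500 * ?S * (?V \<sigma> + 1) + (200 * (m + 1) + 3000 * ?S)) ?Q"
    unfolding levels_def
  proof (rule terminates_Seq[OF loop])
    fix \<sigma>1 assume "?J \<sigma>1 \<and> \<not> eval_cond (Less (Var ''p'') (Var ''norm'')) \<sigma>1"
    then obtain D where D: "level_inv ?X N D \<sigma>1" and i: "scalar \<sigma>1 ''i'' \<le> int L"
      and p: "scalar \<sigma>1 ''norm'' \<le> scalar \<sigma>1 ''p''" by auto
    note D' = D[unfolded level_inv_def]
    let ?f = "arr \<sigma>1 ''flow''" and ?p = "scalar \<sigma>1 ''p''"
    have c1: "carries \<sigma>1" using D' by blast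
    show "terminates (Seq ?fin emit) \<sigma>1 (200 * (m + 1) + 3000 * ?S) ?Q"
    proof (rule terminates_Seq)
      show "terminates ?fin \<sigma>1 (200 * (m + 1)) (\<lambda>\<sigma>'. \<forall>e\<in>{0..<m}. arr \<sigma>' ''Y'' e = ?f e)"
        by (rule terminates_for_loop[where I = "\<lambda>k \<sigma>'. \<forall>e\<in>{0..<k}. arr \<sigma>' ''Y'' e = ?f e"])
          (use c1 m_nonneg in \<open>auto simp: carries_def represents_def frame_def for_loop_def\<close>)
      fix \<sigma>2 assume f2: "frame ?fin \<sigma>1 \<sigma>2" and Y: "\<forall>e\<in>{0..<m}. arr \<sigma>2 ''Y'' e = ?f e"
      have c2: "carries \<sigma>2" using carries_frame[OF f2] c1 by (simp add: defs)
      have w2: "written \<sigma>2 D []"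
        using D' f2 by (subst written_cong[of _ \<sigma>1]) (simp_all add: frame_def defs)
      have p2: "scalar \<sigma>2 ''p'' = ?p" using frame_scalar[OF f2] by (simp add: defs)
      have exY: "ex (arr \<sigma>2 ''Y'') w = 0" for w
        using excess_cong[of m "arr \<sigma>2 ''Y''" ?f] Y D' by simp
      \<comment> \<open>The scale has reached the norm, so only the values -1, 0 and 1 remain;
        \<open>F\<close> dominates them as it is at least 1 on the support.\<close>
      have YF: "\<bar>arr \<sigma>2 ''Y'' e\<bar> \<le> F e" if e: "e \<in> {0..<?c}" for e
      proof -
        have "(\<bar>?f e\<bar> - 1) * ?p < N" "N \<le> ?p" "0 < ?p" "?f e \<noteq> 0 \<longrightarrow> 1 \<le> F e"
          using D' e p by auto
        then have "(\<bar>?f e\<bar> - 1) * ?p < 1 * ?p" by linarith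
        then have "\<bar>?f e\<bar> - 1 < 1" using \<open>0 < ?p\<close> by (simp only: mult_less_cancel_right_pos)
        then show ?thesis using Y e F_nonneg[OF e] \<open>?f e \<noteq> 0 \<longrightarrow> 1 \<le> F e\<close> by (cases "?f e = 0") auto
      qed
      show "terminates emit \<sigma>2 (3000 * ?S) ?Q"
      proof (rule terminates_mono[OF terminates_emit[OF c2 w2 YF exY] order_refl])
        fix \<sigma>' assume "\<exists>E. written \<sigma>' (D @ E) [] \<and> int (length E) \<le> F ?c \<and>
            (\<forall>(w, P)\<in>set E. walk s P t \<and> m - 1 \<notin> set P) \<and>
            (\<forall>e\<in>{0..<?c}. decomposed E e = scalar \<sigma>2 ''p'' * arr \<sigma>2 ''Y'' e)"
        then obtain E where E: "written \<sigma>' (D @ E) []" "int (length E) \<le> F ?c" "st_walks E"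
            "\<forall>e\<in>{0..<?c}. decomposed E e = ?p * ?f e"
          using p2 Y by (auto simp: st_walks_def)
        have "scalar \<sigma>1 ''i'' * F ?c \<le> int L * F ?c" using i F_return_nonneg by (intro mult_right_mono)
        then have "int (length (D @ E)) \<le> (int L + 1) * F ?c" using D' E(2) by (simp add: algebra_simps)
        moreover have "?X e = decomposed (D @ E) e" if "e \<in> {0..<?c}" for e
          using D' E(4) that by (simp add: decomposed_append)
        ultimately show "?Q \<sigma>'" using E D' by (intro exI[of _ "D @ E"]) (auto simp: st_walks_append)
      qed
    qed
  qed
  moreover have "5500 * S * (l + 1) + (200 * k + 3000 * S) \<le> 6000 * S * (l + 2)"
    if "1 \<le> S" "k \<le> S" "0 \<le> S * l" for S l k :: int
    using that by (simp add: algebra_simps)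
  from this[of ?S "m + 1" "?V \<sigma>"]
  have "5500 * ?S * (?V \<sigma> + 1) + (200 * (m + 1) + 3000 * ?S) \<le> 6000 * ?S * (int L + 2)"
    using S n_nonneg F_return_nonneg \<sigma>(3) by simp
  ultimately show ?thesis by (rule terminates_mono)
qed

end

section \<open>The algorithm\<close>

definition scan_low :: prog where
  "scan_low = If (neq (Elem ''flow'' (Var ''e'')) (Const 0))
     (Store ''low'' (Var ''e'') (Const 1)) (Store ''low'' (Var ''e'') (Const 0))"

definition scan_norm :: prog where
  "scan_norm = Seq
     (If (Less (Var ''norm'') (Elem ''flow'' (Var ''e''))) (Assign ''norm'' (Elem ''flow'' (Var ''e'')))
       (Assign ''norm'' (Var ''norm'')))
     (If (Less (Var ''norm'') (Sub (Const 0) (Elem ''flow'' (Var ''e''))))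
       (Assign ''norm'' (Sub (Const 0) (Elem ''flow'' (Var ''e'')))) (Assign ''norm'' (Var ''norm'')))"

definition scan_value :: prog where
  "scan_value = If (neq (Elem ''tail'' (Var ''e'')) (Var ''s'')) (Assign ''val'' (Var ''val''))
     (Assign ''val'' (Add (Var ''val'') (Elem ''flow'' (Var ''e''))))"

definition insert_arc :: prog where
  "insert_arc =
     Seq (Store ''next'' (Add (Var ''e'') (Var ''e'')) (Elem ''first'' (Elem ''tail'' (Var ''e''))))
     (Seq (Store ''first'' (Elem ''tail'' (Var ''e'')) (Add (Add (Var ''e'') (Var ''e'')) (Const 1)))
     (Seq (Store ''next'' (Add (Add (Var ''e'') (Var ''e'')) (Const 1)) (Elem ''first'' (Elem ''head'' (Var ''e''))))
     (Store ''first'' (Elem ''head'' (Var ''e'')) (Add (Add (Var ''e'') (Var ''e'')) (Const 2)))))"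

definition scan_arc :: prog where
  "scan_arc =
     Seq scan_low (Seq scan_norm (Seq scan_value (Seq insert_arc
     (Seq (Store ''F'' (Var ''e'') (Elem ''low'' (Var ''e'')))
     (Seq (Store ''ex'' (Elem ''tail'' (Var ''e'')) (Sub (Elem ''ex'' (Elem ''tail'' (Var ''e''))) (Elem ''low'' (Var ''e''))))
     (Seq (Store ''ex'' (Elem ''head'' (Var ''e'')) (Add (Elem ''ex'' (Elem ''head'' (Var ''e''))) (Elem ''low'' (Var ''e''))))
     (Seq (Store ''out'' (Elem ''tail'' (Var ''e'')) (Var ''e''))
     (Store ''in'' (Elem ''head'' (Var ''e'')) (Var ''e'')))))))))"

lemma exec_scan_low: "exec scan_low \<sigma> = \<sigma>\<lparr>arr := (arr \<sigma>)(''low'' :=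
    (arr \<sigma> ''low'')(scalar \<sigma> ''e'' := of_bool (arr \<sigma> ''flow'' (scalar \<sigma> ''e'') \<noteq> 0)))\<rparr>"
  by (auto simp: scan_low_def)

lemma exec_scan_norm: "exec scan_norm \<sigma> = \<sigma>\<lparr>scalar := (scalar \<sigma>)(''norm'' :=
    max (scalar \<sigma> ''norm'') \<bar>arr \<sigma> ''flow'' (scalar \<sigma> ''e'')\<bar>)\<rparr>"
proof -
  have max: "max N \<bar>x\<bar> = (if (if N < x then x else N) < - x then - x else if N < x then x else N)" for N x :: int
    by auto
  show ?thesis unfolding max by (simp add: scan_norm_def)
qed

lemma exec_scan_value: "exec scan_value \<sigma> = \<sigma>\<lparr>scalar := (scalar \<sigma>)(''val'' := scalar \<sigma> ''val'' +
    arr \<sigma> ''flow'' (scalar \<sigma> ''e'') * of_bool (arr \<sigma> ''tail'' (scalar \<sigma> ''e'') = scalar \<sigma> ''s''))\<rparr>"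
  by (auto simp: scan_value_def)

lemma greatest_below_step:
  "greatest_below f v k c \<Longrightarrow> greatest_below f v (k + 1) (if f k = v then k + 1 else c)"
  unfolding greatest_below_def by (auto simp: less_le)

text \<open>The two new residual arcs have the largest numbers, so prepending them one after the
  other keeps the lists decreasing.\<close>

lemma adjacency_insert:
  assumes adj: "adjacency m ta he first nxt" and m: "0 \<le> m"
  defines "first1 \<equiv> first(ta m := 2 * m + 1)"
  shows "adjacency (m + 1) ta he (first1(he m := 2 * m + 2)) (nxt(2 * m := first (ta m), 2 * m + 1 := first1 (he m)))"
proof -
  let ?f = "src ta he"
  have 1: "greatest_below ?f v (2 * m + 1) (first1 v)" for v
    using greatest_below_step[of ?f v "2 * m" "first v"] adj
    by (auto simp: adjacency_def first1_def src_def)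
  have 2: "greatest_below ?f v (2 * m + 2) ((first1(he m := 2 * m + 2)) v)" for v
    using greatest_below_step[OF 1[of v]] by (auto simp: src_def algebra_simps)
  have "greatest_below ?f (?f a) a ((nxt(2 * m := first (ta m), 2 * m + 1 := first1 (he m))) a)"
    if a: "a \<in> {0..<2 * (m + 1)}" for a
  proof -
    consider "a \<in> {0..<2 * m}" | "a = 2 * m" | "a = 2 * m + 1" using a by fastforce
    then show ?thesis
    proof cases
      case 1
      then show ?thesis using adj by (simp add: adjacency_def)
    next
      case 2
      then show ?thesis using adj by (simp add: adjacency_def src_def)
    next
      case 3
      then show ?thesis using 1[of "he m"] by (simp add: src_def)
    qed
  qed
  with 2 show ?thesis by (simp add: adjacency_def distrib_left)
qed

text \<open>This is for the moment when the return arc is written into cell \<open>m\<close> of the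
  endpoint arrays: the lists depend only on the cells below.\<close>

lemma adjacency_cong:
  assumes adj: "adjacency m ta he first nxt" and eq: "\<And>e. e \<in> {0..<m} \<Longrightarrow> ta e = ta' e \<and> he e = he' e"
  shows "adjacency m ta' he' first nxt"
proof -
  have f: "src ta he b = src ta' he' b" if "b \<in> {0..<2 * m}" for b
    using eq[of "b div 2"] that by (auto simp: src_def)
  have g: "greatest_below (src ta' he') v k c" if g: "greatest_below (src ta he) v k c" and k: "k \<le> 2 * m" for v k c
    unfolding greatest_below_def
  proof (intro conjI allI impI)
    show "src ta' he' (c - 1) = v" if "0 < c"
      using g k that f[of "c - 1"] by (simp add: greatest_below_def)
    show "src ta' he' b \<noteq> v" if "c \<le> b \<and> b < k" for b
    proof -
      have "src ta he b \<noteq> v" "0 \<le> c" using g that unfolding greatest_below_def by blast+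
      then show ?thesis using k that f[of b] by simp
    qed
  qed (use g in \<open>simp_all add: greatest_below_def\<close>)
  have "greatest_below (src ta' he') (src ta' he' a) a (nxt a)" if "a \<in> {0..<2 * m}" for a
  proof -
    have "greatest_below (src ta he) (src ta he a) a (nxt a)"
      using adj that unfolding adjacency_def by blast
    then show ?thesis using g[of "src ta he a" a "nxt a"] that f[OF that] by simp
  qed
  with g adj show ?thesis by (auto simp: adjacency_def)
qed

definition scanned ::
  "(int \<Rightarrow> int) \<Rightarrow> (int \<Rightarrow> int) \<Rightarrow> (int \<Rightarrow> int) \<Rightarrow> int \<Rightarrow> int \<Rightarrow> state \<Rightarrow> bool" where
  "scanned ta he X s k \<sigma> \<longleftrightarrow>
     adjacency k ta he (arr \<sigma> ''first'') (arr \<sigma> ''next'') \<and>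
     (\<forall>e\<in>{0..<k}. arr \<sigma> ''low'' e = of_bool (X e \<noteq> 0) \<and> arr \<sigma> ''F'' e = arr \<sigma> ''low'' e) \<and>
     (\<forall>w. arr \<sigma> ''ex'' w = excess k ta he (arr \<sigma> ''F'') w) \<and>
     (\<forall>e\<in>{0..<k}. arr \<sigma> ''out'' (ta e) \<in> {0..<k} \<and> ta (arr \<sigma> ''out'' (ta e)) = ta e) \<and>
     (\<forall>e\<in>{0..<k}. arr \<sigma> ''in'' (he e) \<in> {0..<k} \<and> he (arr \<sigma> ''in'' (he e)) = he e) \<and>
     0 \<le> scalar \<sigma> ''norm'' \<and> (\<forall>e\<in>{0..<k}. \<bar>X e\<bar> \<le> scalar \<sigma> ''norm'') \<and>
     (scalar \<sigma> ''norm'' = 0 \<or> (\<exists>e\<in>{0..<k}. scalar \<sigma> ''norm'' = \<bar>X e\<bar>)) \<and>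
     scalar \<sigma> ''val'' = (\<Sum>e\<in>{0..<k}. X e * of_bool (ta e = s))"

lemma atLeastLessThan_Suc_int: "0 \<le> k \<Longrightarrow> {0..<k + 1} = insert k {0..<k :: int}"
  by auto

lemma excess_Suc:
  assumes "0 \<le> k"
  shows "excess (k + 1) ta he (f(k := x)) w = excess k ta he f w + x * (of_bool (he k = w) - of_bool (ta k = w))"
proof -
  have "(\<Sum>e\<in>{0..<k}. (f(k := x)) e * (of_bool (he e = w) - of_bool (ta e = w))) =
      (\<Sum>e\<in>{0..<k}. f e * (of_bool (he e = w) - of_bool (ta e = w)))"
    by (rule sum.cong) auto
  then show ?thesis using assms by (simp add: excess_def atLeastLessThan_Suc_int)
qed

lemma scanned_step:
  assumes S: "scanned ta he X s k \<sigma>" and k: "0 \<le> k" "scalar \<sigma> ''e'' = k"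
    and eq: "arr \<sigma> ''tail'' = ta" "arr \<sigma> ''head'' = he" "arr \<sigma> ''flow'' = X" "scalar \<sigma> ''s'' = s"
  shows "scanned ta he X s (k + 1) ((exec scan_arc \<sigma>)\<lparr>scalar := (scalar (exec scan_arc \<sigma>))(''e'' := k + 1)\<rparr>)"
    (is "scanned _ _ _ _ _ ?\<sigma>")
proof -
  note S' = S[unfolded scanned_def]
  note ev = scan_arc_def exec_scan_low exec_scan_norm exec_scan_value insert_arc_def eq k(2)
  have nx: "arr ?\<sigma> ''first'' = ((arr \<sigma> ''first'')(ta k := 2 * k + 1))(he k := 2 * k + 2)"
    "arr ?\<sigma> ''next'' = (arr \<sigma> ''next'')(2 * k := arr \<sigma> ''first'' (ta k),
       2 * k + 1 := ((arr \<sigma> ''first'')(ta k := 2 * k + 1)) (he k))"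
    "arr ?\<sigma> ''low'' = (arr \<sigma> ''low'')(k := of_bool (X k \<noteq> 0))"
    "arr ?\<sigma> ''F'' = (arr \<sigma> ''F'')(k := of_bool (X k \<noteq> 0))"
    "arr ?\<sigma> ''ex'' = (\<lambda>w. arr \<sigma> ''ex'' w + of_bool (X k \<noteq> 0) * (of_bool (he k = w) - of_bool (ta k = w)))"
    "arr ?\<sigma> ''out'' = (arr \<sigma> ''out'')(ta k := k)" "arr ?\<sigma> ''in'' = (arr \<sigma> ''in'')(he k := k)"
    "scalar ?\<sigma> ''norm'' = max (scalar \<sigma> ''norm'') \<bar>X k\<bar>"
    "scalar ?\<sigma> ''val'' = scalar \<sigma> ''val'' + X k * of_bool (ta k = s)"
    by (simp_all add: ev fun_eq_iff)
  have e: "e \<in> {0..<k} \<or> e = k" if "e \<in> {0..<k + 1}" for e using that by auto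
  show ?thesis
    unfolding scanned_def nx
  proof (intro conjI allI ballI)
    show "adjacency (k + 1) ta he ((arr \<sigma> ''first'')(ta k := 2 * k + 1, he k := 2 * k + 2))
        ((arr \<sigma> ''next'')(2 * k := arr \<sigma> ''first'' (ta k), 2 * k + 1 := ((arr \<sigma> ''first'')(ta k := 2 * k + 1)) (he k)))"
      by (rule adjacency_insert) (use S' k in auto)
    fix w
    show "arr \<sigma> ''ex'' w + of_bool (X k \<noteq> 0) * (of_bool (he k = w) - of_bool (ta k = w)) =
        excess (k + 1) ta he ((arr \<sigma> ''F'')(k := of_bool (X k \<noteq> 0))) w"
      using S' k(1) by (simp only: excess_Suc)
  next
    have "scalar \<sigma> ''norm'' = 0 \<or> (\<exists>e\<in>{0..<k}. scalar \<sigma> ''norm'' = \<bar>X e\<bar>)" using S' by blast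
    moreover have "k \<in> {0..<k + 1}" "{0..<k} \<subseteq> {0..<k + 1}" using k by auto
    ultimately show "max (scalar \<sigma> ''norm'') \<bar>X k\<bar> = 0 \<or> (\<exists>e\<in>{0..<k + 1}. max (scalar \<sigma> ''norm'') \<bar>X k\<bar> = \<bar>X e\<bar>)"
      by (cases "\<bar>X k\<bar> \<le> scalar \<sigma> ''norm''") (auto simp: max_def)
  next
    show "scalar \<sigma> ''val'' + X k * of_bool (ta k = s) = (\<Sum>e = 0..<k + 1. X e * of_bool (ta e = s))"
      using S' k(1) by (simp add: atLeastLessThan_Suc_int)
  next
    fix e' assume e': "e' \<in> {0..<k + 1}"
    have old: "arr \<sigma> ''out'' (ta e') \<in> {0..<k}" "ta (arr \<sigma> ''out'' (ta e')) = ta e'"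
        "arr \<sigma> ''in'' (he e') \<in> {0..<k}" "he (arr \<sigma> ''in'' (he e')) = he e'"
        "arr \<sigma> ''low'' e' = of_bool (X e' \<noteq> 0)" "arr \<sigma> ''F'' e' = arr \<sigma> ''low'' e'" "\<bar>X e'\<bar> \<le> scalar \<sigma> ''norm''"
      if "e' \<noteq> k"
    proof -
      have "e' \<in> {0..<k}" using e[OF e'] that by blast
      then show "arr \<sigma> ''out'' (ta e') \<in> {0..<k}" "ta (arr \<sigma> ''out'' (ta e')) = ta e'"
        "arr \<sigma> ''in'' (he e') \<in> {0..<k}" "he (arr \<sigma> ''in'' (he e')) = he e'"
        "arr \<sigma> ''low'' e' = of_bool (X e' \<noteq> 0)" "arr \<sigma> ''F'' e' = arr \<sigma> ''low'' e'" "\<bar>X e'\<bar> \<le> scalar \<sigma> ''norm''"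
        using S' by blast+
    qed
    show "((arr \<sigma> ''out'')(ta k := k)) (ta e') \<in> {0..<k + 1}" "ta (((arr \<sigma> ''out'')(ta k := k)) (ta e')) = ta e'"
      "((arr \<sigma> ''in'')(he k := k)) (he e') \<in> {0..<k + 1}" "he (((arr \<sigma> ''in'')(he k := k)) (he e')) = he e'"
      "((arr \<sigma> ''low'')(k := of_bool (X k \<noteq> 0))) e' = of_bool (X e' \<noteq> 0)"
      "((arr \<sigma> ''F'')(k := of_bool (X k \<noteq> 0))) e' = ((arr \<sigma> ''low'')(k := of_bool (X k \<noteq> 0))) e'"
      "\<bar>X e'\<bar> \<le> max (scalar \<sigma> ''norm'') \<bar>X k\<bar>"
      using k(1) old by (cases "e' = k"; force simp: le_max_iff_disj)+
  qed (use S' in auto)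
qed

lemma terminates_scan:
  assumes "scalar \<sigma> ''m'' = m" "0 \<le> m" "arr \<sigma> ''tail'' = ta" "arr \<sigma> ''head'' = he" "arr \<sigma> ''flow'' = X" "scalar \<sigma> ''s'' = s"
    and zero: "\<And>w. arr \<sigma> ''first'' w = 0" "\<And>w. arr \<sigma> ''ex'' w = 0" "scalar \<sigma> ''norm'' = 0" "scalar \<sigma> ''val'' = 0"
  shows "terminates (for_loop ''e'' ''m'' scan_arc) \<sigma> (200 * (m + 1)) (scanned ta he X s m)"
proof (rule terminates_for_loop)
  show "scanned ta he X s 0 (\<sigma>\<lparr>scalar := (scalar \<sigma>)(''e'' := 0)\<rparr>)"
    using zero by (simp add: scanned_def adjacency_def greatest_below_def excess_def)
  fix \<sigma>' k
  assume f: "frame (for_loop ''e'' ''m'' scan_arc) \<sigma> \<sigma>'" and "scanned ta he X s k \<sigma>'" "scalar \<sigma>' ''e'' = k" "0 \<le> k"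
  then show "scanned ta he X s (k + 1) ((exec scan_arc \<sigma>')\<lparr>scalar := (scalar (exec scan_arc \<sigma>'))(''e'' := k + 1)\<rparr>)"
    by (intro scanned_step)
      (use assms in \<open>auto simp: frame_def for_loop_def scan_arc_def scan_low_def scan_norm_def scan_value_def insert_arc_def\<close>)
qed (use assms in \<open>simp_all add: scan_arc_def scan_low_def scan_norm_def scan_value_def insert_arc_def\<close>)

text \<open>Number \<open>m\<close> becomes the return arc. No arc enters \<open>s\<close>, so its
  excess is minus the value of the flow; \<open>val\<close> is the value of the input flow, gathered
  at \<open>s\<close> during the scan.\<close>

definition close_network :: prog where
  "close_network =
     Seq (Store ''tail'' (Var ''m'') (Var ''t'')) (Seq (Store ''head'' (Var ''m'') (Var ''s''))
     (Seq (Store ''F'' (Var ''m'') (Sub (Const 0) (Elem ''ex'' (Var ''s''))))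
     (Seq (Store ''flow'' (Var ''m'') (Var ''val'')) (Seq (Assign ''e'' (Var ''m'')) (Seq insert_arc
     (Seq (Assign ''m'' (Add (Var ''m'') (Const 1))) (Assign ''p'' (Const 1))))))))"

definition algorithm :: prog where
  "algorithm = Seq (for_loop ''e'' ''m'' scan_arc) (Seq drain (Seq settle (Seq close_network levels)))"

section \<open>Instances, closed cuts and the complete program\<close>

locale flow_instance =
  fixes n m s t :: int and ta he rk X :: "int \<Rightarrow> int"
  assumes n_nonneg: "0 \<le> n" and m_pos: "0 < m"
    and tail_vertex: "e \<in> {0..<m} \<Longrightarrow> ta e \<in> {0..<n}"
    and head_vertex: "e \<in> {0..<m} \<Longrightarrow> he e \<in> {0..<n}"
    and st_vertex: "s \<in> {0..<n}" "t \<in> {0..<n}" "s \<noteq> t"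
    and rk_range: "v \<in> {0..<n} \<Longrightarrow> 0 \<le> rk v \<and> rk v < n"
    and rk_less: "e \<in> {0..<m} \<Longrightarrow> rk (ta e) < rk (he e)"
    and s_source: "e \<in> {0..<m} \<Longrightarrow> he e \<noteq> s" and t_sink: "e \<in> {0..<m} \<Longrightarrow> ta e \<noteq> t"
    and out_exists: "v \<in> {0..<n} \<Longrightarrow> v \<noteq> t \<Longrightarrow> \<exists>e\<in>{0..<m}. ta e = v"
    and in_exists: "v \<in> {0..<n} \<Longrightarrow> v \<noteq> s \<Longrightarrow> \<exists>e\<in>{0..<m}. he e = v"
    and conservation: "w \<noteq> s \<Longrightarrow> w \<noteq> t \<Longrightarrow> excess m ta he X w = 0"
begin

definition closed_cut :: "int set \<Rightarrow> bool" where
  "closed_cut R \<longleftrightarrow> s \<notin> R \<and> t \<in> R \<and> (\<forall>e\<in>{0..<m}. ta e \<in> R \<longrightarrow> he e \<in> R)"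

definition cut_support :: "int set \<Rightarrow> int set" where
  "cut_support R = {e \<in> {0..<m}. ta e \<notin> R \<and> he e \<in> R \<and> X e \<noteq> 0}"

text \<open>The surplus of a node is at most its inflow, and every arc counts once as inflow. As
  \<open>F\<close> starts with values 0 and 1, \<open>drain\<close> has to move at most
  \<open>m\<close> units.\<close>

lemma sum_surplus:
  assumes "\<And>e. e \<in> {0..<m} \<Longrightarrow> 0 \<le> f e \<and> f e \<le> 1"
  shows "(\<Sum>w\<in>{0..<n}. max 0 (excess m ta he f w)) \<le> m"
proof -
  have "max 0 (excess m ta he f w) \<le> (\<Sum>e\<in>{0..<m}. f e * of_bool (he e = w))" for w
  proof -
    have "excess m ta he f w \<le> (\<Sum>e\<in>{0..<m}. f e * of_bool (he e = w))"
      unfolding excess_def using assms by (intro sum_mono mult_left_mono) auto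
    moreover have "0 \<le> (\<Sum>e\<in>{0..<m}. f e * of_bool (he e = w))"
      using assms by (intro sum_nonneg) auto
    ultimately show ?thesis by simp
  qed
  then have "(\<Sum>w\<in>{0..<n}. max 0 (excess m ta he f w)) \<le> (\<Sum>w\<in>{0..<n}. \<Sum>e\<in>{0..<m}. f e * of_bool (he e = w))"
    by (rule sum_mono)
  also have "\<dots> = (\<Sum>e\<in>{0..<m}. \<Sum>w\<in>{0..<n}. f e * of_bool (he e = w))"
    by (rule sum.swap)
  also have "\<dots> \<le> (\<Sum>e\<in>{0..<m}. 1)"
  proof (rule sum_mono)
    fix e assume e: "e \<in> {0..<m}"
    have "(\<Sum>w\<in>{0..<n}. f e * of_bool (he e = w)) = (\<Sum>w\<in>{0..<n}. if he e = w then f e else 0)"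
      by (rule sum.cong) auto
    also have "\<dots> = f e" using head_vertex[OF e] by simp
    also have "f e \<le> 1" using assms[OF e] by blast
    finally show "(\<Sum>w\<in>{0..<n}. f e * of_bool (he e = w)) \<le> 1" .
  qed
  finally show ?thesis using m_pos by simp
qed

lemma excess_s: "excess m ta he f s = - (\<Sum>e\<in>{0..<m}. f e * of_bool (ta e = s))"
  unfolding excess_def sum_negf[symmetric] using s_source by (intro sum.cong) auto

lemma excess_t: "excess m ta he f t = (\<Sum>e\<in>{0..<m}. f e * of_bool (he e = t))"
  unfolding excess_def using t_sink by (intro sum.cong) auto

lemma excess_s_t:
  assumes "\<And>w. w \<noteq> s \<Longrightarrow> w \<noteq> t \<Longrightarrow> excess m ta he f w = 0"
  shows "excess m ta he f t = - excess m ta he f s"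
proof -
  have "(\<Sum>w\<in>{0..<n}. excess m ta he f w) = 0"
    unfolding sum_excess[OF finite_atLeastLessThan_int]
    using tail_vertex head_vertex by (intro sum.neutral) auto
  moreover have "(\<Sum>w\<in>{0..<n}. excess m ta he f w) = (\<Sum>w\<in>{s, t}. excess m ta he f w)"
    using st_vertex assms by (intro sum.mono_neutral_right) auto
  ultimately show ?thesis using st_vertex by simp
qed

lemma excess_close:
  assumes "\<And>w. w \<noteq> s \<Longrightarrow> w \<noteq> t \<Longrightarrow> excess m ta he f w = 0"
  shows "excess (m + 1) (ta(m := t)) (he(m := s)) (f(m := - excess m ta he f s)) w = 0"
proof -
  have "excess m (ta(m := t)) (he(m := s)) f w = excess m ta he f w"
    unfolding excess_def by (rule sum.cong) auto
  then show ?thesis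
    using excess_Suc[of m "ta(m := t)" "he(m := s)" f] m_pos assms[of w] excess_s_t[OF assms] st_vertex
    by (auto split: if_splits)
qed

text \<open>In the sum of the excess over \<open>R\<close> only \<open>t\<close> contributes.
  Counted by arcs, no arc leaves \<open>R\<close>, and those entering it carry 1 on the support of
  \<open>X\<close> and 0 elsewhere.\<close>

lemma cut_value:
  assumes R: "R \<subseteq> {0..<n}" "s \<notin> R" "t \<in> R" "\<And>e. e \<in> {0..<m} \<Longrightarrow> ta e \<in> R \<Longrightarrow> he e \<in> R"
    and F: "\<And>e. e \<in> {0..<m} \<Longrightarrow> he e \<in> R \<Longrightarrow> ta e \<notin> R \<Longrightarrow> F e = of_bool (X e \<noteq> 0)"
    and ex: "\<And>w. w \<noteq> s \<Longrightarrow> w \<noteq> t \<Longrightarrow> excess m ta he F w = 0"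
  shows "excess m ta he F t = int (card (cut_support R))"
proof -
  have fin: "finite R" using R(1) finite_subset by blast
  have "(\<Sum>w\<in>R. excess m ta he F w) = (\<Sum>w\<in>{t}. excess m ta he F w)"
  proof (intro sum.mono_neutral_right ballI)
    fix w assume "w \<in> R - {t}"
    then show "excess m ta he F w = 0" using R(2) ex[of w] by blast
  qed (use R(3) fin in auto)
  then have "excess m ta he F t = (\<Sum>e\<in>{0..<m}. F e * (of_bool (he e \<in> R) - of_bool (ta e \<in> R)))"
    using sum_excess[OF fin] by simp
  also have "\<dots> = (\<Sum>e\<in>{0..<m}. of_bool (e \<in> cut_support R))"
    by (rule sum.cong) (use R(4) F in \<open>auto simp: cut_support_def\<close>)
  also have "\<dots> = int (card (cut_support R))"
  proof -
    have "{0..<m} \<inter> {e. e \<in> cut_support R} = cut_support R" by (auto simp: cut_support_def)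
    then show ?thesis by simp
  qed
  finally show ?thesis .
qed

end

lemma arc_walk_restrict:
  assumes "arc_walk (m + 1) (ta(m := x)) (he(m := y)) u p v" "m \<notin> set p"
  shows "arc_walk m ta he u p v"
  using assms by (induction p arbitrary: u) auto

context flow_instance
begin

text \<open>The result is stated against cuts, not paths: \<open>W\<close> bounds all closed cuts
  and enters the time, while \<open>V\<close>, the value of the flow found, is one particular cut
  and enters the size. If this value is 0, the certificate does not force \<open>t\<close> into
  \<open>R\<close>, hence the alternative \<open>V = 0\<close>.\<close>

lemma terminates_algorithm:
  assumes \<sigma>: "scalar \<sigma> ''n'' = n" "scalar \<sigma> ''m'' = m" "scalar \<sigma> ''s'' = s" "scalar \<sigma> ''t'' = t"
      "arr \<sigma> ''tail'' = ta" "arr \<sigma> ''head'' = he" "arr \<sigma> ''flow'' = X"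
    and zero: "\<And>x. x \<in> {''norm'', ''val'', ''i'', ''len'', ''size''} \<Longrightarrow> scalar \<sigma> x = 0"
      "\<And>a w. a \<in> {''first'', ''ex'', ''d'', ''start''} \<Longrightarrow> arr \<sigma> a w = 0"
    and W: "0 \<le> W" "\<And>R. closed_cut R \<Longrightarrow> int (card (cut_support R)) \<le> W"
    and L: "\<And>e. e \<in> {0..<m} \<Longrightarrow> \<bar>X e\<bar> \<le> 2 ^ L" and nonzero: "\<exists>e\<in>{0..<m}. X e \<noteq> 0"
  shows "terminates algorithm \<sigma> (10000 * (n * n + m * n + n + m + 1) + 6000 * (n + (m + 1) + W * n + 1) * (int L + 2))
    (\<lambda>\<sigma>'. \<exists>D V. written \<sigma>' D [] \<and> (\<forall>(w, P)\<in>set D. arc_walk m ta he s P t) \<and>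
      (\<forall>e\<in>{0..<m}. X e = decomposed D e) \<and> int (length D) \<le> (int L + 1) * V \<and>
      (V = 0 \<or> (\<exists>R. closed_cut R \<and> V = int (card (cut_support R)))))"
    (is "terminates _ _ _ ?Q")
proof -
  note frs = frame_def for_loop_def scan_arc_def scan_low_def scan_norm_def scan_value_def insert_arc_def
    drain_def reset_cursors_def drain_step_def settle_def settle_step_def
  let ?scan = "for_loop ''e'' ''m'' scan_arc"
  let ?N = "6000 * (n + (m + 1) + W * n + 1) * (int L + 2)"
  have m: "0 \<le> m" using m_pos by simp
  have last: "terminates (Seq close_network levels) \<sigma>3 (60 + ?N) ?Q"
    if adj: "adjacency m ta he (arr \<sigma>3 ''first'') (arr \<sigma>3 ''next'')"
      and \<sigma>3: "scalar \<sigma>3 ''n'' = n" "scalar \<sigma>3 ''m'' = m" "scalar \<sigma>3 ''s'' = s" "scalar \<sigma>3 ''t'' = t"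
        "arr \<sigma>3 ''tail'' = ta" "arr \<sigma>3 ''head'' = he" "arr \<sigma>3 ''flow'' = X"
        "scalar \<sigma>3 ''i'' = 0" "scalar \<sigma>3 ''len'' = 0" "scalar \<sigma>3 ''size'' = 0" "arr \<sigma>3 ''start'' 0 = 0"
        "scalar \<sigma>3 ''val'' = (\<Sum>e\<in>{0..<m}. X e * of_bool (ta e = s))"
      and norm: "\<forall>e\<in>{0..<m}. \<bar>X e\<bar> \<le> scalar \<sigma>3 ''norm''" "0 < scalar \<sigma>3 ''norm''" "scalar \<sigma>3 ''norm'' \<le> 2 ^ L"
      and F: "\<And>w. arr \<sigma>3 ''ex'' w = excess m ta he (arr \<sigma>3 ''F'') w" "\<And>w. w \<noteq> s \<Longrightarrow> w \<noteq> t \<Longrightarrow> excess m ta he (arr \<sigma>3 ''F'') w = 0"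
        "\<And>e. e \<in> {0..<m} \<Longrightarrow> of_bool (X e \<noteq> 0) \<le> arr \<sigma>3 ''F'' e"
      and V: "V = excess m ta he (arr \<sigma>3 ''F'') t" "V = 0 \<or> (\<exists>R. closed_cut R \<and> V = int (card (cut_support R)))"
    for \<sigma>3 V
  proof -
    let ?\<sigma> = "exec close_network \<sigma>3"
    let ?F = "(arr \<sigma>3 ''F'')(m := - excess m ta he (arr \<sigma>3 ''F'') s)"
    let ?X = "X(m := - excess m ta he X s)"
    have ev: "scalar ?\<sigma> ''n'' = n" "scalar ?\<sigma> ''m'' = m + 1" "scalar ?\<sigma> ''s'' = s" "scalar ?\<sigma> ''t'' = t"
      "arr ?\<sigma> ''tail'' = ta(m := t)" "arr ?\<sigma> ''head'' = he(m := s)" "arr ?\<sigma> ''F'' = ?F" "arr ?\<sigma> ''flow'' = ?X"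
      "scalar ?\<sigma> ''i'' = 0" "scalar ?\<sigma> ''p'' = 1" "scalar ?\<sigma> ''norm'' = scalar \<sigma>3 ''norm''"
      "arr ?\<sigma> ''start'' = arr \<sigma>3 ''start''" "scalar ?\<sigma> ''len'' = 0" "scalar ?\<sigma> ''size'' = 0"
      "arr ?\<sigma> ''first'' = (arr \<sigma>3 ''first'')(t := 2 * m + 1, s := 2 * m + 2)"
      "arr ?\<sigma> ''next'' = (arr \<sigma>3 ''next'')(2 * m := arr \<sigma>3 ''first'' t, 2 * m + 1 := ((arr \<sigma>3 ''first'')(t := 2 * m + 1)) s)"
      using \<sigma>3 F(1) excess_s[of X] by (simp_all add: close_network_def insert_arc_def)
    have "adjacency m (ta(m := t)) (he(m := s)) (arr \<sigma>3 ''first'') (arr \<sigma>3 ''next'')"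
      by (rule adjacency_cong[OF adj]) auto
    from adjacency_insert[OF this m]
    have adj': "adjacency (m + 1) (ta(m := t)) (he(m := s)) (arr ?\<sigma> ''first'') (arr ?\<sigma> ''next'')"
      by (simp add: ev)
    have Fnn: "0 \<le> arr \<sigma>3 ''F'' e" if "e \<in> {0..<m}" for e
      using F(3)[OF that] by (cases "X e = 0") auto
    interpret C: circulation_network n "m + 1" "ta(m := t)" "he(m := s)" "arr ?\<sigma> ''first''" "arr ?\<sigma> ''next''" s t rk ?F
    proof
      show "(ta(m := t)) e \<in> {0..<n}" "(he(m := s)) e \<in> {0..<n}" if "e \<in> {0..<m + 1}" for e
        using that tail_vertex[of e] head_vertex[of e] st_vertex by auto
      show "excess (m + 1) (ta(m := t)) (he(m := s)) ?F w = 0" for w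
        by (rule excess_close) (rule F(2))
    qed (use n_nonneg m_pos adj' rk_range rk_less t_sink st_vertex Fnn in auto)
    have Vm: "?F m = V" using V(1) excess_s_t[OF F(2)] by simp
    have VW: "V \<le> W" using V(2) W by auto
    have "C.carries ?\<sigma>" unfolding C.carries_def C.represents_def by (simp add: ev)
    moreover have "written ?\<sigma> [] []" using \<sigma>3 by (simp add: written_def ev)
    moreover have "C.ex (arr ?\<sigma> ''flow'') w = 0" for w
      unfolding ev by (rule excess_close) (rule conservation)
    moreover have "(arr ?\<sigma> ''flow'' e \<noteq> 0 \<longrightarrow> 1 \<le> ?F e) \<and> \<bar>arr ?\<sigma> ''flow'' e\<bar> \<le> scalar \<sigma>3 ''norm''"
      if "e \<in> {0..<m + 1 - 1}" for e
      using that F(3)[of e] norm(1) by (auto simp: ev)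
    ultimately have "terminates levels ?\<sigma> (6000 * (n + (m + 1) + ?F (m + 1 - 1) * n + 1) * (int L + 2)) (\<lambda>\<sigma>'.
      \<exists>D. written \<sigma>' D [] \<and> C.st_walks D \<and> int (length D) \<le> (int L + 1) * ?F (m + 1 - 1) \<and>
        (\<forall>e\<in>{0..<m + 1 - 1}. arr ?\<sigma> ''flow'' e = decomposed D e))"
      by (intro C.terminates_levels) (use norm ev in auto)
    then have "terminates levels ?\<sigma> ?N ?Q"
    proof (rule terminates_mono)
      have "V * n \<le> W * n" using VW n_nonneg by (rule mult_right_mono)
      then show "6000 * (n + (m + 1) + ?F (m + 1 - 1) * n + 1) * (int L + 2) \<le> ?N"
        using Vm by (intro mult_right_mono) auto
      fix \<sigma>' assume "\<exists>D. written \<sigma>' D [] \<and> C.st_walks D \<and> int (length D) \<le> (int L + 1) * ?F (m + 1 - 1) \<and>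
        (\<forall>e\<in>{0..<m + 1 - 1}. arr ?\<sigma> ''flow'' e = decomposed D e)"
      then obtain D where D: "written \<sigma>' D []" "C.st_walks D" "int (length D) \<le> (int L + 1) * V"
        "\<forall>e\<in>{0..<m}. X e = decomposed D e" using Vm ev by auto
      moreover have "\<forall>(w, P)\<in>set D. arc_walk m ta he s P t"
        using D(2) arc_walk_restrict unfolding C.st_walks_def by fastforce
      ultimately show "?Q \<sigma>'" using V(2) by blast
    qed
    from terminates_Seq_exec[OF _ this] show ?thesis
      by (rule terminates_mono) (auto simp: close_network_def insert_arc_def)
  qed
  have "terminates algorithm \<sigma> (200 * (m + 1) + (1000 * (n * n + m * n + n + m + 1) + (1000 * (n * n + n + 1) + (60 + ?N)))) ?Q"
    unfolding algorithm_def
  proof (rule terminates_Seq[OF terminates_scan[OF \<sigma>(2) m \<sigma>(5,6,7,3)]])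
    fix \<sigma>1 assume f1: "frame ?scan \<sigma> \<sigma>1" and S: "scanned ta he X s m \<sigma>1"
    note S' = S[unfolded scanned_def]
    have adj: "adjacency m ta he (arr \<sigma>1 ''first'') (arr \<sigma>1 ''next'')" using S' by blast
    let ?low = "arr \<sigma>1 ''low''"
    have low: "?low e = of_bool (X e \<noteq> 0)" if "e \<in> {0..<m}" for e using S' that by blast
    interpret D: dag_network n m ta he "arr \<sigma>1 ''first''" "arr \<sigma>1 ''next''" s t rk "arr \<sigma>1 ''out''" "arr \<sigma>1 ''in''"
    proof
      show "arr \<sigma>1 ''out'' v \<in> {0..<m} \<and> ta (arr \<sigma>1 ''out'' v) = v" if "v \<in> {0..<n}" "v \<noteq> t" for v
        using out_exists[OF that] S' by blast
      show "arr \<sigma>1 ''in'' v \<in> {0..<m} \<and> he (arr \<sigma>1 ''in'' v) = v" if "v \<in> {0..<n}" "v \<noteq> s" for v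
        using in_exists[OF that] S' by blast
    qed (use n_nonneg m tail_vertex head_vertex adj rk_range rk_less in auto)
    have s1: "scalar \<sigma>1 ''n'' = n" "scalar \<sigma>1 ''m'' = m" "scalar \<sigma>1 ''s'' = s" "scalar \<sigma>1 ''t'' = t"
        "arr \<sigma>1 ''tail'' = ta" "arr \<sigma>1 ''head'' = he" "arr \<sigma>1 ''flow'' = X"
        "scalar \<sigma>1 ''i'' = 0" "scalar \<sigma>1 ''len'' = 0" "scalar \<sigma>1 ''size'' = 0" "arr \<sigma>1 ''start'' 0 = 0"
        "\<And>w. arr \<sigma>1 ''d'' w = 0"
      using f1 \<sigma> zero by (simp_all add: frs)
    have r1: "D.represents_dag \<sigma>1" by (simp add: D.represents_dag_def D.represents_def s1)
    then have r1': "D.represents \<sigma>1" by (simp add: D.represents_dag_def)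
    have F1: "arr \<sigma>1 ''F'' e = ?low e" if "e \<in> {0..<m}" for e using S' that by blast
    have ex1: "arr \<sigma>1 ''ex'' w = excess m ta he (arr \<sigma>1 ''F'') w" for w using S' by blast
    have "(\<Sum>w\<in>{0..<n}. max 0 (arr \<sigma>1 ''ex'' w)) \<le> m"
      unfolding ex1 by (rule sum_surplus) (use F1 low in auto)
    note drain = D.terminates_drain[OF r1' s1(12) _ ex1 this]
    show "terminates (Seq drain (Seq settle (Seq close_network levels))) \<sigma>1
      (1000 * (n * n + m * n + n + m + 1) + (1000 * (n * n + n + 1) + (60 + ?N))) ?Q"
    proof (rule terminates_Seq[OF drain])
      fix \<sigma>2 assume f2: "frame drain \<sigma>1 \<sigma>2"
        and "(\<forall>w. arr \<sigma>2 ''ex'' w = excess m ta he (arr \<sigma>2 ''F'') w) \<and> (\<exists>R. D.is_cut R ?low (arr \<sigma>2 ''F''))"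
      then obtain R where ex2: "\<And>w. arr \<sigma>2 ''ex'' w = excess m ta he (arr \<sigma>2 ''F'') w" and R2: "D.is_cut R ?low (arr \<sigma>2 ''F'')"
        by blast
      have r2: "D.represents_dag \<sigma>2"
        using r1 f2 by (simp add: D.represents_dag_def D.represents_def frs)
      show "terminates (Seq settle (Seq close_network levels)) \<sigma>2 (1000 * (n * n + n + 1) + (60 + ?N)) ?Q"
      proof (rule terminates_Seq[OF D.terminates_settle[OF r2 ex2 R2]])
        fix \<sigma>3 assume f3: "frame settle \<sigma>2 \<sigma>3" and *: "(\<forall>w. arr \<sigma>3 ''ex'' w = excess m ta he (arr \<sigma>3 ''F'') w) \<and>
          D.is_cut R ?low (arr \<sigma>3 ''F'') \<and> (\<forall>w. w \<noteq> s \<and> w \<noteq> t \<longrightarrow> excess m ta he (arr \<sigma>3 ''F'') w = 0)"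
        let ?F = "arr \<sigma>3 ''F''"
        let ?V = "excess m ta he ?F t"
        have ex3: "w \<noteq> s \<Longrightarrow> w \<noteq> t \<Longrightarrow> excess m ta he ?F w = 0" for w using * by blast
        have cut: "R \<subseteq> {0..<n}" "\<And>e. e \<in> {0..<m} \<Longrightarrow> ?low e \<le> ?F e" "\<And>w. 0 < excess m ta he ?F w \<Longrightarrow> w \<in> R"
          "\<And>w. excess m ta he ?F w < 0 \<Longrightarrow> w \<notin> R" "\<And>e. e \<in> {0..<m} \<Longrightarrow> ta e \<in> R \<Longrightarrow> he e \<in> R"
          "\<And>e. e \<in> {0..<m} \<Longrightarrow> he e \<in> R \<Longrightarrow> ta e \<notin> R \<Longrightarrow> ?F e = ?low e"
          using * unfolding D.is_cut_def by blast+
        have F0: "0 \<le> ?F e" if "e \<in> {0..<m}" for e using cut(2)[OF that] low[OF that] by (cases "X e = 0") auto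
        have V0: "0 \<le> ?V" unfolding excess_t using F0 by (intro sum_nonneg) auto
        have V: "?V = 0 \<or> (\<exists>R. closed_cut R \<and> ?V = int (card (cut_support R)))"
        proof (cases "?V = 0")
          case False
          \<comment> \<open>A nonzero value is a surplus of \<open>t\<close> and a deficit of
            \<open>s\<close>, so the certificate separates them.\<close>
          then have "t \<in> R" using V0 cut(3)[of t] by simp
          moreover have "s \<notin> R" using False V0 excess_s_t[OF ex3] cut(4)[of s] by simp
          ultimately have "closed_cut R" "?V = int (card (cut_support R))"
            using cut low by (auto simp: closed_cut_def intro!: cut_value ex3)
          then show ?thesis by blast
        qed simp
        have norm: "\<forall>e\<in>{0..<m}. \<bar>X e\<bar> \<le> scalar \<sigma>1 ''norm''" using S' by blast
        moreover obtain e where e: "e \<in> {0..<m}" "X e \<noteq> 0" using nonzero by blast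
        ultimately have pos: "0 < scalar \<sigma>1 ''norm''" by force
        then obtain e' where "e' \<in> {0..<m}" "scalar \<sigma>1 ''norm'' = \<bar>X e'\<bar>" using S' by force
        then have le: "scalar \<sigma>1 ''norm'' \<le> 2 ^ L" using L by simp
        have fr: "scalar \<sigma>3 x = scalar \<sigma>1 x" if "x \<in> {''n'', ''m'', ''s'', ''t'', ''i'', ''len'', ''size'', ''val'', ''norm''}" for x
        proof -
          have "x \<notin> scalars_of drain" "x \<notin> scalars_of settle"
            using that by (auto simp: drain_def reset_cursors_def for_loop_def drain_step_def settle_def settle_step_def)
          then show ?thesis using frame_scalar[OF f2] frame_scalar[OF f3] by simp
        qed
        have fa: "arr \<sigma>3 a = arr \<sigma>1 a" if "a \<in> {''tail'', ''head'', ''flow'', ''start'', ''first'', ''next''}" for a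
        proof -
          have "a \<notin> arrays_of drain" "a \<notin> arrays_of settle"
            using that by (auto simp: drain_def reset_cursors_def for_loop_def drain_step_def settle_def settle_step_def)
          then show ?thesis using frame_arr[OF f2] frame_arr[OF f3] by simp
        qed
        have val: "scalar \<sigma>1 ''val'' = (\<Sum>e\<in>{0..<m}. X e * of_bool (ta e = s))" using S' by blast
        show "terminates (Seq close_network levels) \<sigma>3 (60 + ?N) ?Q"
        proof (rule last[OF _ _ _ _ _ _ _ _ _ _ _ _ _ _ _ _ _ _ _ refl V])
          show "of_bool (X e \<noteq> 0) \<le> ?F e" if "e \<in> {0..<m}" for e using cut(2)[OF that] low[OF that] by simp
          show "arr \<sigma>3 ''ex'' w = excess m ta he ?F w" for w using * by blast
        qed (use s1 adj norm pos le val ex3 in \<open>simp_all add: fr fa\<close>)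
      qed
    qed (use F1 in auto)
  qed (use zero in auto)
  moreover have "0 \<le> n * n" "0 \<le> m * n" using n_nonneg m by simp_all
  ultimately show ?thesis by (elim terminates_mono) (use n_nonneg m in auto)
qed

end

section \<open>Paths and covers in s-t DAGs\<close>

context st_dag
begin

lemma no_closed_walk: "awalk u p u \<Longrightarrow> p = []"
  using acyclic closed_w_imp_cycle[of p] by (auto simp: closed_w_def)

text \<open>A repeated vertex would yield a nonempty closed walk. Hence paths from \<open>s\<close>
  to \<open>t\<close> are just walks, which are easier to concatenate.\<close>

lemma awalk_apath: "awalk u p v \<Longrightarrow> apath u p v"
  using awalk_not_distinct_decomp[of u p v] no_closed_walk by (fastforce simp: apath_def)

text \<open>The number of proper ancestors serves as topological numbering: it grows along arcs and
  stays below the number of nodes.\<close>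

definition rank :: "'a \<Rightarrow> nat" where
  "rank v = card {u \<in> verts G. \<exists>p. p \<noteq> [] \<and> awalk u p v}"

lemma rank_less:
  assumes "e \<in> arcs G"
  shows "rank (tail G e) < rank (head G e)"
  unfolding rank_def
proof (rule psubset_card_mono)
  have e: "awalk (tail G e) [e] (head G e)" using assms by (rule arc_implies_awalk)
  show "{u \<in> verts G. \<exists>p. p \<noteq> [] \<and> awalk u p (tail G e)} \<subset> {u \<in> verts G. \<exists>p. p \<noteq> [] \<and> awalk u p (head G e)}"
  proof
    show "{u \<in> verts G. \<exists>p. p \<noteq> [] \<and> awalk u p (tail G e)} \<subseteq> {u \<in> verts G. \<exists>p. p \<noteq> [] \<and> awalk u p (head G e)}"
      using awalk_appendI[OF _ e] by blast
    have "tail G e \<notin> {u \<in> verts G. \<exists>p. p \<noteq> [] \<and> awalk u p (tail G e)}" using no_closed_walk by blast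
    moreover have "tail G e \<in> {u \<in> verts G. \<exists>p. p \<noteq> [] \<and> awalk u p (head G e)}"
      using e assms by (auto intro: exI[of _ "[e]"])
    ultimately show "{u \<in> verts G. \<exists>p. p \<noteq> [] \<and> awalk u p (tail G e)} \<noteq> {u \<in> verts G. \<exists>p. p \<noteq> [] \<and> awalk u p (head G e)}"
      by blast
  qed
qed simp

lemma rank_less_card:
  assumes "v \<in> verts G"
  shows "rank v < card (verts G)"
  unfolding rank_def
proof (rule psubset_card_mono)
  have "v \<notin> {u \<in> verts G. \<exists>p. p \<noteq> [] \<and> awalk u p v}" using no_closed_walk by blast
  then show "{u \<in> verts G. \<exists>p. p \<noteq> [] \<and> awalk u p v} \<subset> verts G" using assms by blast
qed simp

lemma in_arc_exists: "v \<in> verts G \<Longrightarrow> v \<noteq> s \<Longrightarrow> \<exists>e\<in>arcs G. head G e = v"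
  using unique_source by (force simp: in_arcs_def)

lemma out_arc_exists: "v \<in> verts G \<Longrightarrow> v \<noteq> t \<Longrightarrow> \<exists>e\<in>arcs G. tail G e = v"
  using unique_sink by (force simp: out_arcs_def)

lemma source_vertex: "s \<in> verts G" and head_neq_s: "e \<in> arcs G \<Longrightarrow> head G e \<noteq> s"
  using unique_source by (auto simp: in_arcs_def)

lemma sink_vertex: "t \<in> verts G" and tail_neq_t: "e \<in> arcs G \<Longrightarrow> tail G e \<noteq> t"
  using unique_sink by (auto simp: out_arcs_def)

text \<open>Going backwards along arcs lowers the rank, and only the unique source has no arc to go
  back.\<close>

lemma awalk_from_s: "v \<in> verts G \<Longrightarrow> \<exists>p. awalk s p v"
proof (induction "rank v" arbitrary: v rule: less_induct)
  case less
  show ?case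
  proof (cases "v = s")
    case True
    then show ?thesis using source_vertex awalk_Nil_iff by blast
  next
    case False
    then obtain e where e: "e \<in> arcs G" "head G e = v" using in_arc_exists less.prems by blast
    then obtain p where "awalk s p (tail G e)" using less.hyps[of "tail G e"] rank_less by fastforce
    then show ?thesis using awalk_appendI arc_implies_awalk[OF e(1)] e(2) by blast
  qed
qed

lemma awalk_to_t: "v \<in> verts G \<Longrightarrow> \<exists>p. awalk v p t"
proof (induction "card (verts G) - rank v" arbitrary: v rule: less_induct)
  case less
  show ?case
  proof (cases "v = t")
    case True
    then show ?thesis using sink_vertex awalk_Nil_iff by blast
  next
    case False
    then obtain e where e: "e \<in> arcs G" "tail G e = v" using out_arc_exists less.prems by blast
    then have "card (verts G) - rank (head G e) < card (verts G) - rank v"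
      using rank_less[OF e(1)] rank_less_card[of "head G e"] by simp
    then obtain p where "awalk (head G e) p t" using less.hyps[of "head G e"] e(1) by auto
    then show ?thesis using awalk_appendI arc_implies_awalk[OF e(1)] e(2) by blast
  qed
qed

lemma awalk_through:
  assumes e: "e \<in> arcs G"
  shows "\<exists>p q. awalk s (p @ [e] @ q) t"
proof -
  obtain p where "awalk s p (tail G e)" using awalk_from_s e by fastforce
  moreover obtain q where "awalk (head G e) q t" using awalk_to_t e by fastforce
  ultimately show ?thesis using awalk_appendI arc_implies_awalk[OF e] by blast
qed

lemma s_neq_t:
  assumes "e \<in> arcs G"
  shows "s \<noteq> t"
proof -
  obtain p q where "awalk s (p @ [e] @ q) t" using awalk_through[OF assms] by blast
  then show ?thesis using no_closed_walk[of s "p @ [e] @ q"] by auto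
qed

lemma st_path_iff_awalk: "st_path G s t p \<longleftrightarrow> awalk s p t"
  using awalk_apath awalkI_apath by (auto simp: st_path_def)

text \<open>One path through each arc gives a cover; with it the \<open>LEAST\<close> in
  \<open>width\<close> is attained.\<close>

lemma path_cover_exists: "\<exists>Ps. path_cover G s t Ps"
proof -
  have "\<exists>P. st_path G s t P \<and> e \<in> set P" if e: "e \<in> arcs G" for e
  proof -
    obtain p q where "awalk s (p @ [e] @ q) t" using awalk_through[OF e] by blast
    then show ?thesis using st_path_iff_awalk by (intro exI[of _ "p @ [e] @ q"]) simp
  qed
  then obtain f where f: "\<And>e. e \<in> arcs G \<Longrightarrow> st_path G s t (f e) \<and> e \<in> set (f e)" by metis
  obtain es where "set es = arcs G" using finite_list[OF finite_arcs] by blast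
  then have "path_cover G s t (map f es)" using f by (auto simp: path_cover_def)
  then show ?thesis ..
qed

text \<open>A walk that has entered a set that no arc leaves stays there, so it crosses into it at
  most once.\<close>

lemma card_cut_path_le:
  assumes R: "\<And>e. e \<in> arcs G \<Longrightarrow> tail G e \<in> R \<Longrightarrow> head G e \<in> R" and p: "awalk u p v"
  shows "card (set p \<inter> {e. tail G e \<notin> R \<and> head G e \<in> R}) \<le> (if u \<in> R then 0 else 1)"
  using p
proof (induction p arbitrary: u)
  case (Cons e p)
  let ?C = "{e. tail G e \<notin> R \<and> head G e \<in> R}"
  have e: "e \<in> arcs G" "u = tail G e" and p: "awalk (head G e) p v"
    using Cons.prems by (auto simp: awalk_Cons_iff)
  have IH: "card (set p \<inter> ?C) \<le> (if head G e \<in> R then 0 else 1)" by (rule Cons.IH[OF p])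
  show ?case
  proof (cases "e \<in> ?C")
    case True
    then have "set (e # p) \<inter> ?C = insert e (set p \<inter> ?C)" "card (set p \<inter> ?C) = 0" "u \<notin> R"
      using IH e by auto
    then show ?thesis by (simp add: card_insert_if)
  next
    case False
    then have eq: "set (e # p) \<inter> ?C = set p \<inter> ?C" by auto
    have "head G e \<notin> R \<Longrightarrow> u \<notin> R" using R[OF e(1)] e(2) by blast
    then have "(if head G e \<in> R then 0 else 1) \<le> (if u \<in> R then 0 else 1 :: nat)" by auto
    with IH show ?thesis unfolding eq by (rule order_trans)
  qed
qed simp

text \<open>Weak duality, general enough for covers of all arcs and for covers of the support
  only.\<close>

lemma card_cut_le_paths:
  assumes R: "\<And>e. e \<in> arcs G \<Longrightarrow> tail G e \<in> R \<Longrightarrow> head G e \<in> R"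
    and S: "S \<subseteq> {e. tail G e \<notin> R \<and> head G e \<in> R}" "S \<subseteq> (\<Union>P\<in>set Ps. set P)"
    and Ps: "\<forall>P\<in>set Ps. st_path G s t P"
  shows "card S \<le> length Ps"
proof -
  let ?C = "{e. tail G e \<notin> R \<and> head G e \<in> R}"
  have "card S \<le> card (\<Union>P\<in>set Ps. set P \<inter> ?C)" using S by (intro card_mono) auto
  also have "\<dots> \<le> (\<Sum>P\<in>set Ps. card (set P \<inter> ?C))" by (rule card_UN_le) simp
  also have "\<dots> \<le> (\<Sum>P\<in>set Ps. 1)"
  proof (rule sum_mono)
    fix P assume "P \<in> set Ps"
    then have "awalk s P t" using Ps st_path_iff_awalk by blast
    with R have "card (set P \<inter> ?C) \<le> (if s \<in> R then 0 else 1)" by (rule card_cut_path_le)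
    then show "card (set P \<inter> ?C) \<le> 1" by (cases "s \<in> R") simp_all
  qed
  also have "\<dots> \<le> length Ps" using card_length by simp
  finally show ?thesis .
qed

lemma count_list_path:
  assumes "awalk u P v"
  shows "int (count_list P e) = path_flow P e"
proof -
  have "distinct P" using awalk_apath[OF assms] distinct_verts_imp_distinct by (auto simp: apath_def)
  then show ?thesis by (induction P) (auto simp: path_flow_def)
qed

lemma support_covered:
  assumes "flow_decomposition G s t X D" "e \<in> arcs G" "X e \<noteq> 0"
  shows "\<exists>P\<in>set (map snd D). e \<in> set P"
proof (rule ccontr)
  assume "\<not> ?thesis"
  then have "(\<Sum>(w, P)\<leftarrow>D. w * path_flow P e) = (\<Sum>x\<leftarrow>D. 0)"
    by (intro arg_cong[where f = sum_list] map_cong) (auto simp: path_flow_def)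
  then show False using assms by (simp add: flow_decomposition_def)
qed

text \<open>Every node other than \<open>t\<close> is the tail of some arc.\<close>

lemma card_verts_le: "card (verts G) \<le> card (arcs G) + 1"
proof -
  have "verts G \<subseteq> insert t (tail G ` arcs G)" using out_arc_exists by blast
  then have "card (verts G) \<le> card (insert t (tail G ` arcs G))" by (intro card_mono) auto
  also have "\<dots> \<le> Suc (card (tail G ` arcs G))" by (rule card_insert_le_m1) auto
  also have "\<dots> \<le> card (arcs G) + 1" using card_image_le[OF finite_arcs, of "tail G"] by simp
  finally show ?thesis .
qed

end

section \<open>The final estimate and the theorem\<close>

lemma sum_int_lessThan: "(\<Sum>e\<in>{0..<int M}. f e) = (\<Sum>e<M. f (int e))"
  by (rule sum.reindex_bij_witness[of _ int nat]) auto

text \<open>At its use \<open>W\<close> is the minimum of the width \<open>w\<close> and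
  \<open>m\<close>, and both bounds matter. The part that grows with \<open>L\<close> uses
  \<open>W * n \<le> 2 * (m * w)\<close> and is charged to \<open>m * w * L\<close>; the two further
  copies of \<open>S\<close> use \<open>W \<le> m\<close> and are charged to \<open>m * n\<close>,
  since for \<open>L = 0\<close> no term with \<open>w\<close> is available.\<close>

lemma time_bound:
  fixes n m W L w :: int
  assumes "1 \<le> m" "1 \<le> n" "n \<le> m + 1" "0 \<le> W" "W \<le> m" "W \<le> w" "1 \<le> w" "0 \<le> L"
  shows "10000 * (n * n + m * n + n + m + 1) + 6000 * (n + (m + 1) + W * n + 1) * (L + 2) \<le> 300000 * (m * (n + w * L))"
proof -
  have n2: "n \<le> 2 * m" using assms by simp
  have 1: "n * n \<le> 2 * (m * n)" using mult_right_mono[OF n2, of n] assms by simp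
  have 2: "n \<le> m * n" "m \<le> m * n"
    using mult_right_mono[of 1 m n] mult_left_mono[of 1 n m] assms by simp_all
  have 3: "W * n \<le> m * n" using mult_right_mono[of W m n] assms by simp
  have 4: "W * n \<le> 2 * (m * w)"
    using mult_mono[of W w n "2 * m"] n2 assms by (simp add: algebra_simps)
  have 5: "m \<le> m * w" using mult_left_mono[of 1 w m] assms by simp
  define S where "S = n + (m + 1) + W * n + 1"
  have "S \<le> 7 * (m * n)" unfolding S_def using 2 3 assms(1,2) by linarith
  moreover have "S * L \<le> 8 * (m * w) * L"
    unfolding S_def using 4 5 n2 assms by (intro mult_right_mono) linarith+
  moreover have "6000 * S * (L + 2) = 6000 * (S * L) + 12000 * S" by (simp add: algebra_simps)
  moreover have "300000 * (m * (n + w * L)) = 300000 * (m * n) + 300000 * (m * w * L)" by (simp add: algebra_simps)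
  moreover have "0 \<le> m * w * L" using assms by simp
  moreover have "8 * (m * w) * L = 8 * (m * w * L)" by simp
  moreover have "10000 * (q + a + n + m + 1) + (6000 * T + 12000 * S) \<le> 300000 * a + 300000 * b"
    if "S \<le> 7 * a" "T \<le> 8 * b" "0 \<le> b" "q \<le> 2 * a" "n \<le> a" "m \<le> a" for q a T b :: int
    using that assms(1) by simp
  ultimately show ?thesis unfolding S_def[symmetric] using 1 2 by metis
qed

theorem corollary26:
  shows "\<exists>(A :: prog) (C :: real).
    \<forall>(G :: (nat, nat) pre_digraph) (s :: nat) (t :: nat) (X :: nat \<Rightarrow> int).
      numbered G \<and> st_dag G s t \<and> is_flow G s t X \<and> (\<exists>e \<in> arcs G. X e \<noteq> 0) \<longrightarrow>
      (\<exists>\<tau> \<sigma> D.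
         runs A (initial_state G s t X) \<tau> \<sigma> \<and>
         outputs \<sigma> D \<and>
         flow_decomposition G s t X D \<and>
         int (length D) \<le> (\<lceil>log 2 (real_of_int (flow_norm G X))\<rceil> + 1) * int (mfd_int G s t X) \<and>
         real \<tau> \<le> C * (real (card (arcs G)) *
           (real (card (verts G)) +
            real (width G s t) * real_of_int \<lceil>log 2 (real_of_int (flow_norm G X))\<rceil>)))"
proof (rule exI[of _ algorithm], rule exI[of _ 300000], intro allI impI, elim conjE)
  fix G :: "(nat, nat) pre_digraph" and s t :: nat and X :: "nat \<Rightarrow> int"
  assume num: "numbered G" and dag: "st_dag G s t" and flow: "is_flow G s t X"
    and nz: "\<exists>e \<in> arcs G. X e \<noteq> 0"
  interpret st_dag G s t by (rule dag)
  define M where "M = card (arcs G)"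
  define N where "N = card (verts G)"
  have verts: "verts G = {..<N}" and arcs: "arcs G = {..<M}"
    using num by (simp_all add: numbered_def M_def N_def)
  let ?ta = "input_array M (\<lambda>e. int (tail G e))" and ?he = "input_array M (\<lambda>e. int (head G e))"
    and ?X = "input_array M X"
  define rk where "rk v = int (rank (nat v))" for v
  have arc: "nat e \<in> arcs G" "?ta e = int (tail G (nat e))" "?he e = int (head G (nat e))" "?X e = X (nat e)"
    if "e \<in> {0..<int M}" for e
    using that by (auto simp: arcs input_array_def)
  have tail_lt: "tail G e < N" and head_lt: "head G e < N" if "e \<in> arcs G" for e
    using tail_in_verts[OF that] head_in_verts[OF that] verts by simp_all
  have excess: "excess (int M) ?ta ?he ?X (int v) = (\<Sum>e\<in>in_arcs G v. X e) - (\<Sum>e\<in>out_arcs G v. X e)" for v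
  proof -
    have "excess (int M) ?ta ?he ?X (int v) = (\<Sum>e<M. X e * (of_bool (head G e = v) - of_bool (tail G e = v)))"
      unfolding excess_def sum_int_lessThan by (rule sum.cong) (simp_all add: input_array_def)
    also have "\<dots> = (\<Sum>e<M. if head G e = v then X e else 0) - (\<Sum>e<M. if tail G e = v then X e else 0)"
      unfolding sum_subtractf[symmetric] by (rule sum.cong) auto
    also have "(\<Sum>e<M. if head G e = v then X e else 0) = (\<Sum>e\<in>in_arcs G v. X e)"
      by (rule sum.mono_neutral_cong_right) (auto simp: in_arcs_def arcs)
    also have "(\<Sum>e<M. if tail G e = v then X e else 0) = (\<Sum>e\<in>out_arcs G v. X e)"
      by (rule sum.mono_neutral_cong_right) (auto simp: out_arcs_def arcs)
    finally show ?thesis .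
  qed
  obtain e0 where e0: "e0 \<in> arcs G" "X e0 \<noteq> 0" using nz by blast
  have M_pos: "0 < M" using e0(1) arcs by auto
  have st: "s < N" "t < N" "s \<noteq> t"
    using source_vertex sink_vertex verts s_neq_t[OF e0(1)] by simp_all
  interpret I: flow_instance "int N" "int M" "int s" "int t" ?ta ?he rk ?X
  proof
    fix e assume e: "e \<in> {0..<int M}"
    note a = arc[OF e]
    show "?ta e \<in> {0..<int N}" "?he e \<in> {0..<int N}" using a tail_lt head_lt by auto
    show "rk (?ta e) < rk (?he e)" using a rank_less[OF a(1)] by (simp add: rk_def)
    show "?he e \<noteq> int s" "?ta e \<noteq> int t" using a head_neq_s tail_neq_t by auto
  next
    fix v assume v: "v \<in> {0..<int N}"
    then have nv: "nat v \<in> verts G" by (auto simp: verts)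
    show "0 \<le> rk v \<and> rk v < int N" using rank_less_card[OF nv] by (simp add: rk_def N_def)
    show "\<exists>e\<in>{0..<int M}. ?ta e = v" if "v \<noteq> int t"
    proof -
      have "nat v \<noteq> t" using that v by auto
      then obtain e where "e \<in> arcs G" "tail G e = nat v" using out_arc_exists[OF nv] by blast
      then show ?thesis using v by (intro bexI[of _ "int e"]) (auto simp: input_array_def arcs)
    qed
    show "\<exists>e\<in>{0..<int M}. ?he e = v" if "v \<noteq> int s"
    proof -
      have "nat v \<noteq> s" using that v by auto
      then obtain e where "e \<in> arcs G" "head G e = nat v" using in_arc_exists[OF nv] by blast
      then show ?thesis using v by (intro bexI[of _ "int e"]) (auto simp: input_array_def arcs)
    qed
  next
    fix w assume w: "w \<noteq> int s" "w \<noteq> int t"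
    show "excess (int M) ?ta ?he ?X w = 0"
    proof (cases "w \<in> {0..<int N}")
      case True
      then obtain v where v: "w = int v" "v \<in> verts G" using verts by (metis atLeastLessThan_iff lessThan_iff of_nat_less_iff zero_le_imp_eq_int)
      then show ?thesis using excess[of v] flow w by (auto simp: is_flow_def)
    next
      case False
      have "?ta e \<noteq> w" "?he e \<noteq> w" if "e \<in> {0..<int M}" for e
        using arc[OF that] tail_lt head_lt False by auto
      then show ?thesis by (simp add: excess_def)
    qed
  qed (use M_pos st in auto)
  define Nm where "Nm = flow_norm G X"
  have norm: "\<bar>X e\<bar> \<le> Nm" if "e \<in> arcs G" for e
    unfolding Nm_def flow_norm_def using that by (intro Max_ge) auto
  have "0 < Nm" using norm[OF e0(1)] e0(2) by auto
  then have log_nonneg: "0 \<le> log 2 (real_of_int Nm)" by simp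
  define L where "L = nat \<lceil>log 2 (real_of_int Nm)\<rceil>"
  have L: "int L = \<lceil>log 2 (real_of_int Nm)\<rceil>" using log_nonneg by (simp add: L_def)
  have "Nm \<le> 2 ^ L"
  proof -
    have "real_of_int Nm = 2 powr (log 2 (real_of_int Nm))" using \<open>0 < Nm\<close> by simp
    also have "\<dots> \<le> 2 powr (real L)"
    proof (rule powr_mono)
      have "log 2 (real_of_int Nm) \<le> real_of_int \<lceil>log 2 (real_of_int Nm)\<rceil>" by (rule le_of_int_ceiling)
      also have "\<dots> = real L" using L by (metis of_int_of_nat_eq)
      finally show "log 2 (real_of_int Nm) \<le> real L" .
    qed simp
    also have "\<dots> = real_of_int (2 ^ L)" by (simp add: powr_realpow)
    finally show ?thesis by (simp only: of_int_le_iff)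
  qed
  then have XL: "\<bar>?X e\<bar> \<le> 2 ^ L" if "e \<in> {0..<int M}" for e
    using arc[OF that] norm by (metis order_trans)
  \<comment> \<open>One inequality for two purposes: with a minimum cover it bounds cuts, and so the
    time, by the width; with a minimum decomposition it bounds the output by
    \<open>mfd_int\<close>.\<close>
  have cut_le: "card (I.cut_support R) \<le> length Ps"
    if R: "I.closed_cut R" and Ps: "\<forall>P\<in>set Ps. st_path G s t P"
      and cover: "\<And>e. e \<in> arcs G \<Longrightarrow> X e \<noteq> 0 \<Longrightarrow> \<exists>P\<in>set Ps. e \<in> set P" for R Ps
  proof -
    let ?R = "{v. int v \<in> R}"
    have closed: "head G e \<in> ?R" if "e \<in> arcs G" "tail G e \<in> ?R" for e
    proof -
      have e: "int e \<in> {0..<int M}" using that(1) arcs by auto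
      then have "?ta (int e) \<in> R \<longrightarrow> ?he (int e) \<in> R" using R unfolding I.closed_cut_def by blast
      then show ?thesis using that arc(2,3)[OF e] by simp
    qed
    have "card (I.cut_support R) = card (nat ` I.cut_support R)"
      by (rule card_image[symmetric]) (auto simp: inj_on_def I.cut_support_def)
    also have "\<dots> \<le> length Ps"
    proof (rule card_cut_le_paths[OF closed _ _ Ps])
      show "nat ` I.cut_support R \<subseteq> {e. tail G e \<notin> ?R \<and> head G e \<in> ?R}"
        using arc unfolding I.cut_support_def by auto
      show "nat ` I.cut_support R \<subseteq> (\<Union>P\<in>set Ps. set P)"
        using arc cover unfolding I.cut_support_def by fastforce
    qed
    finally show ?thesis .
  qed
  obtain Ps where Ps: "path_cover G s t Ps" "length Ps = width G s t"
    using LeastI_ex[of "\<lambda>k. \<exists>Ps. path_cover G s t Ps \<and> length Ps = k"] path_cover_exists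
    unfolding width_def by blast
  have width_pos: "1 \<le> width G s t" using Ps e0(1) by (cases Ps) (auto simp: path_cover_def)
  \<comment> \<open>The second bound is trivial for a cut, but \<open>time_bound\<close> needs it to
    charge the levels outside of the factor \<open>L\<close> to \<open>m * n\<close>.\<close>
  let ?W = "min (int (width G s t)) (int M)"
  have W: "int (card (I.cut_support R)) \<le> ?W" if "I.closed_cut R" for R
  proof -
    have "card (I.cut_support R) \<le> card {0..<int M}" by (rule card_mono) (auto simp: I.cut_support_def)
    moreover have "card (I.cut_support R) \<le> width G s t"
      unfolding Ps(2)[symmetric] using Ps(1) by (intro cut_le[OF that]) (auto simp: path_cover_def)
    ultimately show ?thesis by simp
  qed
  let ?\<sigma> = "initial_state G s t X"
  have "terminates algorithm ?\<sigma> (10000 * (int N * int N + int M * int N + int N + int M + 1)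
      + 6000 * (int N + (int M + 1) + ?W * int N + 1) * (int L + 2))
    (\<lambda>\<sigma>'. \<exists>D V. written \<sigma>' D [] \<and> (\<forall>(w, P)\<in>set D. arc_walk (int M) ?ta ?he (int s) P (int t)) \<and>
      (\<forall>e\<in>{0..<int M}. ?X e = decomposed D e) \<and> int (length D) \<le> (int L + 1) * V \<and>
      (V = 0 \<or> (\<exists>R. I.closed_cut R \<and> V = int (card (I.cut_support R)))))"
  proof (rule I.terminates_algorithm)
    show "\<exists>e\<in>{0..<int M}. ?X e \<noteq> 0"
      using e0 arcs by (intro bexI[of _ "int e0"]) (auto simp: input_array_def)
  qed (use W XL in \<open>auto simp: initial_state_def M_def N_def\<close>)
  then obtain \<tau> \<sigma> D V where run: "runs algorithm ?\<sigma> \<tau> \<sigma>"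
    and \<tau>: "int \<tau> \<le> 10000 * (int N * int N + int M * int N + int N + int M + 1)
      + 6000 * (int N + (int M + 1) + ?W * int N + 1) * (int L + 2)"
    and D: "written \<sigma> D []" "\<forall>(w, P)\<in>set D. arc_walk (int M) ?ta ?he (int s) P (int t)"
      "\<forall>e\<in>{0..<int M}. ?X e = decomposed D e" "int (length D) \<le> (int L + 1) * V"
      "V = 0 \<or> (\<exists>R. I.closed_cut R \<and> V = int (card (I.cut_support R)))"
    unfolding terminates_def by blast
  define D' where "D' = map (\<lambda>(w, P). (w, map nat P)) D"
  \<comment> \<open>Back from machine integers to arcs of \<open>G\<close>. The equation
    \<open>map int (map nat P) = P\<close> is there because \<open>outputs\<close> compares the
    cells with a list of the form \<open>map int\<close>.\<close>
  have walk: "awalk u (map nat P) t \<and> map int (map nat P) = P \<and> (\<forall>e. count_list (map nat P) e = count_list P (int e))"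
    if "arc_walk (int M) ?ta ?he (int u) P (int t)" for u P
    using that
  proof (induction P arbitrary: u)
    case Nil
    then show ?case using sink_vertex by (simp add: awalk_Nil_iff)
  next
    case (Cons e P)
    then have e: "e \<in> {0..<int M}" "?ta e = int u" "arc_walk (int M) ?ta ?he (?he e) P (int t)" by auto
    note a = arc[OF e(1)]
    have "arc_walk (int M) ?ta ?he (int (head G (nat e))) P (int t)" using e(3) a(3) by simp
    note IH = Cons.IH[OF this]
    have "tail G (nat e) = u" using e(2) a(2) by simp
    then show ?case using IH a(1) e(1) by (auto simp: awalk_Cons_iff)
  qed
  have outs: "outputs \<sigma> D'"
    unfolding outputs_def
  proof (intro conjI allI impI)
    show "scalar \<sigma> ''size'' = int (length D')" using D(1) by (simp add: written_def D'_def)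
    fix i assume "i < length D'"
    then have i: "i < length D" by (simp add: D'_def)
    obtain w P where wP: "D ! i = (w, P)" by fastforce
    then have "(w, P) \<in> set D" using i by (metis nth_mem)
    then have P: "map int (map nat P) = P" using D(2) walk by blast
    have "arr \<sigma> ''weight'' (int i) = fst (D ! i) \<and>
      map (arr \<sigma> ''path'') [arr \<sigma> ''start'' (int i) .. arr \<sigma> ''start'' (int i + 1) - 1] = snd (D ! i)"
      using D(1) i unfolding written_def by blast
    moreover have "D' ! i = (w, map nat P)" using i wP by (simp add: D'_def)
    ultimately show "arr \<sigma> ''weight'' (int i) = fst (D' ! i)"
      "map (arr \<sigma> ''path'') [arr \<sigma> ''start'' (int i) .. arr \<sigma> ''start'' (int i + 1) - 1] = map int (snd (D' ! i))"
      using P wP by (simp_all only: fst_conv snd_conv)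
  qed
  have dec: "flow_decomposition G s t X D'"
    unfolding flow_decomposition_def
  proof (intro conjI ballI)
    show "case x of (w, P) \<Rightarrow> st_path G s t P" if "x \<in> set D'" for x
      using that D(2) walk st_path_iff_awalk by (fastforce simp: D'_def)
    fix e assume e: "e \<in> arcs G"
    then have e': "int e \<in> {0..<int M}" by (simp add: arcs)
    have "X e = decomposed D (int e)" using D(3) e' arc(4)[OF e'] by simp
    also have "\<dots> = (\<Sum>(w, P)\<leftarrow>D'. w * path_flow P e)"
      unfolding decomposed_def D'_def map_map
    proof (intro arg_cong[where f = sum_list] map_cong refl)
      fix x assume x: "x \<in> set D"
      obtain w P where wP: "x = (w, P)" by fastforce
      then have "arc_walk (int M) ?ta ?he (int s) P (int t)" using x D(2) by blast
      from walk[OF this] have "int (count_list P (int e)) = path_flow (map nat P) e"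
        using count_list_path[of s "map nat P" t e] by simp
      then show "(case x of (w, P) \<Rightarrow> w * int (count_list P (int e))) =
          ((\<lambda>(w, P). w * path_flow P e) \<circ> (\<lambda>(w, P). (w, map nat P))) x"
        by (simp add: wP)
    qed
    finally show "X e = (\<Sum>(w, P)\<leftarrow>D'. w * path_flow P e)" .
  qed
  \<comment> \<open>The decomposition just found shows that the \<open>LEAST\<close> in
    \<open>mfd_int\<close> is attained.\<close>
  obtain D0 where D0: "flow_decomposition G s t X D0" "length D0 = mfd_int G s t X"
    using LeastI_ex[of "\<lambda>k. \<exists>D. flow_decomposition G s t X D \<and> length D = k"] dec
    unfolding mfd_int_def by blast
  have "V \<le> int (mfd_int G s t X)"
  proof (cases "V = 0")
    case False
    then obtain R where R: "I.closed_cut R" "V = int (card (I.cut_support R))" using D(5) by blast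
    have "card (I.cut_support R) \<le> length (map snd D0)"
    proof (rule cut_le[OF R(1)])
      show "\<forall>P\<in>set (map snd D0). st_path G s t P" using D0(1) by (auto simp: flow_decomposition_def)
      show "\<exists>P\<in>set (map snd D0). e \<in> set P" if "e \<in> arcs G" "X e \<noteq> 0" for e
        by (rule support_covered[OF D0(1) that])
    qed
    then show ?thesis using R(2) D0(2) by simp
  qed simp
  then have "(int L + 1) * V \<le> (int L + 1) * int (mfd_int G s t X)" by (intro mult_left_mono) auto
  then have size: "int (length D') \<le> (\<lceil>log 2 (real_of_int (flow_norm G X))\<rceil> + 1) * int (mfd_int G s t X)"
    using D(4) L by (simp add: D'_def Nm_def)
  have "int \<tau> \<le> 300000 * (int M * (int N + int (width G s t) * int L))"
    using \<tau> time_bound[of "int M" "int N" ?W "int (width G s t)" "int L"] M_pos st card_verts_le width_pos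
    by (simp add: M_def N_def)
  then have "real_of_int (int \<tau>) \<le> real_of_int (300000 * (int M * (int N + int (width G s t) * int L)))"
    by (simp only: of_int_le_iff)
  also have "\<dots> = 300000 * (real M * (real N + real (width G s t) * real L))" by simp
  also have "real L = real_of_int \<lceil>log 2 (real_of_int (flow_norm G X))\<rceil>"
    using L unfolding Nm_def by (metis of_int_of_nat_eq)
  finally have "real \<tau> \<le> 300000 * (real (card (arcs G)) * (real (card (verts G)) +
      real (width G s t) * real_of_int \<lceil>log 2 (real_of_int (flow_norm G X))\<rceil>))"
    by (simp add: M_def N_def)
  with run outs dec size show "\<exists>\<tau> \<sigma> D. runs algorithm (initial_state G s t X) \<tau> \<sigma> \<and> outputs \<sigma> D \<and>
      flow_decomposition G s t X D \<and>
      int (length D) \<le> (\<lceil>log 2 (real_of_int (flow_norm G X))\<rceil> + 1) * int (mfd_int G s t X) \<and>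
      real \<tau> \<le> 300000 * (real (card (arcs G)) *
        (real (card (verts G)) +
         real (width G s t) * real_of_int \<lceil>log 2 (real_of_int (flow_norm G X))\<rceil>))"
    by blast
qed

end
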